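(* In the setting described in the context, let $\widehat{B}_1,\widehat{B}_2$ be disjoint bases of $\widehat{M}$, let $I=\{i_1,i_2,i_3,i_4\}\subseteq\{1,\dots,m\}$, $\widehat{H}=\widehat{H}_I$, and assume $\widehat{B}_1\cap E(\widehat{H})=\{\widehat{e}_{i_1i_2}\}$ and $\widehat{B}_2\cap E(\widehat{H})=\{\widehat{e}_{i_3i_4}\}$. For $i=1,2$ let $\widehat{C}_i$ be the unique circuit of $\widehat{M}$ contained in $\widehat{B}_i\cup\{\widehat{e}_{i_1i_2},\widehat{e}_{i_3i_4}\}$ and $\widehat{L}_i$ the subgraph of $\widehat{G}$ induced by $\widehat{C}_i$. If $(\widehat{B}_1,\widehat{B}_2)$ is not $\widehat{e}_{i_1i_2},\widehat{e}_{i_3i_4}$-switchable, then for $i=1,2$, $\widehat{L}_i$ consists of two vertex-disjoint cycles of $\widehat{G}$ joined by a non-trivial path, each cycle of $\widehat{L}_i$ containing exactly one edge of $\{\widehat{e}_{i_1i_2},\widehat{e}_{i_3i_4}\}$.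
   Context: Graphs may have loops and parallel edges. A biased graph $(G,\mathcal{C})$ is a graph with a set $\mathcal{C}$ of cycles (balanced; others unbalanced) such that if two cycles of a theta graph (three cycles $C_1,C_2,C_3$ with $C_i\triangle C_j=C_k$) lie in $\mathcal{C}$ so does the third; it is linear if every cycle that is a symmetric difference of cycles of $\mathcal{C}$ lies in $\mathcal{C}$. The frame matroid $M(\Omega)$ on $E(G)$ has bases the maximal edge sets $A$ such that each component of $G[A]$ has at most one cycle, which if present is unbalanced; $\mathcal{B}(\cdot)$ is the set of bases. Setting: $\Omega=(G,\mathcal{C})$ linear, no balanced loops, $v\in V(G)$, $e_1,\dots,e_m$ the edges at $v$, $e_i=v\,v(e_i)$. The $v$-deleted biased graph $\widehat{\Omega}=(\widehat{G},\widehat{\mathcal{C}})$: $V(\widehat{G})=V(G)\setminus\{v\}$, $E(\widehat{G})=E(G-v)\cup\widehat{E}$, where for $i\ne j$ with not both $e_i,e_j$ loops there is an edge $\widehat{e}_{ij}=\widehat{e}_{ji}$ joining $v(e_i),v(e_j)$ if neither is a loop and a loop (stem loop) at $v(e_i)$ if exactly $e_j$ is a loop. Pull-backs: $\mathfrak{E}(\widehat{e})=\{\widehat{e}\}$ for $\widehat{e}\notin\widehat{E}$, $\mathfrak{E}(\widehat{e}_{ij})=\{e_i,e_j\}$, extended to sets by symmetric difference. For a cycle $\widehat{C}$ meeting $\widehat{E}$ (not a stem loop) with $\mathfrak{E}(\widehat{C})\neq\emptyset$, the pull-back splits uniquely into cycles (petals) pairwise meeting only at $v$. $\widehat{\mathcal{A}}$: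 cycles $\widehat{C}$, not stem loops, with $\widehat{C}\in\mathcal{C}$, or $\mathfrak{E}(\widehat{C})=\emptyset$, or ($\widehat{C}$ meets $\widehat{E}$, $\mathfrak{E}(\widehat{C})\ne\emptyset$, all petals balanced). $\widehat{\mathcal{C}}$ = cycles expressible as symmetric differences of cycles of $\widehat{\mathcal{A}}$ minus its loops; $\widehat{M}=M(\widehat{\Omega})$. For $I\subseteq\{1,\dots,m\}$, $\widehat{H}=\widehat{H}_I$ is the subgraph induced by $\{\widehat{e}_{ij}:i,j\in I\}$, $\widehat{F}_I(\widehat{B})=\{\widehat{e}\in E(\widehat{H}):(\widehat{B}\setminus E(\widehat{H}))\cup\{\widehat{e}\}\in\mathcal{B}(\widehat{M})\}$. Edges $\widehat{e}_{ij},\widehat{e}_{kl}$ of $\widehat{H}$ are non-incident when $\{i,j\}\cap\{k,l\}=\emptyset$. A pair of disjoint bases $(\widehat{A}_1,\widehat{A}_2)$ with $(\widehat{A}_1\cup\widehat{A}_2)\cap E(\widehat{H})=\{\widehat{a},\widehat{b}\}$ is $\widehat{H}$-viable if $\widehat{a},\widehat{b}$ are non-incident or both lie in the same $\widehat{A}_i$. It is $\widehat{e}',\widehat{f}'$-amenable (distinct $\widehat{e}',\widehat{f}'\in E(\widehat{H})$) if there are disjoint bases $\widehat{A}_1',\widehat{A}_2'$ with $\widehat{A}_i'\setminus E(\widehat{H})=\widehat{A}_i\setminus E(\widehat{H})$ and $(\widehat{A}_1'\cup\widehat{A}_2')\cap E(\widehat{H})=\{\widehat{e}',\widehat{f}'\}$;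 write $(\widehat{A}_1,\widehat{A}_2)\to_{\widehat{e}',\widehat{f}'}(\widehat{A}_1',\widehat{A}_2')$. For $\widehat{H}$-viable pairs, $(\widehat{A}_1,\widehat{A}_2)\curvearrowright_1(\widehat{B}_1,\widehat{B}_2)$ if for some $\widehat{c}_1,\widehat{c}_2$ there are $\widehat{H}$-viable pairs with $(\widehat{A}_1,\widehat{A}_2)\to_{\widehat{c}_1,\widehat{c}_2}(\widehat{A}_1',\widehat{A}_2')$, $(\widehat{B}_1,\widehat{B}_2)\to_{\widehat{c}_1,\widehat{c}_2}(\widehat{B}_1',\widehat{B}_2')$, and $(\widehat{B}_1',\widehat{B}_2')$ obtained from $(\widehat{A}_1',\widehat{A}_2')$ by one symmetric exchange; $\curvearrowright$ is a finite chain of $\curvearrowright_1$ steps. For disjoint bases with non-incident $\widehat{e}\in\widehat{F}_I(\widehat{B}_1)$, $\widehat{f}\in\widehat{F}_I(\widehat{B}_2)$, $(\widehat{B}_1,\widehat{B}_2)$ is $\widehat{e},\widehat{f}$-switchable if some $(\widehat{B}_1',\widehat{B}_2')$ with $(\widehat{B}_1,\widehat{B}_2)\curvearrowright(\widehat{B}_1',\widehat{B}_2')$ is $\widehat{e}',\widehat{f}'$-amenable for some non-incident $\widehat{e}',\widehat{f}'\in E(\widehat{H})\setminus\{\widehat{e},\widehat{f}\}$.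
   Formalization: New edges ê_ij that are loops arising from a balanced pair of parallel edges e_i, e_j at v are deleted from Ĝ, rather than kept as unbalanced loops of Ω̂; with them kept as unbalanced loops the statement is false. *)

theory Defs
  imports Main
begin

section \<open>Graphs with loops and parallel edges\<close>

text \<open>The value of \<open>ends\<close> is the set of ends of an edge: a singleton for a loop, a two-element
  set otherwise. Its values outside \<open>edges\<close> are irrelevant.\<close>

record ('v, 'e) mgraph =
  verts :: "'v set"
  edges :: "'e set"
  ends :: "'e \<Rightarrow> 'v set"

definition finite_mgraph :: "('v, 'e) mgraph \<Rightarrow> bool" where
  "finite_mgraph G \<longleftrightarrow> finite (verts G) \<and> finite (edges G) \<and>
     (\<forall>e\<in>edges G. \<exists>u\<in>verts G. \<exists>w\<in>verts G. ends G e = {u, w})"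

definition is_loop :: "('v, 'e) mgraph \<Rightarrow> 'e \<Rightarrow> bool" where
  "is_loop G e \<longleftrightarrow> (\<exists>u. ends G e = {u})"

definition edge_verts :: "('v, 'e) mgraph \<Rightarrow> 'e set \<Rightarrow> 'v set" where
  "edge_verts G A = (\<Union>e\<in>A. ends G e)"

text \<open>The subgraph \<open>G[A]\<close> induced by a set of edges.\<close>

definition edge_induced :: "('v, 'e) mgraph \<Rightarrow> 'e set \<Rightarrow> ('v, 'e) mgraph" where
  "edge_induced G A = \<lparr>verts = edge_verts G A, edges = A, ends = ends G\<rparr>"

definition is_path :: "('v, 'e) mgraph \<Rightarrow> 'v list \<Rightarrow> 'e list \<Rightarrow> bool" where
  "is_path G vs es \<longleftrightarrow>
     length vs = Suc (length es) \<and> distinct vs \<and> set vs \<subseteq> verts G \<and> set es \<subseteq> edges G \<and>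
     (\<forall>i<length es. ends G (es ! i) = {vs ! i, vs ! Suc i})"

text \<open>Cycles are identified with their edge sets. A loop is a cycle of length 1 and two parallel
  edges form a cycle of length 2.\<close>

definition is_cycle :: "('v, 'e) mgraph \<Rightarrow> 'e set \<Rightarrow> bool" where
  "is_cycle G D \<longleftrightarrow> (\<exists>vs es.
     es \<noteq> [] \<and> length vs = length es \<and> distinct vs \<and> distinct es \<and>
     set vs \<subseteq> verts G \<and> set es \<subseteq> edges G \<and> D = set es \<and>
     (\<forall>i<length es. ends G (es ! i) = {vs ! i, vs ! (Suc i mod length es)}))"

text \<open>Components, given by their vertex sets.\<close>

definition components :: "('v, 'e) mgraph \<Rightarrow> 'v set set" where
  "components G =
     {{y. (x, y) \<in> {(a, b). \<exists>e\<in>edges G. ends G e = {a, b}}\<^sup>*} |x. x \<in> verts G}"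

text \<open>The symmetric difference of a family of sets indexed by a finite set \<open>X\<close>.\<close>

definition sym_diff_fam :: "('i \<Rightarrow> 'a set) \<Rightarrow> 'i set \<Rightarrow> 'a set" where
  "sym_diff_fam f X = {x. odd (card {i\<in>X. x \<in> f i})}"

text \<open>All cycles that are symmetric differences of (finitely many) members of \<open>\<A>\<close>.\<close>

definition cycle_span :: "('v, 'e) mgraph \<Rightarrow> 'e set set \<Rightarrow> 'e set set" where
  "cycle_span G \<A> =
     {D. is_cycle G D \<and> (\<exists>S. finite S \<and> S \<subseteq> \<A> \<and> D = sym_diff_fam (\<lambda>A. A) S)}"


section \<open>Biased graphs and frame matroids\<close>

definition biased_graph :: "('v, 'e) mgraph \<Rightarrow> 'e set set \<Rightarrow> bool" where
  "biased_graph G \<C> \<longleftrightarrow> finite_mgraph G \<and> (\<forall>D\<in>\<C>. is_cycle G D) \<and>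
     (\<forall>C1 C2 C3. is_cycle G C1 \<and> is_cycle G C2 \<and> is_cycle G C3 \<and>
        C3 = (C1 - C2) \<union> (C2 - C1) \<and> C1 \<in> \<C> \<and> C2 \<in> \<C> \<longrightarrow> C3 \<in> \<C>)"

definition linear_bias :: "('v, 'e) mgraph \<Rightarrow> 'e set set \<Rightarrow> bool" where
  "linear_bias G \<C> \<longleftrightarrow> cycle_span G \<C> \<subseteq> \<C>"

definition frame_indep :: "('v, 'e) mgraph \<Rightarrow> 'e set set \<Rightarrow> 'e set \<Rightarrow> bool" where
  "frame_indep G \<C> A \<longleftrightarrow> A \<subseteq> edges G \<and>
     (\<forall>X\<in>components (edge_induced G A).
        \<forall>D. is_cycle (edge_induced G A) D \<and> edge_verts G D \<subseteq> X \<longrightarrow>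
          D \<notin> \<C> \<and>
          (\<forall>D'. is_cycle (edge_induced G A) D' \<and> edge_verts G D' \<subseteq> X \<longrightarrow> D' = D))"

definition frame_bases :: "('v, 'e) mgraph \<Rightarrow> 'e set set \<Rightarrow> 'e set set" where
  "frame_bases G \<C> =
     {A. frame_indep G \<C> A \<and> (\<forall>A'. frame_indep G \<C> A' \<and> A \<subseteq> A' \<longrightarrow> A' = A)}"

text \<open>Circuits of the matroid on \<open>E\<close> with set of bases \<open>\<B>\<close>: the minimal subsets of \<open>E\<close> that are
  contained in no basis.\<close>

definition is_circuit :: "'a set \<Rightarrow> 'a set set \<Rightarrow> 'a set \<Rightarrow> bool" where
  "is_circuit E \<B> C \<longleftrightarrow> C \<subseteq> E \<and> \<not> (\<exists>B\<in>\<B>. C \<subseteq> B) \<and> (\<forall>D. D \<subset> C \<longrightarrow> (\<exists>B\<in>\<B>. D \<subseteq> B))"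


section \<open>The vertex-deleted biased graph\<close>

text \<open>The edges at \<open>v\<close> are \<open>e 1, \<dots>, e m\<close>. An edge of \<open>G - v\<close> is kept as \<open>Old f\<close>, and
  \<open>Hat {i, j}\<close> is the new edge obtained from \<open>e i\<close> and \<open>e j\<close>.\<close>

datatype 'e hat_edge = Old 'e | Hat "nat set"

definition edges_at :: "('v, 'e) mgraph \<Rightarrow> 'v \<Rightarrow> 'e set" where
  "edges_at G v = {f\<in>edges G. v \<in> ends G f}"

text \<open>The vertex \<open>v(f)\<close> with \<open>f = v v(f)\<close>; it equals \<open>v\<close> if \<open>f\<close> is a loop.\<close>

definition far_end :: "('v, 'e) mgraph \<Rightarrow> 'v \<Rightarrow> 'e \<Rightarrow> 'v" where
  "far_end G v f = (THE u. ends G f = {v, u})"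

definition hat_new :: "('v, 'e) mgraph \<Rightarrow> (nat \<Rightarrow> 'e) \<Rightarrow> nat \<Rightarrow> 'e hat_edge set" where
  "hat_new G e m = {Hat {i, j} |i j. i \<in> {1..m} \<and> j \<in> {1..m} \<and> i \<noteq> j \<and>
     \<not> (is_loop G (e i) \<and> is_loop G (e j))}"

definition stem_loops :: "('v, 'e) mgraph \<Rightarrow> (nat \<Rightarrow> 'e) \<Rightarrow> nat \<Rightarrow> 'e hat_edge set" where
  "stem_loops G e m = {Hat {i, j} |i j. i \<in> {1..m} \<and> j \<in> {1..m} \<and>
     \<not> is_loop G (e i) \<and> is_loop G (e j)}"

text \<open>Indices of loops at \<open>v\<close> contribute no end, so a stem loop is a loop at \<open>v(e i)\<close> for its
  only index \<open>i\<close> such that \<open>e i\<close> is not a loop.\<close>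

fun hat_ends :: "('v, 'e) mgraph \<Rightarrow> 'v \<Rightarrow> (nat \<Rightarrow> 'e) \<Rightarrow> 'e hat_edge \<Rightarrow> 'v set" where
  "hat_ends G v e (Old f) = ends G f"
| "hat_ends G v e (Hat P) = {far_end G v (e i) |i. i \<in> P \<and> \<not> is_loop G (e i)}"

definition hat_graph ::
    "('v, 'e) mgraph \<Rightarrow> 'v \<Rightarrow> (nat \<Rightarrow> 'e) \<Rightarrow> nat \<Rightarrow> ('v, 'e hat_edge) mgraph" where
  "hat_graph G v e m =
     \<lparr>verts = verts G - {v},
      edges = Old ` (edges G - edges_at G v) \<union> hat_new G e m,
      ends = hat_ends G v e\<rparr>"

fun pull_back_edge :: "(nat \<Rightarrow> 'e) \<Rightarrow> 'e hat_edge \<Rightarrow> 'e set" where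
  "pull_back_edge e (Old f) = {f}"
| "pull_back_edge e (Hat P) = e ` P"

definition pull_back :: "(nat \<Rightarrow> 'e) \<Rightarrow> 'e hat_edge set \<Rightarrow> 'e set" where
  "pull_back e D = sym_diff_fam (pull_back_edge e) D"

text \<open>\<open>\<P>\<close> is the set of petals into which \<open>D\<close> splits at \<open>v\<close>. For the sets \<open>D\<close> to which this is
  applied below, such a \<open>\<P>\<close> exists and is unique.\<close>

definition petal_split :: "('v, 'e) mgraph \<Rightarrow> 'v \<Rightarrow> 'e set \<Rightarrow> 'e set set \<Rightarrow> bool" where
  "petal_split G v D \<P> \<longleftrightarrow> (\<forall>P\<in>\<P>. is_cycle G P) \<and> \<Union>\<P> = D \<and>
     (\<forall>P\<in>\<P>. \<forall>Q\<in>\<P>. P \<noteq> Q \<longrightarrow> edge_verts G P \<inter> edge_verts G Q = {v})"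

definition hat_generators ::
    "('v, 'e) mgraph \<Rightarrow> 'e set set \<Rightarrow> 'v \<Rightarrow> (nat \<Rightarrow> 'e) \<Rightarrow> nat \<Rightarrow> 'e hat_edge set set" where
  "hat_generators G \<C> v e m =
     {D. is_cycle (hat_graph G v e m) D \<and> (\<forall>s\<in>stem_loops G e m. D \<noteq> {s}) \<and>
       ((\<exists>C\<in>\<C>. D = Old ` C) \<or>
        pull_back e D = {} \<or>
        (D \<inter> hat_new G e m \<noteq> {} \<and> pull_back e D \<noteq> {} \<and>
         (\<exists>\<P>. petal_split G v (pull_back e D) \<P> \<and> \<P> \<subseteq> \<C>)))}"

definition hat_balanced ::
    "('v, 'e) mgraph \<Rightarrow> 'e set set \<Rightarrow> 'v \<Rightarrow> (nat \<Rightarrow> 'e) \<Rightarrow> nat \<Rightarrow> 'e hat_edge set set" where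
  "hat_balanced G \<C> v e m =
     cycle_span (hat_graph G v e m) {D\<in>hat_generators G \<C> v e m. \<not> (\<exists>l. D = {l})}"

text \<open>Loops among the generators are the edges \<open>Hat {i, j}\<close> with \<open>{e i, e j}\<close> a balanced cycle of
  length 2. The vertex-deleted biased graph is taken minus these loops, so that it has no balanced
  loops: they are not only left out of the generators but also deleted from the graph. Left in
  the graph, they would become unbalanced. Keeping them as balanced loops instead would
  yield the same bases.\<close>

definition hat_graph_reduced ::
    "('v, 'e) mgraph \<Rightarrow> 'e set set \<Rightarrow> 'v \<Rightarrow> (nat \<Rightarrow> 'e) \<Rightarrow> nat \<Rightarrow> ('v, 'e hat_edge) mgraph" where
  "hat_graph_reduced G \<C> v e m =
     (hat_graph G v e m)
       \<lparr>edges := edges (hat_graph G v e m) - {l. {l} \<in> hat_generators G \<C> v e m}\<rparr>"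

definition hat_bases ::
    "('v, 'e) mgraph \<Rightarrow> 'e set set \<Rightarrow> 'v \<Rightarrow> (nat \<Rightarrow> 'e) \<Rightarrow> nat \<Rightarrow> 'e hat_edge set set" where
  "hat_bases G \<C> v e m =
     frame_bases (hat_graph_reduced G \<C> v e m) (hat_balanced G \<C> v e m)"

text \<open>Circuits of the frame matroid of the vertex-deleted biased graph.\<close>

definition hat_circuit ::
    "('v, 'e) mgraph \<Rightarrow> 'e set set \<Rightarrow> 'v \<Rightarrow> (nat \<Rightarrow> 'e) \<Rightarrow> nat \<Rightarrow> 'e hat_edge set \<Rightarrow> bool" where
  "hat_circuit G \<C> v e m C \<longleftrightarrow>
     is_circuit (edges (hat_graph_reduced G \<C> v e m)) (hat_bases G \<C> v e m) C"


section \<open>Switching\<close>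

text \<open>The edge set of the subgraph induced by the new edges with both indices in \<open>I\<close>.\<close>

definition H_edges ::
    "('v, 'e) mgraph \<Rightarrow> (nat \<Rightarrow> 'e) \<Rightarrow> nat \<Rightarrow> nat set \<Rightarrow> 'e hat_edge set" where
  "H_edges G e m I = {Hat {i, j} |i j. i \<in> I \<and> j \<in> I} \<inter> hat_new G e m"

text \<open>Non-incidence refers to indices, not to ends in the vertex-deleted graph.\<close>

definition non_incident :: "'e hat_edge \<Rightarrow> 'e hat_edge \<Rightarrow> bool" where
  "non_incident a b \<longleftrightarrow> (\<exists>P Q. a = Hat P \<and> b = Hat Q \<and> P \<inter> Q = {})"

text \<open>In the following, \<open>\<B>\<close> is the set of bases of a matroid and \<open>H\<close> a set of new edges.\<close>

definition F_set :: "'a set set \<Rightarrow> 'a set \<Rightarrow> 'a set \<Rightarrow> 'a set" where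
  "F_set \<B> H B = {x\<in>H. (B - H) \<union> {x} \<in> \<B>}"

definition disjoint_bases :: "'a set set \<Rightarrow> 'a set \<times> 'a set \<Rightarrow> bool" where
  "disjoint_bases \<B> A \<longleftrightarrow> fst A \<in> \<B> \<and> snd A \<in> \<B> \<and> fst A \<inter> snd A = {}"

definition viable ::
    "'e hat_edge set set \<Rightarrow> 'e hat_edge set \<Rightarrow> 'e hat_edge set \<times> 'e hat_edge set \<Rightarrow> bool" where
  "viable \<B> H A \<longleftrightarrow> disjoint_bases \<B> A \<and>
     (\<exists>a b. a \<noteq> b \<and> (fst A \<union> snd A) \<inter> H = {a, b} \<and>
       (non_incident a b \<or> {a, b} \<subseteq> fst A \<or> {a, b} \<subseteq> snd A))"

definition transforms ::
    "'a set set \<Rightarrow> 'a set \<Rightarrow> 'a \<Rightarrow> 'a \<Rightarrow> 'a set \<times> 'a set \<Rightarrow> 'a set \<times> 'a set \<Rightarrow> bool" where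
  "transforms \<B> H a b A A' \<longleftrightarrow> a \<in> H \<and> b \<in> H \<and> a \<noteq> b \<and>
     disjoint_bases \<B> A \<and> disjoint_bases \<B> A' \<and>
     fst A' - H = fst A - H \<and> snd A' - H = snd A - H \<and>
     (fst A' \<union> snd A') \<inter> H = {a, b}"

definition amenable ::
    "'a set set \<Rightarrow> 'a set \<Rightarrow> 'a \<Rightarrow> 'a \<Rightarrow> 'a set \<times> 'a set \<Rightarrow> bool" where
  "amenable \<B> H a b A \<longleftrightarrow> (\<exists>A'. transforms \<B> H a b A A')"

definition sym_exchange ::
    "'a set set \<Rightarrow> 'a set \<times> 'a set \<Rightarrow> 'a set \<times> 'a set \<Rightarrow> bool" where
  "sym_exchange \<B> A A' \<longleftrightarrow> fst A \<in> \<B> \<and> snd A \<in> \<B> \<and> fst A' \<in> \<B> \<and> snd A' \<in> \<B> \<and>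
     (\<exists>x\<in>fst A - snd A. \<exists>y\<in>snd A - fst A.
        fst A' = (fst A - {x}) \<union> {y} \<and> snd A' = (snd A - {y}) \<union> {x})"

definition switch_step ::
    "'e hat_edge set set \<Rightarrow> 'e hat_edge set \<Rightarrow> 'e hat_edge set \<times> 'e hat_edge set
       \<Rightarrow> 'e hat_edge set \<times> 'e hat_edge set \<Rightarrow> bool" where
  "switch_step \<B> H A B \<longleftrightarrow> viable \<B> H A \<and> viable \<B> H B \<and>
     (\<exists>c1 c2 A' B'. viable \<B> H A' \<and> viable \<B> H B' \<and>
        transforms \<B> H c1 c2 A A' \<and> transforms \<B> H c1 c2 B B' \<and> sym_exchange \<B> A' B')"

definition switchable ::
    "'e hat_edge set set \<Rightarrow> 'e hat_edge set \<Rightarrow> 'e hat_edge \<Rightarrow> 'e hat_edge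
       \<Rightarrow> 'e hat_edge set \<times> 'e hat_edge set \<Rightarrow> bool" where
  "switchable \<B> H a b B \<longleftrightarrow>
     disjoint_bases \<B> B \<and> non_incident a b \<and> a \<in> F_set \<B> H (fst B) \<and> b \<in> F_set \<B> H (snd B) \<and>
     (\<exists>B'. (switch_step \<B> H)\<^sup>*\<^sup>* B B' \<and>
       (\<exists>a'\<in>H - {a, b}. \<exists>b'\<in>H - {a, b}. non_incident a' b' \<and> amenable \<B> H a' b' B'))"


section \<open>Two cycles joined by a path\<close>

text \<open>\<open>L\<close> is the union of the vertex-disjoint cycles \<open>D1\<close> and \<open>D2\<close> of \<open>G\<close> and a path with at least
  one edge that meets \<open>D1\<close> exactly in its first and \<open>D2\<close> exactly in its last vertex.\<close>

definition cycles_joined_by_path ::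
    "('v, 'e) mgraph \<Rightarrow> ('v, 'e) mgraph \<Rightarrow> 'e set \<Rightarrow> 'e set \<Rightarrow> bool" where
  "cycles_joined_by_path G L D1 D2 \<longleftrightarrow>
     is_cycle G D1 \<and> is_cycle G D2 \<and> edge_verts G D1 \<inter> edge_verts G D2 = {} \<and>
     (\<exists>vs es. is_path G vs es \<and> es \<noteq> [] \<and>
        set vs \<inter> edge_verts G D1 = {hd vs} \<and> set vs \<inter> edge_verts G D2 = {last vs} \<and>
        edges L = D1 \<union> D2 \<union> set es \<and>
        verts L = edge_verts G D1 \<union> edge_verts G D2 \<union> set vs)"

end

theory Submission
  imports Defs
begin

text \<open>
  Let \<open>W\<close> be the span over the two-element field of the generating cycles that are not loops, so
  that a cycle of the vertex-deleted graph is balanced iff it lies in \<open>W\<close>. A potential is a set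
  \<open>U\<close> of vertices with a labelling \<open>f\<close> of \<open>U\<close> by edge sets; it satisfies an edge if both ends
  are outside \<open>U\<close>, or both are in \<open>U\<close> and their labels differ by that edge modulo \<open>W\<close>. The frame
  matroid is the matroid whose closure of \<open>A\<close> consists of the edges satisfied by every potential
  that satisfies \<open>A\<close>, and a hyperplane is given by a single potential.

  For a fixed potential, ``\<open>Hat {i, j}\<close> is satisfied or was deleted'' is an equivalence relation on
  the indices of the edges at \<open>v\<close>. Apply this to the hyperplanes spanned by
  \<open>X1 = B1 - {Hat {i1, i2}}\<close> and \<open>X2 = B2 - {Hat {i3, i4}}\<close>: if \<open>(B1, B2)\<close> is not switchable, then,
  up to exchanging \<open>i3\<close> and \<open>i4\<close>, the classes are \<open>{i1, i3}, {i2, i4}\<close> for \<open>X1\<close> and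
  \<open>{i1, i4}, {i2, i3}\<close> for \<open>X2\<close>. Moreover, an edge \<open>z\<close> of \<open>X2\<close> that violates the potential of
  \<open>X1\<close> may be moved to the first basis; the resulting pair is amenable if \<open>X2 - {z}\<close>
  separates exactly one of the four indices from the others. Hence all such separating edges satisfy the
  potential of \<open>X1\<close>. Since the two potentials induce different partitions, this forces an edge of
  \<open>X2\<close> that separates \<open>i1, i2\<close> from \<open>i3, i4\<close>; it lies on the path of the handcuff \<open>L2\<close>, whose
  cycles are closed by \<open>Hat {i1, i2}\<close> and \<open>Hat {i3, i4}\<close>.
\<close>

section \<open>Symmetric differences\<close>

definition sdiff :: "'a set \<Rightarrow> 'a set \<Rightarrow> 'a set" (infixl "\<triangle>" 65) where
  "A \<triangle> B = (A - B) \<union> (B - A)"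

lemma sdiff_commute: "A \<triangle> B = B \<triangle> A"
  and sdiff_assoc: "A \<triangle> B \<triangle> C = A \<triangle> (B \<triangle> C)"
  and sdiff_left_commute: "A \<triangle> (B \<triangle> C) = B \<triangle> (A \<triangle> C)"
  by (auto simp: sdiff_def)

lemma sdiff_self [simp]: "A \<triangle> A = {}"
  and sdiff_cancel [simp]: "A \<triangle> (A \<triangle> B) = B"
  and sdiff_empty [simp]: "A \<triangle> {} = A" "{} \<triangle> A = A"
  by (auto simp: sdiff_def)

lemmas sdiff_ac = sdiff_commute sdiff_assoc sdiff_left_commute

lemma finite_sdiff [simp]: "finite A \<Longrightarrow> finite B \<Longrightarrow> finite (A \<triangle> B)"
  by (simp add: sdiff_def)

lemma sym_diff_fam_empty [simp]: "sym_diff_fam f {} = {}"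
  by (simp add: sym_diff_fam_def)

lemma sym_diff_fam_insert:
  assumes "finite X" "a \<notin> X"
  shows "sym_diff_fam f (insert a X) = f a \<triangle> sym_diff_fam f X"
proof -
  have *: "{i \<in> insert a X. x \<in> f i} =
      (if x \<in> f a then insert a {i \<in> X. x \<in> f i} else {i \<in> X. x \<in> f i})" for x
    by auto
  have "odd (card {i \<in> insert a X. x \<in> f i}) \<longleftrightarrow> x \<in> f a \<triangle> sym_diff_fam f X" for x
    unfolding * using assms by (auto simp: sdiff_def sym_diff_fam_def)
  then show ?thesis
    by (auto simp: sym_diff_fam_def)
qed

lemma sym_diff_fam_remove:
  assumes "finite X" "a \<in> X"
  shows "sym_diff_fam f (X - {a}) = f a \<triangle> sym_diff_fam f X"
  using sym_diff_fam_insert[of "X - {a}" a f] assms by (simp add: insert_absorb)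

text \<open>For a fixed family, the sum over an index set is linear in that set: indices in both
  \<open>X\<close> and \<open>Y\<close> cancel.\<close>

lemma sym_diff_fam_sdiff:
  assumes "finite X" "finite Y"
  shows "sym_diff_fam f (X \<triangle> Y) = sym_diff_fam f X \<triangle> sym_diff_fam f Y"
  using assms(1)
proof (induction X rule: finite_induct)
  case empty
  show ?case by simp
next
  case (insert a X)
  have fin: "finite (X \<triangle> Y)"
    using insert assms by simp
  show ?case
  proof (cases "a \<in> Y")
    case True
    then have "insert a X \<triangle> Y = X \<triangle> Y - {a}" and "a \<in> X \<triangle> Y"
      using insert by (auto simp: sdiff_def)
    then show ?thesis
      using insert fin by (simp add: sym_diff_fam_remove sym_diff_fam_insert sdiff_ac)
  next
    case False
    then have "insert a X \<triangle> Y = insert a (X \<triangle> Y)" and "a \<notin> X \<triangle> Y"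
      using insert by (auto simp: sdiff_def)
    then show ?thesis
      using insert fin by (simp add: sym_diff_fam_insert sdiff_ac)
  qed
qed

section \<open>Spans over the two-element field\<close>

text \<open>Unlike \<open>cycle_span\<close>, this contains sets that are not cycles, and so it is
  closed under \<open>\<triangle>\<close>.\<close>

definition xspan :: "'a set set \<Rightarrow> 'a set set" where
  "xspan \<A> = {D. \<exists>S. finite S \<and> S \<subseteq> \<A> \<and> D = sym_diff_fam (\<lambda>A. A) S}"

lemma xspan_empty [simp]: "{} \<in> xspan \<A>"
  unfolding xspan_def by (auto intro!: exI[of _ "{}"])

lemma xspan_base: "A \<in> \<A> \<Longrightarrow> A \<in> xspan \<A>"
  unfolding xspan_def by (auto intro!: exI[of _ "{A}"] simp: sym_diff_fam_insert)

lemma xspan_sdiff: "X \<in> xspan \<A> \<Longrightarrow> Y \<in> xspan \<A> \<Longrightarrow> X \<triangle> Y \<in> xspan \<A>"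
  unfolding xspan_def
proof clarify
  fix S T assume *: "finite S" "S \<subseteq> \<A>" "finite T" "T \<subseteq> \<A>"
  then have "S \<triangle> T \<subseteq> \<A>" by (auto simp: sdiff_def)
  with * show "\<exists>S'. finite S' \<and> S' \<subseteq> \<A> \<and>
      sym_diff_fam (\<lambda>A. A) S \<triangle> sym_diff_fam (\<lambda>A. A) T = sym_diff_fam (\<lambda>A. A) S'"
    by (metis finite_sdiff sym_diff_fam_sdiff)
qed

lemma xspan_induct [consumes 1, case_names empty sdiff]:
  assumes "X \<in> xspan \<A>" "P {}" "\<And>A X. A \<in> \<A> \<Longrightarrow> P X \<Longrightarrow> P (A \<triangle> X)"
  shows "P X"
proof -
  obtain S where S: "finite S" "S \<subseteq> \<A>" "X = sym_diff_fam (\<lambda>A. A) S"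
    using assms(1) by (auto simp: xspan_def)
  from S(1,2) have "P (sym_diff_fam (\<lambda>A. A) S)"
    by (induction S rule: finite_induct) (auto simp: sym_diff_fam_insert assms)
  with S show ?thesis by simp
qed

lemma cycle_span_eq: "cycle_span G \<A> = {D. is_cycle G D \<and> D \<in> xspan \<A>}"
  by (simp add: cycle_span_def xspan_def)


section \<open>Connectivity and paths\<close>

text \<open>An end map and an edge set take the place of a graph, so that deleting an edge is just
  \<open>A - {z}\<close>.\<close>

definition conn :: "('e \<Rightarrow> 'v set) \<Rightarrow> 'e set \<Rightarrow> 'v \<Rightarrow> 'v \<Rightarrow> bool" where
  "conn en A u w \<longleftrightarrow> (u, w) \<in> {(a, b). \<exists>e\<in>A. en e = {a, b}}\<^sup>*"

lemma conn_refl [simp]: "conn en A u u"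
  by (simp add: conn_def)

lemma conn_step: "conn en A u w \<Longrightarrow> e \<in> A \<Longrightarrow> en e = {w, x} \<Longrightarrow> conn en A u x"
  unfolding conn_def by (rule rtrancl_into_rtrancl) auto

lemma conn_trans: "conn en A u w \<Longrightarrow> conn en A w x \<Longrightarrow> conn en A u x"
  unfolding conn_def by (rule rtrancl_trans)

lemma conn_edge: "e \<in> A \<Longrightarrow> en e = {u, w} \<Longrightarrow> conn en A u w"
  by (rule conn_step[OF conn_refl])

lemma conn_induct [consumes 1, case_names refl step]:
  assumes "conn en A u w" "P u"
    "\<And>w e x. conn en A u w \<Longrightarrow> P w \<Longrightarrow> e \<in> A \<Longrightarrow> en e = {w, x} \<Longrightarrow> P x"
  shows "P w"
  using assms(1) unfolding conn_def
proof (induction rule: rtrancl_induct)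
  case base
  show ?case by (rule assms(2))
next
  case (step w x)
  then show ?case
    using assms(3)[unfolded conn_def, of w _ x] by blast
qed

lemma conn_sym: "conn en A u w \<Longrightarrow> conn en A w u"
proof (induction rule: conn_induct)
  case (step w e x)
  have "conn en A x w"
    using step by (intro conn_edge[of e]) (auto simp: insert_commute)
  then show ?case
    using step.IH by (rule conn_trans)
qed simp

lemma conn_join: "conn en A r x \<Longrightarrow> conn en A r y \<Longrightarrow> conn en A x y"
  by (rule conn_trans[OF conn_sym])

lemma conn_mono: "conn en A u w \<Longrightarrow> A \<subseteq> B \<Longrightarrow> conn en B u w"
proof (induction rule: conn_induct)
  case (step w e x)
  then show ?case by (blast intro: conn_step)
qed simp

text \<open>Cut a walk at its first and last crossing of \<open>z\<close>: the pieces before and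
  after avoid \<open>z\<close>. If they meet \<open>z\<close> at the same end, they join to a walk
  without \<open>z\<close>.\<close>

lemma conn_remove:
  assumes "conn en A u w" "en z = {a, b}"
  shows "conn en (A - {z}) u w \<or>
    conn en (A - {z}) u a \<and> conn en (A - {z}) b w \<or>
    conn en (A - {z}) u b \<and> conn en (A - {z}) a w"
  using assms(1)
proof (induction rule: conn_induct)
  case refl
  show ?case by simp
next
  case (step w e x)
  show ?case
  proof (cases "e = z")
    case True
    then have "w = a \<and> x = b \<or> w = b \<and> x = a"
      using step assms by (auto simp: doubleton_eq_iff)
    then show ?thesis
      using step.IH conn_refl[of en "A - {z}" x] by (elim disjE conjE) simp_all
  next
    case False
    then have e: "e \<in> A - {z}" "en e = {w, x}" using step by simp_all
    have "conn en (A - {z}) y x" if "conn en (A - {z}) y w" for y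
      using conn_step[OF that e] .
    then show ?thesis
      using step.IH by blast
  qed
qed

section \<open>Simple paths as parallel lists of vertices and edges\<close>

text \<open>Containment in a graph, which \<open>is_path\<close> demands, is left out, so a path can
  be read in any graph with the same end map.\<close>

fun upath :: "('e \<Rightarrow> 'v set) \<Rightarrow> 'v list \<Rightarrow> 'e list \<Rightarrow> bool" where
  "upath en [u] [] = True"
| "upath en (u # w # vs) (e # es) \<longleftrightarrow> en e = {u, w} \<and> u \<notin> set (w # vs) \<and> upath en (w # vs) es"
| "upath en _ _ = False"

lemma upath_iff:
  "upath en vs es \<longleftrightarrow> length vs = Suc (length es) \<and> distinct vs \<and>
     (\<forall>i<length es. en (es ! i) = {vs ! i, vs ! Suc i})"
proof (induction en vs es rule: upath.induct)
  case (2 en u w vs e es)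
  then show ?case by (auto simp: All_less_Suc2)
qed auto

lemma upath_nonempty: "upath en vs es \<Longrightarrow> vs \<noteq> []"
  by (cases vs) auto

lemma upath_ends: "upath en vs es \<Longrightarrow> e \<in> set es \<Longrightarrow> en e \<subseteq> set vs"
  by (induction en vs es rule: upath.induct) auto

lemma upath_edge_verts: "upath en vs es \<Longrightarrow> es \<noteq> [] \<Longrightarrow> (\<Union>e\<in>set es. en e) = set vs"
proof (induction en vs es rule: upath.induct)
  case (2 en u w vs e es)
  show ?case
  proof (cases "es = []")
    case True
    then have "vs = []" using 2 by (cases vs) auto
    then show ?thesis using 2 True by auto
  next
    case False
    then have "(\<Union>e\<in>set es. en e) = set (w # vs)"
      using 2 by auto
    moreover have "en e = {u, w}" using 2 by simp
    ultimately show ?thesis by auto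
  qed
qed auto

lemma upath_card_ends: "upath en vs es \<Longrightarrow> e \<in> set es \<Longrightarrow> \<exists>a b. a \<noteq> b \<and> en e = {a, b}"
proof (induction en vs es rule: upath.induct)
  case (2 en u w vs e' es)
  then show ?case
  proof (cases "e = e'")
    case True
    with 2 have "u \<noteq> w \<and> en e = {u, w}" by simp
    then show ?thesis by blast
  qed auto
qed auto

lemma upath_distinct: "upath en vs es \<Longrightarrow> distinct es"
proof (induction en vs es rule: upath.induct)
  case (2 en u w vs e es)
  then have "e \<notin> set es"
    using upath_ends[of en "w # vs" es e] by auto
  then show ?case using 2 by simp
qed auto

lemma upath_conn: "upath en vs es \<Longrightarrow> conn en (set es) (hd vs) (last vs)"
proof (induction en vs es rule: upath.induct)
  case (2 en u w vs e es)
  then have "conn en (set (e # es)) u w"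
    by (intro conn_edge[of e]) auto
  moreover have "conn en (set (e # es)) w (last (w # vs))"
    using 2 by (auto elim!: conn_mono)
  ultimately show ?case
    using conn_trans by fastforce
qed auto

lemma upath_split:
  "upath en vs es \<Longrightarrow> z \<in> set es \<Longrightarrow>
     \<exists>a b. en z = {a, b} \<and> conn en (set es - {z}) (hd vs) a \<and> conn en (set es - {z}) b (last vs)"
proof (induction en vs es rule: upath.induct)
  case (2 en u w vs e es)
  have dist: "e \<notin> set es"
    using upath_distinct[OF "2.prems"(1)] by simp
  show ?case
  proof (cases "z = e")
    case True
    have "conn en (set es) w (last (w # vs))"
      using upath_conn[of en "w # vs" es] 2 by simp
    then show ?thesis
      using True 2 dist by (intro exI[of _ u] exI[of _ w]) auto
  next
    case False
    then have z: "z \<in> set es" using 2 by simp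
    then obtain a b where ab: "en z = {a, b}" "conn en (set es - {z}) w a"
        "conn en (set es - {z}) b (last (w # vs))"
      using 2 by auto
    have "conn en (set (e # es) - {z}) u a"
    proof (rule conn_trans)
      show "conn en (set (e # es) - {z}) u w"
        using False 2 by (intro conn_edge[of e]) auto
      show "conn en (set (e # es) - {z}) w a"
        using ab(2) by (rule conn_mono) auto
    qed
    moreover have "conn en (set (e # es) - {z}) b (last (u # w # vs))"
      using ab(3) by (auto elim!: conn_mono)
    ultimately show ?thesis
      using ab(1) by (intro exI[of _ a] exI[of _ b]) simp
  qed
qed auto

text \<open>The strict drop in length is what will make a shortest connecting path meet its two end
  sets only once.\<close>

lemma upath_suffix:
  "upath en vs es \<Longrightarrow> x \<in> set vs \<Longrightarrow>
     \<exists>vs' es'. upath en vs' es' \<and> hd vs' = x \<and> last vs' = last vs \<and> set es' \<subseteq> set es \<and>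
       set vs' \<subseteq> set vs \<and> length es' \<le> length es \<and> (x \<noteq> hd vs \<longrightarrow> length es' < length es)"
proof (induction en vs es rule: upath.induct)
  case (1 en u)
  then show ?case by (intro exI[of _ "[u]"] exI[of _ "[]"]) auto
next
  case (2 en u w vs e es)
  show ?case
  proof (cases "x = u")
    case True
    then show ?thesis using 2
      by (intro exI[of _ "u # w # vs"] exI[of _ "e # es"]) auto
  next
    case False
    then obtain vs' es' where "upath en vs' es'" "hd vs' = x" "last vs' = last (w # vs)"
        "set es' \<subseteq> set es" "set vs' \<subseteq> set (w # vs)" "length es' \<le> length es"
      using 2 by auto
    then show ?thesis
      by (intro exI[of _ vs'] exI[of _ es']) auto
  qed
qed auto

lemma upath_prefix:
  "upath en vs es \<Longrightarrow> x \<in> set vs \<Longrightarrow>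
     \<exists>vs' es'. upath en vs' es' \<and> hd vs' = hd vs \<and> last vs' = x \<and> set es' \<subseteq> set es \<and>
       set vs' \<subseteq> set vs \<and> length es' \<le> length es \<and> (x \<noteq> last vs \<longrightarrow> length es' < length es)"
proof (induction en vs es rule: upath.induct)
  case (1 en u)
  then show ?case by (intro exI[of _ "[u]"] exI[of _ "[]"]) auto
next
  case (2 en u w vs e es)
  show ?case
  proof (cases "x = u")
    case True
    then show ?thesis using 2
      by (intro exI[of _ "[u]"] exI[of _ "[]"]) auto
  next
    case False
    then obtain vs' es' where p: "upath en vs' es'" "hd vs' = w" "last vs' = x"
        "set es' \<subseteq> set es" "set vs' \<subseteq> set (w # vs)" "length es' \<le> length es"
        "x \<noteq> last (w # vs) \<longrightarrow> length es' < length es"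
      using 2 by auto
    from p(1,2) obtain vs'' where vs'': "vs' = w # vs''"
      by (cases vs') auto
    have "upath en (u # vs') (e # es')"
      using 2 p vs'' by auto
    then show ?thesis
      using p vs'' by (intro exI[of _ "u # vs'"] exI[of _ "e # es'"]) auto
  qed
qed auto

lemma conn_imp_upath:
  "conn en A u w \<Longrightarrow> \<exists>vs es. upath en vs es \<and> hd vs = u \<and> last vs = w \<and> set es \<subseteq> A"
proof (induction rule: conn_induct)
  case refl
  show ?case by (intro exI[of _ "[u]"] exI[of _ "[]"]) auto
next
  case (step w e x)
  have "conn en A x u"
    using step by (meson conn_step conn_sym)
  \<comment> \<open>\<open>conn\<close> grows at its second argument but a path at its head, so the
    path is built backwards from its last vertex \<open>z\<close>. If the new vertex already lies on
    the path, a suffix is taken.\<close>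
  have "\<exists>vs es. upath en vs es \<and> hd vs = y \<and> last vs = z \<and> set es \<subseteq> A"
    if "conn en A z y" for y z
    using that
  proof (induction rule: conn_induct)
    case refl
    show ?case by (intro exI[of _ "[z]"] exI[of _ "[]"]) auto
  next
    case (step w e x)
    then obtain vs es where p: "upath en vs es" "hd vs = w" "last vs = z" "set es \<subseteq> A"
      by auto
    show ?case
    proof (cases "x \<in> set vs")
      case True
      then show ?thesis
        using upath_suffix[OF p(1)] p by (metis subset_trans)
    next
      case False
      obtain vs' where vs': "vs = w # vs'"
        using p by (cases vs) auto
      then have "upath en (x # vs) (e # es)"
        using p False step by (auto simp: insert_commute)
      then show ?thesis
        using p step vs' by (intro exI[of _ "x # vs"] exI[of _ "e # es"]) auto
    qed
  qed
  from this[OF \<open>conn en A x u\<close>] show ?case .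
qed

lemma upath_conn_mem:
  assumes "upath en vs es" "x \<in> set vs"
  shows "conn en (set es) (hd vs) x"
proof -
  obtain vs' es' where p: "upath en vs' es'" "hd vs' = hd vs" "last vs' = x" "set es' \<subseteq> set es"
    using upath_prefix[OF assms] by blast
  show ?thesis
    using upath_conn[OF p(1)] p conn_mono[of en "set es'"] by simp
qed

text \<open>Take a path from \<open>S\<close> to \<open>T\<close> with the fewest edges: any further
  visit to \<open>S\<close> or \<open>T\<close> would give a shorter suffix or prefix.\<close>

lemma connecting_path:
  assumes "conn en A x y" "x \<in> S" "y \<in> T"
  obtains vs es where "upath en vs es" "set es \<subseteq> A" "hd vs \<in> S" "last vs \<in> T"
    "set vs \<inter> S = {hd vs}" "set vs \<inter> T = {last vs}"
proof -
  define good where "good p \<longleftrightarrow> upath en (fst p) (snd p) \<and> set (snd p) \<subseteq> A \<and>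
      hd (fst p) \<in> S \<and> last (fst p) \<in> T" for p
  have "\<exists>p. good p"
    using conn_imp_upath[OF assms(1)] assms(2,3) by (auto simp: good_def)
  then obtain p where p: "good p" "\<And>q. good q \<Longrightarrow> length (snd p) \<le> length (snd q)"
    using ex_has_least_nat[of good _ "\<lambda>p. length (snd p)"] by blast
  obtain vs es where pe: "p = (vs, es)" by (cases p)
  have g: "upath en vs es" "set es \<subseteq> A" "hd vs \<in> S" "last vs \<in> T"
    using p(1) by (simp_all add: good_def pe)
  have min: "length es \<le> length es'"
    if "upath en vs' es'" "set es' \<subseteq> set es" "hd vs' \<in> S" "last vs' \<in> T" for vs' es'
    using p(2)[of "(vs', es')"] that g(2) by (auto simp: good_def pe)
  have "vs \<noteq> []" using upath_nonempty[OF g(1)] .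
  have "z = hd vs" if z: "z \<in> set vs" "z \<in> S" for z
  proof (rule ccontr)
    assume ne: "z \<noteq> hd vs"
    obtain vs' es' where q: "upath en vs' es'" "hd vs' = z" "last vs' = last vs"
        "set es' \<subseteq> set es" "length es' < length es"
      using upath_suffix[OF g(1) z(1)] ne by blast
    then have "length es \<le> length es'" using z(2) g(4) by (intro min[of vs']) simp_all
    then show False using q(5) by simp
  qed
  moreover have "z = last vs" if z: "z \<in> set vs" "z \<in> T" for z
  proof (rule ccontr)
    assume ne: "z \<noteq> last vs"
    obtain vs' es' where q: "upath en vs' es'" "hd vs' = hd vs" "last vs' = z"
        "set es' \<subseteq> set es" "length es' < length es"
      using upath_prefix[OF g(1) z(1)] ne by blast
    then have "length es \<le> length es'" using z(2) g(3) by (intro min[of vs']) simp_all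
    then show False using q(5) by simp
  qed
  ultimately have "set vs \<inter> S = {hd vs}" "set vs \<inter> T = {last vs}"
    using g(3,4) \<open>vs \<noteq> []\<close> by auto
  then show ?thesis using that[OF g] by blast
qed

section \<open>Cycles as paths with a closing edge\<close>

lemma cycleI:
  assumes "upath (ends G) vs es" "ends G e = {hd vs, last vs}" "e \<notin> set es"
    "set vs \<subseteq> verts G" "insert e (set es) \<subseteq> edges G"
  shows "is_cycle G (insert e (set es))"
  unfolding is_cycle_def
proof (intro exI conjI)
  have p: "length vs = Suc (length es)" "distinct vs"
      "\<And>i. i < length es \<Longrightarrow> ends G (es ! i) = {vs ! i, vs ! Suc i}"
    using assms(1) by (auto simp: upath_iff)
  have ne: "vs \<noteq> []" using p by auto
  show "es @ [e] \<noteq> []" "length vs = length (es @ [e])" "distinct vs"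
    using p by auto
  show "distinct (es @ [e])"
    using upath_distinct[OF assms(1)] assms(3) by simp
  show "set vs \<subseteq> verts G" "set (es @ [e]) \<subseteq> edges G" "insert e (set es) = set (es @ [e])"
    using assms by auto
  show "\<forall>i<length (es @ [e]). ends G ((es @ [e]) ! i) = {vs ! i, vs ! (Suc i mod length (es @ [e]))}"
  proof (intro allI impI)
    fix i assume "i < length (es @ [e])"
    then consider "i < length es" | "i = length es" by fastforce
    then show "ends G ((es @ [e]) ! i) = {vs ! i, vs ! (Suc i mod length (es @ [e]))}"
    proof cases
      case 1
      then show ?thesis using p by (simp add: nth_append)
    next
      case 2
      then show ?thesis using p ne assms(2)
        by (simp add: hd_conv_nth last_conv_nth insert_commute)
    qed
  qed
qed

text \<open>Any chosen edge may serve as the closing edge; cycles are handled in this form from here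
  on.\<close>

lemma cycle_path:
  assumes "is_cycle G D" "e \<in> D"
  obtains vs es where "upath (ends G) vs es" "set es = D - {e}" "ends G e = {hd vs, last vs}"
    "set vs \<subseteq> verts G" "D \<subseteq> edges G" "edge_verts G D = set vs"
proof -
  obtain vs0 es0 where c: "es0 \<noteq> []" "length vs0 = length es0" "distinct vs0" "distinct es0"
      "set vs0 \<subseteq> verts G" "set es0 \<subseteq> edges G" "D = set es0"
      "\<And>i. i < length es0 \<Longrightarrow> ends G (es0 ! i) = {vs0 ! i, vs0 ! (Suc i mod length es0)}"
    using assms(1) unfolding is_cycle_def by blast
  obtain k where k: "k < length es0" "es0 ! k = e"
    using assms(2) c(7) by (auto simp: in_set_conv_nth)
  define n where "n = length es0"
  \<comment> \<open>Rotating by \<open>Suc k\<close> moves \<open>e\<close>, at position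
    \<open>k\<close>, to the end, where it closes the path.\<close>
  define vs where "vs = rotate (Suc k) vs0"
  define es' where "es' = rotate (Suc k) es0"
  have n: "0 < n" "k < n" using k by (auto simp: n_def)
  have len: "length vs = n" "length es' = n"
    using c by (auto simp: vs_def es'_def n_def)
  have step: "ends G (es' ! i) = {vs ! i, vs ! (Suc i mod n)}" if "i < n" for i
  proof -
    have "es' ! i = es0 ! ((Suc k + i) mod n)" "vs ! i = vs0 ! ((Suc k + i) mod n)"
      using that c(2) by (simp_all add: es'_def vs_def n_def nth_rotate del: rotate_Suc)
    moreover have "vs ! (Suc i mod n) = vs0 ! ((Suc k + Suc i mod n) mod n)"
      using that c(2) n by (simp add: vs_def n_def nth_rotate del: rotate_Suc)
    moreover have "(Suc k + Suc i mod n) mod n = Suc ((Suc k + i) mod n) mod n"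
      by (simp only: mod_add_right_eq mod_Suc_eq add_Suc_right)
    moreover have "(Suc k + i) mod n < length es0"
      using n by (simp add: n_def)
    ultimately show ?thesis
      using c(8)[of "(Suc k + i) mod n"] by (simp add: n_def)
  qed
  have last: "last es' = e"
  proof -
    have "last es' = es' ! (n - 1)"
      using len n by (subst last_conv_nth) auto
    also have "\<dots> = es0 ! ((Suc k + (n - 1)) mod n)"
      using n by (simp add: es'_def n_def nth_rotate del: rotate_Suc)
    also have "(Suc k + (n - 1)) mod n = k"
      using n by simp
    finally show ?thesis using k by simp
  qed
  have "es' \<noteq> []" using len n by auto
  then obtain es where es': "es' = es @ [e]"
    using append_butlast_last_id[of es'] last by metis
  have len_es: "length es = n - 1" using len(2) es' by simp
  have "distinct es'" "set es' = D" using c by (simp_all add: es'_def)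
  then have set_es: "set es = D - {e}" unfolding es' by auto
  have vs: "distinct vs" "set vs = set vs0" using c by (auto simp: vs_def)
  have "ends G (es ! i) = {vs ! i, vs ! Suc i}" if "i < length es" for i
    using step[of i] that len_es es' by (simp add: nth_append)
  then have up: "upath (ends G) vs es"
    using len len_es n vs by (auto simp: upath_iff)
  have "vs \<noteq> []" using len n by auto
  have ends_e: "ends G e = {hd vs, last vs}"
    using step[of "n - 1"] es' len_es n len \<open>vs \<noteq> []\<close>
    by (auto simp: nth_append hd_conv_nth last_conv_nth)
  have "edge_verts G D = set vs"
  proof (cases "es = []")
    case True
    then have "D = {e}" using set_es assms(2) by auto
    moreover have "length vs = Suc 0"
      using True up upath_iff[of "ends G" vs es] by simp
    moreover from this obtain x where "vs = [x]"
      by (cases vs) auto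
    ultimately show ?thesis
      using ends_e by (simp add: edge_verts_def)
  next
    case False
    have "edge_verts G D = (\<Union>d\<in>set es. ends G d) \<union> ends G e"
      using set_es assms(2) by (auto simp: edge_verts_def)
    then show ?thesis
      using upath_edge_verts[OF up False] ends_e \<open>vs \<noteq> []\<close> by auto
  qed
  then show ?thesis
    using that[OF up set_es ends_e] c vs by auto
qed

lemma cycle_nonempty: "is_cycle G D \<Longrightarrow> D \<noteq> {}"
  by (auto simp: is_cycle_def)

lemma cycle_subset: "is_cycle G D \<Longrightarrow> D \<subseteq> edges G"
  by (auto simp: is_cycle_def)

text \<open>Deleting the loop leaves a path with equal ends; its vertices being distinct, it has no
  edges.\<close>

lemma cycle_with_loop:
  assumes "is_cycle G D" "l \<in> D" "is_loop G l"
  shows "D = {l}"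
proof -
  obtain vs es where p: "upath (ends G) vs es" "set es = D - {l}" "ends G l = {hd vs, last vs}"
    using cycle_path[OF assms(1,2)] by metis
  have "hd vs = last vs"
    using p(3) assms(3) by (auto simp: is_loop_def doubleton_eq_iff)
  then have "es = []"
  proof (rule contrapos_pp)
    assume "es \<noteq> []"
    then have "length vs \<ge> 2" and dist: "distinct vs"
      using p(1) by (auto simp: upath_iff Suc_le_eq)
    then obtain x y vs' where "vs = x # y # vs'"
      by (cases vs; cases "tl vs") auto
    then show "hd vs \<noteq> last vs"
      using dist last_in_set[of "y # vs'"] by auto
  qed
  then show ?thesis using p assms by auto
qed

lemma cycle_transfer:
  assumes "is_cycle G D" "D \<subseteq> edges G'" "edge_verts G D \<subseteq> verts G'"
    "\<And>d. d \<in> D \<Longrightarrow> ends G' d = ends G d"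
  shows "is_cycle G' D"
proof -
  obtain e where e: "e \<in> D" using cycle_nonempty[OF assms(1)] by blast
  obtain vs es where p: "upath (ends G) vs es" "set es = D - {e}" "ends G e = {hd vs, last vs}"
      "edge_verts G D = set vs"
    using cycle_path[OF assms(1) e] by metis
  have "ends G' (es ! i) = ends G (es ! i)" if "i < length es" for i
    using assms(4) p(2) that nth_mem[OF that] by simp
  then have up: "upath (ends G') vs es"
    using p(1) by (simp add: upath_iff)
  have D: "insert e (set es) = D" using p(2) e by auto
  have "is_cycle G' (insert e (set es))"
    using p assms D e by (intro cycleI[OF up]) auto
  then show ?thesis using D by simp
qed

lemma conn_cycle_minus:
  assumes "is_cycle G D" "x \<in> edge_verts G D" "y \<in> edge_verts G D"
  shows "conn (ends G) (D - {e}) x y"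
proof -
  have *: "conn (ends G) (D - {e}) x y" if e: "e \<in> D" for e
  proof -
    obtain vs es where p: "upath (ends G) vs es" "set es = D - {e}" "edge_verts G D = set vs"
      using cycle_path[OF assms(1) e] by metis
    then have "conn (ends G) (D - {e}) (hd vs) z" if "z \<in> edge_verts G D" for z
      using upath_conn_mem[OF p(1), of z] that by simp
    then show ?thesis
      using assms(2,3) conn_sym conn_trans by meson
  qed
  show ?thesis
  proof (cases "e \<in> D")
    case False
    obtain e' where "e' \<in> D" using cycle_nonempty[OF assms(1)] by blast
    then show ?thesis
      using *[of e'] False by (auto elim: conn_mono)
  qed (rule *)
qed


lemma cycle_vertex:
  assumes "is_cycle G D"
  obtains x where "x \<in> edge_verts G D"
proof -
  obtain e where e: "e \<in> D" using cycle_nonempty[OF assms] by blast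
  obtain vs es where "upath (ends G) vs es" "edge_verts G D = set vs"
    using cycle_path[OF assms e] by metis
  moreover from this have "hd vs \<in> set vs" by (intro hd_in_set upath_nonempty)
  ultimately show ?thesis using that by metis
qed

lemma single_cycle:
  assumes "is_cycle H {l}"
  shows "is_loop H l"
proof -
  obtain vs es where p: "upath (ends H) vs es" "set es = {l} - {l}" "ends H l = {hd vs, last vs}"
    using cycle_path[OF assms, of l] by (metis singletonI)
  then have "es = []" by simp
  then obtain x where "vs = [x]" using p(1) by (auto simp: upath_iff length_Suc_conv)
  then show ?thesis using p(3) unfolding is_loop_def by simp
qed

lemma loop_cycle:
  assumes "l \<in> edges H" "ends H l = {x}" "x \<in> verts H"
  shows "is_cycle H {l}"
  using cycleI[of H "[x]" "[]" l] assms by simp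

lemma digon_cycle:
  assumes "a \<in> edges H" "b \<in> edges H" "a \<noteq> b" "ends H a = {x, y}" "ends H b = {x, y}" "x \<noteq> y"
    "x \<in> verts H" "y \<in> verts H"
  shows "is_cycle H {a, b}"
  using cycleI[of H "[x, y]" "[b]" a] assms by simp

lemma triangle_cycle:
  assumes "{a, b, c} \<subseteq> edges H" "a \<noteq> b" "b \<noteq> c" "a \<noteq> c" "distinct [x, y, z]" "{x, y, z} \<subseteq> verts H"
    "ends H a = {x, z}" "ends H b = {x, y}" "ends H c = {y, z}"
  shows "is_cycle H {a, b, c}"
  using cycleI[of H "[x, y, z]" "[b, c]" a] assms by simp


section \<open>Matroids from a closure operator\<close>

text \<open>The closure axioms of a finite matroid; \<open>cl_least\<close> packs monotonicity and
  idempotence together.\<close>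

locale closure_matroid =
  fixes E :: "'a set" and cl :: "'a set \<Rightarrow> 'a set"
  assumes finite_E: "finite E"
    and cl_subset: "cl A \<subseteq> E"
    and extensive: "A \<subseteq> E \<Longrightarrow> A \<subseteq> cl A"
    and cl_least: "A \<subseteq> cl B \<Longrightarrow> cl A \<subseteq> cl B"
    and exchange: "\<lbrakk>A \<subseteq> E; b \<in> E; a \<in> cl (insert b A); a \<notin> cl A\<rbrakk> \<Longrightarrow> b \<in> cl (insert a A)"
begin

definition ind :: "'a set \<Rightarrow> bool" where
  "ind A \<longleftrightarrow> A \<subseteq> E \<and> (\<forall>a\<in>A. a \<notin> cl (A - {a}))"

definition bas :: "'a set \<Rightarrow> bool" where
  "bas A \<longleftrightarrow> ind A \<and> (\<forall>A'. ind A' \<and> A \<subseteq> A' \<longrightarrow> A' = A)"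

lemma cl_mono: "A \<subseteq> B \<Longrightarrow> B \<subseteq> E \<Longrightarrow> cl A \<subseteq> cl B"
  using cl_least extensive by (meson order_trans)

lemma ind_subset: "ind A \<Longrightarrow> B \<subseteq> A \<Longrightarrow> ind B"
  unfolding ind_def
proof (intro conjI ballI)
  fix b assume A: "A \<subseteq> E \<and> (\<forall>a\<in>A. a \<notin> cl (A - {a}))" and B: "B \<subseteq> A" "b \<in> B"
  have "cl (B - {b}) \<subseteq> cl (A - {b})"
    using A B by (intro cl_mono) auto
  then show "b \<notin> cl (B - {b})"
    using A B by blast
qed blast

lemma ind_insert:
  assumes "ind A" "e \<in> E" "e \<notin> cl A"
  shows "ind (insert e A)"
  unfolding ind_def
proof (intro conjI ballI notI)
  show "insert e A \<subseteq> E" using assms by (auto simp: ind_def)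
  have eA: "e \<notin> A" using assms extensive[of A] by (auto simp: ind_def)
  fix a assume a: "a \<in> insert e A" "a \<in> cl (insert e A - {a})"
  show False
  proof (cases "a = e")
    case True
    then show False using a assms eA by simp
  next
    case False
    then have "a \<in> A" "insert e A - {a} = insert e (A - {a})" using a by auto
    moreover have "a \<notin> cl (A - {a})" "A - {a} \<subseteq> E"
      using assms \<open>a \<in> A\<close> by (auto simp: ind_def)
    ultimately have "e \<in> cl (insert a (A - {a}))"
      using exchange[of "A - {a}" e a] a assms by simp
    then show False using \<open>a \<in> A\<close> assms by (simp add: insert_absorb)
  qed
qed

lemma bas_iff: "bas A \<longleftrightarrow> ind A \<and> E \<subseteq> cl A"
proof
  assume A: "bas A"
  have "e \<in> cl A" if "e \<in> E" for e
  proof (rule ccontr)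
    assume "e \<notin> cl A"
    then have "insert e A = A"
      using A that ind_insert unfolding bas_def by blast
    then have "e \<in> A" by auto
    then show False
      using \<open>e \<notin> cl A\<close> A extensive[of A] by (auto simp: bas_def ind_def)
  qed
  then show "ind A \<and> E \<subseteq> cl A" using A by (auto simp: bas_def)
next
  assume A: "ind A \<and> E \<subseteq> cl A"
  have "A' = A" if A': "ind A'" "A \<subseteq> A'" for A'
  proof (rule ccontr)
    assume "A' \<noteq> A"
    then obtain e where e: "e \<in> A'" "e \<notin> A" using A' by auto
    then have "e \<in> E" using A' by (auto simp: ind_def)
    moreover have "cl A \<subseteq> cl (A' - {e})"
      using A' e by (intro cl_mono) (auto simp: ind_def)
    ultimately show False
      using A A' e by (auto simp: ind_def)
  qed
  then show "bas A" using A by (auto simp: bas_def)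
qed

lemma bas_ind: "bas A \<Longrightarrow> ind A"
  by (simp add: bas_def)

lemma ind_E: "ind A \<Longrightarrow> A \<subseteq> E"
  by (simp add: ind_def)

lemma bas_E: "bas A \<Longrightarrow> A \<subseteq> E"
  by (simp add: bas_def ind_E)

lemma ind_extend: "ind A \<Longrightarrow> \<exists>B. bas B \<and> A \<subseteq> B"
proof (induction "card E - card A" arbitrary: A rule: less_induct)
  case less
  show ?case
  proof (cases "bas A")
    case False
    then obtain A' where A': "ind A'" "A \<subset> A'"
      using less.prems by (auto simp: bas_def)
    have "A' \<subseteq> E" using A' ind_E by simp
    then have "card A < card A'" "card A' \<le> card E"
      using A' finite_E by (auto intro: psubset_card_mono card_mono finite_subset)
    then show ?thesis
      using less.hyps[of A'] A' by fastforce
  qed auto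
qed

lemma bas_not_cl: "bas (insert a X) \<Longrightarrow> a \<notin> X \<Longrightarrow> a \<notin> cl X"
  by (auto simp: bas_def ind_def)

text \<open>\<open>X\<close> spans a hyperplane, and any element off this hyperplane completes
  \<open>X\<close> to a basis.\<close>

lemma bas_swap:
  assumes "bas (insert b X)" "a \<in> E" "a \<notin> cl X"
  shows "bas (insert a X)"
proof -
  have ins: "ind (insert b X)" "b \<in> E" "X \<subseteq> E" "E \<subseteq> cl (insert b X)"
    using assms(1) by (auto simp: bas_iff ind_def)
  have "ind (insert a X)"
    using ind_insert[OF ind_subset[OF ins(1)] assms(2,3)] by blast
  moreover have "b \<in> cl (insert a X)"
    using exchange[OF ins(3,2) _ assms(3)] ins(4) assms(2) by blast
  then have "insert b X \<subseteq> cl (insert a X)"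
    using extensive[of "insert a X"] ins assms(2) by auto
  then have "E \<subseteq> cl (insert a X)"
    using cl_least ins(4) by blast
  ultimately show ?thesis by (simp add: bas_iff)
qed

lemma bas_exchange:
  assumes "bas (insert b X)" "b \<notin> X" "z \<in> X" "a \<in> E" "a \<notin> cl (insert b (X - {z}))"
  shows "bas (insert a (insert b (X - {z})))"
proof -
  have "insert z (insert b (X - {z})) = insert b X" using assms(3) by auto
  then show ?thesis
    using bas_swap[of z "insert b (X - {z})" a] assms by simp
qed

text \<open>Dependence puts some \<open>d\<close> in the closure of the rest; since
  \<open>C - {c}\<close> is independent, exchange transfers this to \<open>c\<close>.\<close>

lemma circuit_cl:
  assumes "is_circuit E {B. bas B} C" "c \<in> C"
  shows "c \<in> cl (C - {c})"
proof -
  have circ: "C \<subseteq> E" "\<not> (\<exists>B. bas B \<and> C \<subseteq> B)" "\<forall>D. D \<subset> C \<longrightarrow> (\<exists>B. bas B \<and> D \<subseteq> B)"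
    using assms(1) by (simp_all add: is_circuit_def)
  have C: "C \<subseteq> E" "\<not> ind C"
    using circ ind_extend[of C] by metis+
  have ind_D: "ind D" if D: "D \<subset> C" for D
  proof -
    obtain B where "bas B" "D \<subseteq> B"
      using circ(3) D by metis
    then show ?thesis by (metis ind_subset bas_ind)
  qed
  obtain d where d: "d \<in> C" "d \<in> cl (C - {d})"
    using C by (auto simp: ind_def)
  show ?thesis
  proof (cases "d = c")
    case False
    have "ind (C - {c})" using ind_D[of "C - {c}"] assms(2) by blast
    then have "d \<notin> cl (C - {c} - {d})" using d False by (auto simp: ind_def)
    moreover have "C - {d} = insert c (C - {c} - {d})" using assms(2) False by auto
    ultimately have "c \<in> cl (insert d (C - {c} - {d}))"
      using exchange[of "C - {c} - {d}" c d] d C(1) assms(2) by auto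
    moreover have "insert d (C - {c} - {d}) = C - {c}" using d False by auto
    ultimately show ?thesis by simp
  qed (use d in simp)
qed

lemma circuit_mem_iff:
  assumes X: "bas (insert a X)" "bas (insert b X)" "a \<notin> X" "b \<notin> X"
    and C: "is_circuit E {B. bas B} C" "C \<subseteq> insert a (insert b X)"
  shows "a \<in> C \<and> b \<in> C"
proof -
  have "\<not> C \<subseteq> insert a X" "\<not> C \<subseteq> insert b X"
    using X C by (auto simp: is_circuit_def)
  then show ?thesis using C by blast
qed

end

section \<open>Potentials\<close>

text \<open>This is a gain graph: \<open>e\<close> has gain \<open>{e}\<close> in the quotient of
  the power set by \<open>W\<close>. Every element there is its own inverse, so edges need no
  direction.\<close>

locale potentials =
  fixes E :: "'e set" and en :: "'e \<Rightarrow> 'v set" and W :: "'e set set"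
  assumes finite_edges: "finite E"
    and two_ends: "e \<in> E \<Longrightarrow> \<exists>u w. en e = {u, w}"
    and W_empty [simp]: "{} \<in> W"
    and W_sdiff: "X \<in> W \<Longrightarrow> Y \<in> W \<Longrightarrow> X \<triangle> Y \<in> W"
begin

text \<open>\<open>U\<close> is the support: the potential counts as zero outside it and must change
  by the gain along an edge inside it. A loop at a vertex of \<open>U\<close> is satisfied only if
  its singleton lies in \<open>W\<close>.\<close>

definition sat :: "'v set \<Rightarrow> ('v \<Rightarrow> 'e set) \<Rightarrow> 'e \<Rightarrow> bool" where
  "sat U f e \<longleftrightarrow> (\<forall>u w. en e = {u, w} \<longrightarrow>
     (u \<in> U \<longleftrightarrow> w \<in> U) \<and> (u \<in> U \<longrightarrow> f u \<triangle> f w \<triangle> {e} \<in> W))"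

definition sats :: "'v set \<Rightarrow> ('v \<Rightarrow> 'e set) \<Rightarrow> 'e set \<Rightarrow> bool" where
  "sats U f A \<longleftrightarrow> (\<forall>a\<in>A. sat U f a)"

text \<open>The closure is defined dually: potentials play the part of linear functionals, and
  satisfying an edge that of vanishing on it.\<close>

definition span :: "'e set \<Rightarrow> 'e set" where
  "span A = {e \<in> E. \<forall>U f. sats U f A \<longrightarrow> sat U f e}"

lemma W_iff: "X \<in> W \<Longrightarrow> X \<triangle> Y \<in> W \<longleftrightarrow> Y \<in> W"
  using W_sdiff[of X Y] W_sdiff[of X "X \<triangle> Y"] by auto

lemma sat_iff:
  "en e = {u, w} \<Longrightarrow>
     sat U f e \<longleftrightarrow> (u \<in> U \<longleftrightarrow> w \<in> U) \<and> (u \<in> U \<longrightarrow> f u \<triangle> f w \<triangle> {e} \<in> W)"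
  unfolding sat_def by (auto simp: doubleton_eq_iff sdiff_commute)

lemma not_satE:
  assumes "e \<in> E" "\<not> sat U f e"
  obtains u w where "en e = {u, w}" "u \<in> U" "w \<in> U \<Longrightarrow> f u \<triangle> f w \<triangle> {e} \<notin> W"
proof -
  obtain u w where uw: "en e = {u, w}" using two_ends[OF assms(1)] by blast
  then have wu: "en e = {w, u}" by auto
  show ?thesis
  proof (cases "u \<in> U")
    case True
    then show ?thesis using that[OF uw] assms(2) sat_iff[OF uw, of U f] by blast
  next
    case False
    then show ?thesis using that[OF wu] assms(2) sat_iff[OF wu, of U f] by blast
  qed
qed

lemma sats_insert: "sats U f (insert a A) \<longleftrightarrow> sat U f a \<and> sats U f A"
  by (auto simp: sats_def)

lemma sats_mono: "sats U f B \<Longrightarrow> A \<subseteq> B \<Longrightarrow> sats U f A"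
  by (auto simp: sats_def)

lemma spanI: "e \<in> E \<Longrightarrow> (\<And>U f. sats U f A \<Longrightarrow> sat U f e) \<Longrightarrow> e \<in> span A"
  by (simp add: span_def)

lemma spanD: "e \<in> span A \<Longrightarrow> sats U f A \<Longrightarrow> sat U f e"
  by (simp add: span_def)

lemma spanE: "e \<in> span A \<Longrightarrow> e \<in> E"
  by (simp add: span_def)

lemma sats_conn:
  assumes "sats U f A" "conn en A u w"
  shows "u \<in> U \<longleftrightarrow> w \<in> U"
  using assms(2)
proof (induction rule: conn_induct)
  case (step w e x)
  then show ?case using assms(1) sat_iff[of e w x U f] by (simp add: sats_def)
qed simp

text \<open>Along every edge of \<open>A\<close> both labels change by the same gain, so their
  difference modulo \<open>W\<close> is constant on a component.\<close>

lemma sats_scale: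
  assumes "sats U f A" "sats U' f' A" "conn en A u w" "u \<in> U" "u \<in> U'"
  shows "f u \<triangle> f' u \<triangle> (f w \<triangle> f' w) \<in> W"
  using assms(3)
proof (induction rule: conn_induct)
  case refl
  show ?case by simp
next
  case (step w e x)
  have "w \<in> U" "w \<in> U'"
    using sats_conn[OF assms(1) step.hyps(1)] sats_conn[OF assms(2) step.hyps(1)] assms by auto
  then have "f w \<triangle> f x \<triangle> {e} \<in> W" "f' w \<triangle> f' x \<triangle> {e} \<in> W"
    using step assms(1,2) sat_iff[of e w x] by (auto simp: sats_def)
  then have "(f u \<triangle> f' u \<triangle> (f w \<triangle> f' w)) \<triangle> ((f w \<triangle> f x \<triangle> {e}) \<triangle> (f' w \<triangle> f' x \<triangle> {e})) \<in> W"
    using step.IH by (blast intro: W_sdiff)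
  then show ?case by (simp add: sdiff_ac)
qed

section \<open>Restricting and gluing potentials along components\<close>

text \<open>Says that \<open>K\<close> is a union of components of \<open>A\<close>; a single
  implication suffices because both orders of the ends are quantified.\<close>

definition sep :: "'e set \<Rightarrow> 'v set \<Rightarrow> bool" where
  "sep A K \<longleftrightarrow> (\<forall>a\<in>A. \<forall>u w. en a = {u, w} \<longrightarrow> u \<in> K \<longrightarrow> w \<in> K)"

lemma sep_comp: "sep A {y. conn en A r y}"
  unfolding sep_def by (auto intro: conn_step)

lemma sepD: "sep A K \<Longrightarrow> a \<in> A \<Longrightarrow> en a = {u, w} \<Longrightarrow> u \<in> K \<longleftrightarrow> w \<in> K"
  unfolding sep_def by (metis insert_commute)

text \<open>No edge of \<open>A\<close> leaves \<open>K\<close>, so the potential may be chosen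
  independently inside and outside \<open>K\<close>.\<close>

lemma sats_glue:
  assumes "sep A K" "sats U1 f1 A" "sats U2 f2 A"
  shows "sats (U1 \<inter> K \<union> (U2 - K)) (\<lambda>y. if y \<in> K then f1 y else f2 y) A"
  unfolding sats_def
proof
  fix a assume a: "a \<in> A"
  show "sat (U1 \<inter> K \<union> (U2 - K)) (\<lambda>y. if y \<in> K then f1 y else f2 y) a"
    unfolding sat_def
  proof (intro allI impI)
    fix u w assume uw: "en a = {u, w}"
    have "sat U1 f1 a" "sat U2 f2 a"
      using assms a by (auto simp: sats_def)
    then show "(u \<in> U1 \<inter> K \<union> (U2 - K) \<longleftrightarrow> w \<in> U1 \<inter> K \<union> (U2 - K)) \<and>
        (u \<in> U1 \<inter> K \<union> (U2 - K) \<longrightarrow>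
          (if u \<in> K then f1 u else f2 u) \<triangle> (if w \<in> K then f1 w else f2 w) \<triangle> {a} \<in> W)"
      using sepD[OF assms(1) a uw] by (auto simp: sat_iff[OF uw])
  qed
qed

lemma sats_empty: "sats {} f A"
  by (simp add: sats_def sat_def)

lemma sats_restrict:
  assumes "sep A K" "sats U f A"
  shows "sats (U \<inter> K) f A"
  using sats_glue[OF assms sats_empty[of f]] by (simp cong: if_cong)

lemma sats_shift: "sats U f A \<Longrightarrow> sats U (\<lambda>y. f y \<triangle> c) A"
  unfolding sats_def sat_def by (auto simp: sdiff_ac)

lemma comp_subset:
  assumes "sats U f A" "r \<in> U"
  shows "U \<inter> {y. conn en A r y} = {y. conn en A r y}"
  using sats_conn[OF assms(1)] assms(2) by auto

text \<open>If the conclusion fails, some \<open>(V, g)\<close> satisfies \<open>A\<close> and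
  \<open>a\<close> but violates \<open>b\<close>, while some \<open>(K, f)\<close> on a single
  component satisfies \<open>A\<close> but violates \<open>a\<close>. Restricting, combining or
  rescaling them yields a potential that satisfies \<open>A\<close> and \<open>b\<close> but not
  \<open>a\<close>, against \<open>key\<close>, unless a case is contradictory outright.\<close>

lemma span_exchange:
  assumes A: "A \<subseteq> E" and b: "b \<in> E" and ab: "a \<in> span (insert b A)" and a: "a \<notin> span A"
  shows "b \<in> span (insert a A)"
proof (rule ccontr)
  assume nb: "b \<notin> span (insert a A)"
  have aE: "a \<in> E" using ab by (rule spanE)
  have key: "sat U f a" if "sats U f A" "sat U f b" for U f
    using spanD[OF ab, of U f] that by (simp add: sats_insert)
  obtain U0 f where U0: "sats U0 f A" "\<not> sat U0 f a"
    using a aE spanI by blast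
  obtain c d where cd: "en a = {c, d}" "c \<in> U0" "d \<in> U0 \<Longrightarrow> f c \<triangle> f d \<triangle> {a} \<notin> W"
    using not_satE[OF aE U0(2)] by blast
  define K where "K = {y. conn en A c y}"
  have cK: "c \<in> K" by (simp add: K_def)
  have KU: "K \<subseteq> U0" using comp_subset[OF U0(1) cd(2)] by (auto simp: K_def)
  have K: "sats K f A"
    using sats_restrict[OF sep_comp U0(1), of c] comp_subset[OF U0(1) cd(2)] by (simp add: K_def)
  have bad_a: "d \<in> K \<Longrightarrow> f c \<triangle> f d \<triangle> {a} \<notin> W"
    using cd KU by blast
  have na: "\<not> sat K f a"
    using bad_a cK by (auto simp: sat_iff[OF cd(1)])
  then have "\<not> sat K f b" using key K by blast
  then obtain u w where uw: "en b = {u, w}" "u \<in> K" "w \<in> K \<Longrightarrow> f u \<triangle> f w \<triangle> {b} \<notin> W"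
    using not_satE[OF b] by blast
  obtain V g where "sats V g (insert a A)" and "\<not> sat V g b"
    using nb spanI[OF b] by blast
  then have V: "sats V g A" "sat V g a" "\<not> sat V g b"
    by (simp_all add: sats_insert)
  have conn_K: "conn en A x y" if "x \<in> K" "y \<in> K" for x y
    using that conn_join[of en A c x y] by (simp add: K_def)
  have K_V: "x \<in> V \<longleftrightarrow> c \<in> V" if "x \<in> K" for x
    using sats_conn[OF V(1) conn_K[OF that cK]] .
  have cV: "d \<notin> K" "d \<in> V" if "c \<in> V"
  proof -
    show "d \<in> V" using V(2) that by (simp add: sat_iff[OF cd(1)])
    \<comment> \<open>With both ends of \<open>a\<close> in \<open>K\<close>, the labellings
      \<open>f\<close> and \<open>g\<close> would differ by a constant there, but only
      \<open>g\<close> satisfies \<open>a\<close>.\<close>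
    show "d \<notin> K"
    proof
      assume d: "d \<in> K"
      have "f c \<triangle> g c \<triangle> (f d \<triangle> g d) \<in> W"
        using sats_scale[OF K V(1) conn_K[OF cK d] cK that] .
      moreover have "g c \<triangle> g d \<triangle> {a} \<in> W"
        using V(2) that by (simp add: sat_iff[OF cd(1)])
      ultimately have "(f c \<triangle> g c \<triangle> (f d \<triangle> g d)) \<triangle> (g c \<triangle> g d \<triangle> {a}) \<in> W"
        by (rule W_sdiff)
      then show False using bad_a[OF d] by (simp add: sdiff_ac)
    qed
  qed
  define Kd where "Kd = {y. conn en A d y}"
  have K_Kd: "x \<notin> Kd" if "c \<in> V" "x \<in> K" for x
    using cV(1)[OF that(1)] that(2) conn_trans[OF _ conn_sym, of en A c x d]
    by (auto simp: K_def Kd_def)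
  have Kd: "sats Kd g A" if "c \<in> V"
    using sats_restrict[OF sep_comp V(1), of d] comp_subset[OF V(1) cV(2)[OF that]]
    by (simp add: Kd_def)
  \<comment> \<open>\<open>Kd\<close> misses \<open>u\<close>. If it also misses \<open>w\<close>,
    then \<open>g\<close> restricted to \<open>Kd\<close> satisfies \<open>b\<close> trivially, yet
    its support contains just one end of \<open>a\<close>.\<close>
  have contra_Kd: False if "c \<in> V" "w \<notin> Kd"
  proof -
    have "sat Kd g b" using K_Kd[OF that(1) uw(2)] that by (simp add: sat_iff[OF uw(1)])
    then have "sat Kd g a" using key Kd that by blast
    then show False using K_Kd[OF that(1) cK] by (simp add: sat_iff[OF cd(1)] Kd_def)
  qed
  define Kw where "Kw = {y. conn en A w y}"
  have contra_Kw: False if "w \<notin> K" "c \<notin> V"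
  proof -
    have "u \<notin> V" using K_V[OF uw(2)] that by simp
    then have wV: "w \<in> V" using V(3) by (auto simp: sat_iff[OF uw(1)])
    \<comment> \<open>Rescaling \<open>g\<close> on the component of \<open>w\<close> makes
      \<open>b\<close> satisfied. The edge \<open>a\<close> stays violated: its end \<open>d\<close>
      lies either in \<open>K\<close>, where the labels are those of \<open>f\<close>, or outside
      the new support.\<close>
    define h where "h = (\<lambda>y. if y \<in> K then f y else g y \<triangle> (f u \<triangle> g w \<triangle> {b}))"
    have disj: "y \<notin> K" if "y \<in> Kw" for y
      using that \<open>w \<notin> K\<close> conn_trans[OF _ conn_sym, of en A c y w] by (auto simp: K_def Kw_def)
    have "sats Kw g A"
      using sats_restrict[OF sep_comp V(1), of w] comp_subset[OF V(1) wV] by (simp add: Kw_def)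
    then have "sats (K \<inter> K \<union> (Kw - K)) h A"
      unfolding h_def
      by (intro sats_glue K sats_shift) (simp_all add: K_def sep_comp)
    moreover have U: "K \<inter> K \<union> (Kw - K) = K \<union> Kw" by blast
    ultimately have "sats (K \<union> Kw) h A" by simp
    moreover have "sat (K \<union> Kw) h b"
      using uw(2) that by (simp add: sat_iff[OF uw(1)] h_def Kw_def sdiff_ac)
    ultimately have "sat (K \<union> Kw) h a" by (rule key)
    then have d: "d \<in> K \<union> Kw" "h c \<triangle> h d \<triangle> {a} \<in> W"
      using cK by (auto simp: sat_iff[OF cd(1)])
    show False
    proof (cases "d \<in> K")
      case True
      then show False using d(2) bad_a cK by (simp add: h_def)
    next
      case False
      then have "d \<in> V" using d(1) sats_conn[OF V(1), of w d] wV by (simp add: Kw_def)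
      then show False using V(2) that by (simp add: sat_iff[OF cd(1)])
    qed
  qed
  show False
  proof (cases "c \<in> V")
    case False
    then have "w \<in> K" using contra_Kw by blast
    then show False
      using False K_V[OF uw(2)] K_V[of w] V(3) by (simp add: sat_iff[OF uw(1)])
  next
    case True
    then have wd: "w \<in> Kd" using contra_Kd by blast
    then have "w \<in> V" using sats_conn[OF V(1), of d w] cV[OF True] by (simp add: Kd_def)
    moreover have "u \<in> V" using K_V[OF uw(2)] True by simp
    ultimately have bad: "g u \<triangle> g w \<triangle> {b} \<notin> W"
      using V(3) by (simp add: sat_iff[OF uw(1)])
    \<comment> \<open>Shifting by the defect of \<open>b\<close> on \<open>Kd\<close> repairs
      \<open>b\<close> and passes the same defect on to \<open>a\<close>, which has exactly one end
      in \<open>Kd\<close>.\<close>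
    define h where "h = (\<lambda>y. if y \<in> Kd then g y \<triangle> (g u \<triangle> g w \<triangle> {b}) else g y)"
    have "sats (V \<inter> Kd \<union> (V - Kd)) h A"
      unfolding h_def
      by (intro sats_glue V sats_shift) (simp_all add: Kd_def sep_comp)
    then have h: "sats V h A" by (simp add: Int_Diff_Un)
    have "sat V h b"
      using \<open>u \<in> V\<close> \<open>w \<in> V\<close> wd K_Kd[OF True uw(2)]
      by (simp add: sat_iff[OF uw(1)] h_def sdiff_ac)
    then have "sat V h a" using key h by blast
    then have "g c \<triangle> (g d \<triangle> (g u \<triangle> g w \<triangle> {b})) \<triangle> {a} \<in> W"
      using True K_Kd[OF True cK] by (simp add: sat_iff[OF cd(1)] h_def Kd_def)
    moreover have "g c \<triangle> g d \<triangle> {a} \<in> W"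
      using V(2) True by (simp add: sat_iff[OF cd(1)])
    ultimately have "(g c \<triangle> g d \<triangle> {a}) \<triangle> (g c \<triangle> (g d \<triangle> (g u \<triangle> g w \<triangle> {b})) \<triangle> {a}) \<in> W"
      by (rule W_sdiff[rotated])
    then show False using bad by (simp add: sdiff_ac)
  qed
qed

sublocale closure_matroid E span
proof
  show "finite E" by (rule finite_edges)
  show "span A \<subseteq> E" for A by (auto simp: span_def)
  show "A \<subseteq> span A" if "A \<subseteq> E" for A
    using that by (auto simp: span_def sats_def)
  show "span A \<subseteq> span B" if "A \<subseteq> span B" for A B
    using that unfolding span_def sats_def by blast
qed (rule span_exchange)

section \<open>Potentials along paths, hyperplanes and exchanges\<close>

text \<open>The gains telescope, and a simple path uses each of its edges once.\<close>

lemma upath_sats: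
  assumes "upath en vs es" "sats U f (set es)" "hd vs \<in> U"
  shows "f (hd vs) \<triangle> f (last vs) \<triangle> set es \<in> W"
  using assms
proof (induction es arbitrary: vs)
  case Nil
  then obtain x where "vs = [x]" by (auto simp: upath_iff length_Suc_conv)
  then show ?case by simp
next
  case (Cons e es)
  then obtain u w vs' where vs: "vs = u # w # vs'"
    by (auto simp: upath_iff length_Suc_conv)
  have e: "en e = {u, w}" and p: "upath en (w # vs') es" and sat_e: "sat U f e"
      and s: "sats U f (set es)" and e_es: "e \<notin> set es"
    using Cons.prems vs upath_distinct[OF Cons.prems(1)] by (auto simp: sats_insert)
  have "u \<in> U" using Cons.prems vs by simp
  then have "w \<in> U" and uw: "f u \<triangle> f w \<triangle> {e} \<in> W"
    using sat_e by (auto simp: sat_iff[OF e])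
  then have "f w \<triangle> f (last (w # vs')) \<triangle> set es \<in> W"
    using Cons.IH[OF p s] by simp
  then have "(f u \<triangle> f w \<triangle> {e}) \<triangle> (f w \<triangle> f (last (w # vs')) \<triangle> set es) \<in> W"
    using uw by (blast intro: W_sdiff)
  moreover have "set (e # es) = {e} \<triangle> set es"
    using e_es by (auto simp: sdiff_def)
  ultimately show ?case using vs by (simp add: sdiff_ac)
qed

lemma component_violation:
  assumes "e \<in> E" "sats U f A" "\<not> sat U f e"
  obtains r where "sats {y. conn en A r y} f A" "\<not> sat {y. conn en A r y} f e"
proof -
  obtain u w where uw: "en e = {u, w}" "u \<in> U" "w \<in> U \<Longrightarrow> f u \<triangle> f w \<triangle> {e} \<notin> W"
    using not_satE[OF assms(1,3)] by blast
  have sub: "U \<inter> {y. conn en A u y} = {y. conn en A u y}"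
    by (rule comp_subset[OF assms(2) uw(2)])
  have "sats (U \<inter> {y. conn en A u y}) f A"
    by (rule sats_restrict[OF sep_comp assms(2)])
  moreover have "w \<in> {y. conn en A u y} \<Longrightarrow> f u \<triangle> f w \<triangle> {e} \<notin> W"
    using uw(3) sub by blast
  then have "\<not> sat {y. conn en A u y} f e"
    by (auto simp: sat_iff[OF uw(1)])
  ultimately show ?thesis using that[of u] by (simp add: sub)
qed

text \<open>\<open>X\<close> spans a hyperplane. The edges satisfied by \<open>(U, f)\<close> form a
  flat that contains \<open>X\<close> but not \<open>b\<close>, so they are that hyperplane.\<close>

lemma hyperplane_bas_iff:
  assumes "bas (insert b X)" "sats U f X" "\<not> sat U f b" "a \<in> E"
  shows "bas (insert a X) \<longleftrightarrow> \<not> sat U f a"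
proof
  assume a: "bas (insert a X)"
  show "\<not> sat U f a"
  proof
    assume "sat U f a"
    then have "sats U f (insert a X)" using assms(2) by (simp add: sats_insert)
    moreover have "b \<in> span (insert a X)" using a bas_E[OF assms(1)] by (auto simp: bas_iff)
    ultimately show False using spanD assms(3) by blast
  qed
next
  assume "\<not> sat U f a"
  then have "a \<notin> span X" using spanD[OF _ assms(2)] by blast
  then show "bas (insert a X)" using bas_swap[OF assms(1,4)] by blast
qed

text \<open>The potential tells \<open>a\<close> and \<open>b\<close> apart over
  \<open>X - {z}\<close>: adding the satisfied one leaves the violated one outside the closure, so
  both can be added.\<close>

lemma bas_exchange_sat:
  assumes "bas (insert a X)" "bas (insert b X)" "a \<notin> X" "b \<notin> X" "z \<in> X"
    "sats T h (X - {z})" "sat T h a \<noteq> sat T h b"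
  shows "bas (insert a (insert b (X - {z})))"
proof -
  have E: "a \<in> E" "b \<in> E" using assms(1,2) bas_E by blast+
  show ?thesis
  proof (cases "sat T h b")
    case True
    then have "sats T h (insert b (X - {z}))" using assms(6) by (simp add: sats_insert)
    then have "a \<notin> span (insert b (X - {z}))" using spanD assms(7) True by blast
    then show ?thesis using bas_exchange[OF assms(2,4,5) E(1)] by blast
  next
    case False
    then have "sats T h (insert a (X - {z}))" using assms(6,7) by (simp add: sats_insert)
    then have "b \<notin> span (insert a (X - {z}))" using spanD False by blast
    then have "bas (insert b (insert a (X - {z})))"
      using bas_exchange[OF assms(1,3,5) E(2)] by blast
    then show ?thesis by (simp add: insert_commute)
  qed
qed

text \<open>A component of an independent set that supports a potential is a tree. Were the ends of
  \<open>z\<close> joined in another way, every potential on \<open>X - {z}\<close> would be zero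
  there or a shift of \<open>f\<close>, and would satisfy \<open>z\<close>.\<close>

lemma bridge:
  assumes "ind X" "sats U f X" "z \<in> X" "en z = {a, b}" "a \<in> U"
  shows "\<not> conn en (X - {z}) a b"
proof
  assume c: "conn en (X - {z}) a b"
  have s: "sats U f (X - {z})" using assms(2) by (rule sats_mono) blast
  have "sat U f z" using assms(2,3) by (simp add: sats_def)
  then have ab: "f a \<triangle> f b \<triangle> {z} \<in> W" using assms(5) by (simp add: sat_iff[OF assms(4)])
  have "z \<in> span (X - {z})"
  proof (rule spanI)
    show "z \<in> E" using assms(1,3) ind_E by blast
    fix T h assume T: "sats T h (X - {z})"
    have eq: "a \<in> T \<longleftrightarrow> b \<in> T" by (rule sats_conn[OF T c])
    have "h a \<triangle> h b \<triangle> {z} \<in> W" if "a \<in> T"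
    proof -
      have "f a \<triangle> h a \<triangle> (f b \<triangle> h b) \<in> W"
        by (rule sats_scale[OF s T c assms(5) that])
      then have "(f a \<triangle> h a \<triangle> (f b \<triangle> h b)) \<triangle> (f a \<triangle> f b \<triangle> {z}) \<in> W"
        using ab by (rule W_sdiff)
      then show ?thesis by (simp add: sdiff_ac)
    qed
    then show "sat T h z" using eq by (simp add: sat_iff[OF assms(4)])
  qed
  then show False using assms(1,3) by (auto simp: ind_def)
qed

lemma path_cut:
  assumes X: "ind X" "sats U f X" and p: "upath en vs es" "set es \<subseteq> X" "z \<in> set es" "hd vs \<in> U"
  shows "\<not> conn en (X - {z}) (hd vs) (last vs)"
proof
  assume c: "conn en (X - {z}) (hd vs) (last vs)"
  obtain a b where ab: "en z = {a, b}" "conn en (set es - {z}) (hd vs) a"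
      "conn en (set es - {z}) b (last vs)"
    using upath_split[OF p(1,3)] by blast
  have sub: "set es - {z} \<subseteq> X - {z}" using p(2) by blast
  have h: "conn en (X - {z}) (hd vs) a" "conn en (X - {z}) b (last vs)"
    using ab(2,3) sub by (auto elim: conn_mono)
  have "a \<in> U"
    using sats_conn[OF X(2) conn_mono[OF h(1)], of] p(4) by blast
  moreover have "conn en (X - {z}) a b"
    by (rule conn_trans[OF conn_join[OF h(1) c] conn_sym[OF h(2)]])
  moreover have "z \<in> X" using p by blast
  ultimately show False using bridge[OF X] ab(1) by blast
qed

end


section \<open>Frame matroids of linear classes\<close>

text \<open>\<open>\<B>\<close> and \<open>W\<close> are compared on cycles only, since
  \<open>W\<close>, being closed under sums, also contains sets that are not cycles.\<close>

locale linear_frame = potentials "edges R" "ends R" W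
  for R :: "('v, 'e) mgraph" and W :: "'e set set" +
  fixes \<B> :: "'e set set"
  assumes ends_verts: "e \<in> edges R \<Longrightarrow> ends R e \<subseteq> verts R"
    and balanced_iff: "is_cycle R D \<Longrightarrow> D \<in> \<B> \<longleftrightarrow> D \<in> W"
begin

lemma edge_induced_simps [simp]:
  "edges (edge_induced G A) = A" "verts (edge_induced G A) = edge_verts G A"
  "ends (edge_induced G A) = ends G" "edge_verts (edge_induced G A) D = edge_verts G D"
  by (simp_all add: edge_induced_def edge_verts_def)

lemma cycle_edge_induced:
  assumes "A \<subseteq> edges R"
  shows "is_cycle (edge_induced R A) D \<longleftrightarrow> is_cycle R D \<and> D \<subseteq> A"
proof
  assume D: "is_cycle (edge_induced R A) D"
  have DA: "D \<subseteq> A" using cycle_subset[OF D] by simp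
  then have "edge_verts R D \<subseteq> verts R"
    using assms ends_verts unfolding edge_verts_def by blast
  then have "is_cycle R D"
    using cycle_transfer[OF D, of R] DA assms by simp
  then show "is_cycle R D \<and> D \<subseteq> A" using DA by simp
next
  assume D: "is_cycle R D \<and> D \<subseteq> A"
  then have "edge_verts R D \<subseteq> edge_verts R A" unfolding edge_verts_def by blast
  then show "is_cycle (edge_induced R A) D"
    using cycle_transfer[of R D "edge_induced R A"] D by simp
qed

lemma component_edge_induced:
  "X \<in> components (edge_induced R A) \<longleftrightarrow> (\<exists>x\<in>edge_verts R A. X = {y. conn (ends R) A x y})"
  by (auto simp: components_def edge_induced_def conn_def)

section \<open>Frame independence in terms of cycles and connections\<close>

lemma frame_indepI:
  assumes A: "A \<subseteq> edges R"
    and unbal: "\<And>D. is_cycle R D \<Longrightarrow> D \<subseteq> A \<Longrightarrow> D \<notin> W"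
    and unique: "\<And>D D' x y. is_cycle R D \<Longrightarrow> D \<subseteq> A \<Longrightarrow> is_cycle R D' \<Longrightarrow> D' \<subseteq> A \<Longrightarrow>
        x \<in> edge_verts R D \<Longrightarrow> y \<in> edge_verts R D' \<Longrightarrow> conn (ends R) A x y \<Longrightarrow> D' = D"
  shows "frame_indep R \<B> A"
  unfolding frame_indep_def cycle_edge_induced[OF A]
proof (intro conjI ballI allI impI)
  show "A \<subseteq> edges R" by (rule A)
  fix X D assume "X \<in> components (edge_induced R A)"
    and D: "(is_cycle R D \<and> D \<subseteq> A) \<and> edge_verts R D \<subseteq> X"
  then obtain x where X: "X = {y. conn (ends R) A x y}"
    using component_edge_induced[of X A] by blast
  show "D \<notin> \<B>" using unbal[of D] D balanced_iff[of D] by simp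
  fix D' assume D': "(is_cycle R D' \<and> D' \<subseteq> A) \<and> edge_verts R D' \<subseteq> X"
  have cyc: "is_cycle R D" "is_cycle R D'" using D D' by simp_all
  obtain y where y: "y \<in> edge_verts R D" using cycle_vertex[OF cyc(1)] .
  obtain z where z: "z \<in> edge_verts R D'" using cycle_vertex[OF cyc(2)] .
  have "conn (ends R) A x y" "conn (ends R) A x z"
    using y z D D' X by auto
  then have "conn (ends R) A y z" by (rule conn_join)
  then show "D' = D" using unique[of D D' y z] y z D D' by simp
qed

lemma frame_indepD:
  assumes ind: "frame_indep R \<B> A"
  shows "A \<subseteq> edges R"
    and "\<And>D. is_cycle R D \<Longrightarrow> D \<subseteq> A \<Longrightarrow> D \<notin> W"
    and "\<And>D D' x y. is_cycle R D \<Longrightarrow> D \<subseteq> A \<Longrightarrow> is_cycle R D' \<Longrightarrow> D' \<subseteq> A \<Longrightarrow>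
        x \<in> edge_verts R D \<Longrightarrow> y \<in> edge_verts R D' \<Longrightarrow> conn (ends R) A x y \<Longrightarrow> D' = D"
proof -
  show A: "A \<subseteq> edges R" using ind by (simp add: frame_indep_def)
  have main: "D \<notin> \<B>" "\<And>D'. is_cycle R D' \<Longrightarrow> D' \<subseteq> A \<Longrightarrow> edge_verts R D' \<subseteq> X \<Longrightarrow> D' = D"
    if "X = {y. conn (ends R) A x y}" "x \<in> edge_verts R D" "is_cycle R D" "D \<subseteq> A" "edge_verts R D \<subseteq> X"
    for X x D
  proof -
    have "x \<in> edge_verts R A" using that(2,4) by (auto simp: edge_verts_def)
    then have "X \<in> components (edge_induced R A)"
      using component_edge_induced[of X A] that(1) by blast
    then have *: "\<forall>D. is_cycle (edge_induced R A) D \<and> edge_verts R D \<subseteq> X \<longrightarrow> D \<notin> \<B> \<and>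
        (\<forall>D'. is_cycle (edge_induced R A) D' \<and> edge_verts R D' \<subseteq> X \<longrightarrow> D' = D)"
      using ind by (simp add: frame_indep_def)
    then show "D \<notin> \<B>" using that cycle_edge_induced[OF A] by simp
    show "D' = D" if "is_cycle R D'" "D' \<subseteq> A" "edge_verts R D' \<subseteq> X" for D'
      using * that \<open>is_cycle R D\<close> \<open>D \<subseteq> A\<close> \<open>edge_verts R D \<subseteq> X\<close> cycle_edge_induced[OF A] by metis
  qed
  have sub: "edge_verts R D \<subseteq> {y. conn (ends R) A x y}"
    if "is_cycle R D" "D \<subseteq> A" "y \<in> edge_verts R D" "conn (ends R) A x y" for D x y
  proof
    fix z assume "z \<in> edge_verts R D"
    then have "conn (ends R) (D - {undefined}) y z"
      by (intro conn_cycle_minus that)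
    then have "conn (ends R) A y z" by (rule conn_mono) (use that(2) in blast)
    then show "z \<in> {y. conn (ends R) A x y}" using conn_trans[OF that(4)] by simp
  qed
  show "D \<notin> W" if "is_cycle R D" "D \<subseteq> A" for D
  proof -
    obtain x where x: "x \<in> edge_verts R D" using cycle_vertex[OF \<open>is_cycle R D\<close>] .
    show ?thesis
      using main(1)[OF refl x that sub[OF that x conn_refl]] balanced_iff[OF that(1)] by simp
  qed
  show "D' = D" if "is_cycle R D" "D \<subseteq> A" "is_cycle R D'" "D' \<subseteq> A"
    "x \<in> edge_verts R D" "y \<in> edge_verts R D'" "conn (ends R) A x y" for D D' x y
    using main(2)[OF refl that(5,1,2) sub[OF that(1,2,5) conn_refl] that(3,4) sub[OF that(3,4,6,7)]] .
qed

lemma conn_imp_cycle: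
  assumes "A \<subseteq> edges R" "e \<in> edges R" "e \<notin> A" "ends R e = {u, w}" "conn (ends R) A u w"
  obtains D where "is_cycle R D" "e \<in> D" "D \<subseteq> insert e A"
proof -
  obtain vs es where p: "upath (ends R) vs es" "hd vs = u" "last vs = w" "set es \<subseteq> A"
    using conn_imp_upath[OF assms(5)] by blast
  have "set vs \<subseteq> verts R"
  proof (cases "es = []")
    case True
    then have "vs = [u]" using p by (auto simp: upath_iff length_Suc_conv)
    then show ?thesis using ends_verts assms by auto
  next
    case False
    have "(\<Union>e\<in>set es. ends R e) \<subseteq> verts R"
      using p(4) assms(1) ends_verts by blast
    then show ?thesis using upath_edge_verts[OF p(1) False] by simp
  qed
  then have "is_cycle R (insert e (set es))"
    using p assms by (intro cycleI[OF p(1)]) auto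
  then show ?thesis using that p by blast
qed

section \<open>Existence of potentials on forests\<close>

text \<open>Edges are added one by one. Without cycles a new edge joins two components, and shifting
  the labels on one of them satisfies it.\<close>

lemma acyclic_potential:
  assumes "finite A" "A \<subseteq> edges R" "\<And>D. is_cycle R D \<Longrightarrow> \<not> D \<subseteq> A"
  shows "\<exists>f. sats UNIV f A"
  using assms
proof (induction A rule: finite_induct)
  case empty
  show ?case by (simp add: sats_def)
next
  case (insert e A)
  obtain f where f: "sats UNIV f A" using insert by (metis subset_insertI2 insert_subset)
  obtain u w where uw: "ends R e = {u, w}" using two_ends insert by blast
  have nc: "\<not> conn (ends R) A w u"
  proof
    assume "conn (ends R) A w u"
    then obtain D where "is_cycle R D" "D \<subseteq> insert e A"
      using conn_imp_cycle[of A e u w] insert uw conn_sym by (metis insert_subset)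
    then show False using insert by blast
  qed
  define K where "K = {y. conn (ends R) A w y}"
  define h where "h = (\<lambda>y. if y \<in> K then f y \<triangle> (f u \<triangle> f w \<triangle> {e}) else f y)"
  have "sats (UNIV \<inter> K \<union> (UNIV - K)) h A"
    unfolding h_def by (intro sats_glue sats_shift f) (simp add: K_def sep_comp)
  moreover have "sat UNIV h e"
    using nc by (simp add: sat_iff[OF uw] h_def K_def sdiff_ac)
  ultimately have "sats UNIV h (insert e A)" by (simp add: sats_insert)
  then show ?case by blast
qed

text \<open>The edges of \<open>A\<close> inside \<open>K\<close> form a forest, and the other edges
  of \<open>A\<close> have no end in the component \<open>K\<close>.\<close>

lemma component_potential:
  assumes "A \<subseteq> edges R" "K = {y. conn (ends R) A r y}"
    "\<And>D. is_cycle R D \<Longrightarrow> D \<subseteq> A \<Longrightarrow> \<not> edge_verts R D \<subseteq> K"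
  obtains f where "sats K f A"
proof -
  define A' where "A' = {a \<in> A. ends R a \<subseteq> K}"
  have "\<not> D \<subseteq> A'" if "is_cycle R D" for D
    using assms(3)[OF that] by (auto simp: A'_def edge_verts_def)
  moreover have "A' \<subseteq> edges R" "finite A'"
    using assms finite_edges by (auto simp: A'_def intro: finite_subset)
  ultimately obtain f where f: "sats UNIV f A'"
    using acyclic_potential by blast
  have "sat K f a" if a: "a \<in> A" for a
  proof -
    obtain u w where uw: "ends R a = {u, w}" using two_ends a assms by blast
    have "u \<in> K \<longleftrightarrow> w \<in> K" using sepD[OF sep_comp a uw] assms(2) by blast
    moreover have "f u \<triangle> f w \<triangle> {a} \<in> W" if "u \<in> K" "w \<in> K"
      using f that a uw by (auto simp: A'_def sats_def sat_iff[OF uw])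
    ultimately show ?thesis by (auto simp: sat_iff[OF uw])
  qed
  then show ?thesis using that by (auto simp: sats_def)
qed

section \<open>Potentials on balanced and unbalanced cycles\<close>

lemma cycle_sats:
  assumes "is_cycle R D" "e \<in> D" "sats U f (D - {e})" "ends R e = {u, w}" "u \<in> U"
  shows "w \<in> U" "f u \<triangle> f w \<triangle> (D - {e}) \<in> W"
proof -
  obtain vs es where p: "upath (ends R) vs es" "set es = D - {e}" "ends R e = {hd vs, last vs}"
    using cycle_path[OF assms(1,2)] by metis
  have c: "conn (ends R) (D - {e}) (hd vs) (last vs)"
    using upath_conn[OF p(1)] p(2) by simp
  have uw: "u = hd vs \<and> w = last vs \<or> u = last vs \<and> w = hd vs"
    using p(3) assms(4) by (auto simp: doubleton_eq_iff)
  then show "w \<in> U" using sats_conn[OF assms(3) c] assms(5) by auto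
  then have "hd vs \<in> U" using uw assms(5) by auto
  then have "f (hd vs) \<triangle> f (last vs) \<triangle> (D - {e}) \<in> W"
    using upath_sats[OF p(1)] p(2) assms(3) by simp
  then show "f u \<triangle> f w \<triangle> (D - {e}) \<in> W"
    using uw by (auto simp: sdiff_commute)
qed

lemma cycle_split: "e \<in> D \<Longrightarrow> D = {e} \<triangle> (D - {e})"
  by (auto simp: sdiff_def)

text \<open>Once around the cycle, the labels change by the sum of its gains, which is
  \<open>D\<close>; the last edge closes up exactly when this vanishes modulo
  \<open>W\<close>.\<close>

lemma cycle_sats_iff:
  assumes "is_cycle R D" "e \<in> D" "sats U f (D - {e})" "ends R e = {u, w}" "u \<in> U"
  shows "sat U f e \<longleftrightarrow> D \<in> W"
proof -
  have "sat U f e \<longleftrightarrow> f u \<triangle> f w \<triangle> {e} \<in> W"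
    using cycle_sats[OF assms] assms(5) by (simp add: sat_iff[OF assms(4)])
  also have "\<dots> \<longleftrightarrow> (f u \<triangle> f w \<triangle> (D - {e})) \<triangle> (f u \<triangle> f w \<triangle> {e}) \<in> W"
    using W_iff[OF cycle_sats(2)[OF assms]] by blast
  also have "(f u \<triangle> f w \<triangle> (D - {e})) \<triangle> (f u \<triangle> f w \<triangle> {e}) = {e} \<triangle> (D - {e})"
    by (simp add: sdiff_ac)
  also have "\<dots> = D" using cycle_split[OF assms(2)] by simp
  finally show ?thesis .
qed

lemma balanced_cycle_dependent:
  assumes "is_cycle R D" "D \<in> W" "e \<in> D"
  shows "e \<in> span (D - {e})"
proof (rule spanI)
  show e: "e \<in> edges R" using assms cycle_subset by blast
  fix U f assume s: "sats U f (D - {e})"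
  show "sat U f e"
  proof (rule ccontr)
    assume "\<not> sat U f e"
    then obtain u w where "ends R e = {u, w}" "u \<in> U" using not_satE[OF e] by metis
    then show False
      using cycle_sats_iff[OF assms(1,3) s] assms(2) \<open>\<not> sat U f e\<close> by blast
  qed
qed

lemma unbalanced_cycle_zero:
  assumes "is_cycle R D" "D \<notin> W" "sats U f D"
  shows "U \<inter> edge_verts R D = {}"
proof (rule ccontr)
  assume "U \<inter> edge_verts R D \<noteq> {}"
  then obtain e u where e: "e \<in> D" "u \<in> ends R e" "u \<in> U" by (auto simp: edge_verts_def)
  then obtain w where "ends R e = {u, w}"
    using two_ends cycle_subset[OF assms(1)] by (metis empty_iff insertE insert_commute subsetD)
  then show False
    using cycle_sats_iff[OF assms(1) e(1), of U f u w] assms(2,3) e sats_mono[OF assms(3)]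
    by (auto simp: sats_def)
qed

section \<open>Matroid independence agrees with frame independence\<close>

lemma ind_imp_frame_indep:
  assumes "ind A"
  shows "frame_indep R \<B> A"
proof (rule frame_indepI)
  show A: "A \<subseteq> edges R" using assms by (rule ind_E)
  have bal: "D \<notin> W" if "is_cycle R D" "D \<subseteq> A" for D
  proof
    assume "D \<in> W"
    obtain e where e: "e \<in> D" using cycle_nonempty[OF \<open>is_cycle R D\<close>] by blast
    then have "e \<in> span (D - {e})" using balanced_cycle_dependent that \<open>D \<in> W\<close> by blast
    moreover have "span (D - {e}) \<subseteq> span (A - {e})" using that A by (intro cl_mono) auto
    ultimately show False using assms e that by (auto simp: ind_def)
  qed
  then show "D \<notin> W" if "is_cycle R D" "D \<subseteq> A" for D using that .
  \<comment> \<open>An edge \<open>e\<close> of \<open>D\<close> outside \<open>D'\<close> is in the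
    closure of the rest. A potential on \<open>A - {e}\<close> violating \<open>e\<close> would have
    an end of \<open>e\<close> in its support; this end stays joined to \<open>D'\<close>, an
    unbalanced cycle, where the potential vanishes.\<close>
  have sub: "D \<subseteq> D'" if "is_cycle R D" "D \<subseteq> A" "is_cycle R D'" "D' \<subseteq> A"
      "x \<in> edge_verts R D" "y \<in> edge_verts R D'" "conn (ends R) A x y" for D D' x y
  proof (rule ccontr)
    assume "\<not> D \<subseteq> D'"
    then obtain e where e: "e \<in> D" "e \<notin> D'" by blast
    have De: "D - {e} \<subseteq> A - {e}" "D' \<subseteq> A - {e}" using that e by auto
    have "e \<in> span (A - {e})"
    proof (rule spanI)
      show eR: "e \<in> edges R" using e that A by blast
      fix U f assume s: "sats U f (A - {e})"
      show "sat U f e"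
      proof (rule ccontr)
        assume n: "\<not> sat U f e"
        obtain u w where uw: "ends R e = {u, w}" "u \<in> U" using not_satE[OF eR n] by metis
        have eD: "u \<in> edge_verts R D" "w \<in> edge_verts R D"
          using uw e by (auto simp: edge_verts_def)
        have D_conn: "conn (ends R) (A - {e}) z z'"
          if "z \<in> edge_verts R D" "z' \<in> edge_verts R D" for z z'
          using conn_cycle_minus[OF \<open>is_cycle R D\<close> that, of e] De by (blast intro: conn_mono)
        have "conn (ends R) (A - {e}) u y"
          using conn_remove[OF that(7) uw(1)] D_conn that(5) eD conn_trans by meson
        then have "y \<in> U" using sats_conn[OF s] uw by blast
        moreover have "U \<inter> edge_verts R D' = {}"
          using unbalanced_cycle_zero[OF that(3) bal[OF that(3,4)]] sats_mono[OF s De(2)] by blast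
        ultimately show False using that(6) by blast
      qed
    qed
    then show False using assms e that by (auto simp: ind_def)
  qed
  fix D D' x y
  assume "is_cycle R D" "D \<subseteq> A" "is_cycle R D'" "D' \<subseteq> A"
    "x \<in> edge_verts R D" "y \<in> edge_verts R D'" "conn (ends R) A x y"
  then show "D' = D"
    using sub[of D D' x y] sub[of D' D y x] conn_sym[of "ends R" A x y] by blast
qed

lemma frame_indep_imp_ind:
  assumes "frame_indep R \<B> A"
  shows "ind A"
  unfolding ind_def
proof (intro conjI ballI notI)
  note A = frame_indepD(1)[OF assms] and unbal = frame_indepD(2)[OF assms]
    and unique = frame_indepD(3)[OF assms]
  show "A \<subseteq> edges R" by (rule A)
  fix e assume e: "e \<in> A" and span: "e \<in> span (A - {e})"
  obtain u w where uw: "ends R e = {u, w}" using two_ends e A by blast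
  define K where "K x = {y. conn (ends R) (A - {e}) x y}" for x
  have Ae: "A - {e} \<subseteq> edges R" using A by blast
  show False
  proof (cases "conn (ends R) (A - {e}) u w")
    \<comment> \<open>The cycle closed by \<open>e\<close> is the only one in its component. Without
      \<open>e\<close> that component therefore has a potential, and it satisfies \<open>e\<close>
      only if the cycle is balanced.\<close>
    case True
    obtain D where D: "is_cycle R D" "e \<in> D" "D \<subseteq> A"
    proof -
      obtain D where "is_cycle R D" "e \<in> D" "D \<subseteq> insert e (A - {e})"
        using conn_imp_cycle[OF Ae _ _ uw True] e A by auto
      then show ?thesis using that e by (simp add: insert_absorb)
    qed
    have uD: "u \<in> edge_verts R D" using D uw by (auto simp: edge_verts_def)
    obtain f where f: "sats (K u) f (A - {e})"
    proof (rule component_potential[OF Ae, of "K u" u])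
      fix D' assume D': "is_cycle R D'" "D' \<subseteq> A - {e}"
      show "\<not> edge_verts R D' \<subseteq> K u"
      proof
        assume sub: "edge_verts R D' \<subseteq> K u"
        obtain z where z: "z \<in> edge_verts R D'" using cycle_vertex[OF D'(1)] .
        then have "conn (ends R) A u z" using sub by (auto simp: K_def elim: conn_mono)
        then have "D' = D" using unique[OF D(1,3) D'(1) _ uD z] D' by blast
        then show False using D D' by blast
      qed
    qed (simp_all add: K_def)
    have "sats (K u) f (D - {e})" using f by (rule sats_mono) (use D in blast)
    moreover have "u \<in> K u" by (simp add: K_def)
    ultimately have "sat (K u) f e \<longleftrightarrow> D \<in> W"
      using cycle_sats_iff[OF D(1,2) _ uw] by blast
    then show False using spanD[OF span f] unbal D by blast
  next
    case False
    \<comment> \<open>A potential on the component of one end of \<open>e\<close> would miss the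
      other end and violate \<open>e\<close>. So both components contain a cycle, and
      \<open>e\<close> puts these two cycles into one component of \<open>A\<close>.\<close>
    have violated: False if "sats (K x) f (A - {e})" "x = u \<or> x = w" for x f
    proof -
      have "sat (K x) f e" using spanD[OF span that(1)] .
      then show False
        using that(2) False conn_sym[of "ends R" "A - {e}" w u] by (auto simp: sat_iff[OF uw] K_def)
    qed
    have "\<exists>D. is_cycle R D \<and> D \<subseteq> A - {e} \<and> edge_verts R D \<subseteq> K x" if "x = u \<or> x = w" for x
      using component_potential[OF Ae, of "K x" x] violated[OF _ that] unfolding K_def by metis
    then obtain D D' where D: "is_cycle R D" "D \<subseteq> A - {e}" "edge_verts R D \<subseteq> K u"
        and D': "is_cycle R D'" "D' \<subseteq> A - {e}" "edge_verts R D' \<subseteq> K w"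
      by metis
    obtain x where x: "x \<in> edge_verts R D" using cycle_vertex[OF D(1)] .
    obtain y where y: "y \<in> edge_verts R D'" using cycle_vertex[OF D'(1)] .
    note xy = x y
    have "conn (ends R) (A - {e}) u x" "conn (ends R) (A - {e}) w y"
      using D(3) D'(3) xy by (auto simp: K_def)
    then have c: "conn (ends R) A u x" "conn (ends R) A w y"
      by (auto elim!: conn_mono)
    have "conn (ends R) A x y"
      using conn_trans[OF conn_trans[OF conn_sym[OF c(1)] conn_edge[OF e, of "ends R" u w]] c(2)] uw by simp
    then have "D' = D" using unique[of D D' x y] D D' xy by blast
    then have "conn (ends R) (A - {e}) u x" "conn (ends R) (A - {e}) w x"
      using D(3) D'(3) xy by (auto simp: K_def)
    then show False
      using False conn_trans[OF _ conn_sym, of "ends R" "A - {e}" u x w] by blast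
  qed
qed

lemma frame_bases_eq: "frame_bases R \<B> = {A. bas A}"
  unfolding frame_bases_def bas_def
  using ind_imp_frame_indep frame_indep_imp_ind by blast

end

section \<open>The vertex-deleted biased graph as a linear class\<close>

locale vertex_deletion =
  fixes G :: "('v, 'e) mgraph" and \<C> :: "'e set set" and v :: 'v and e :: "nat \<Rightarrow> 'e" and m :: nat
  assumes biased: "biased_graph G \<C>"
    and linear: "linear_bias G \<C>"
    and no_balanced_loop: "\<And>f. f \<in> edges G \<Longrightarrow> is_loop G f \<Longrightarrow> {f} \<notin> \<C>"
    and v: "v \<in> verts G"
    and bij_e: "bij_betw e {1..m} (edges_at G v)"
begin

abbreviation "Gh \<equiv> hat_graph G v e m"
abbreviation "R \<equiv> hat_graph_reduced G \<C> v e m"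
abbreviation "w i \<equiv> far_end G v (e i)"
abbreviation "lp i \<equiv> is_loop G (e i)"

definition gens :: "'e hat_edge set set" where
  "gens = {D \<in> hat_generators G \<C> v e m. \<not> (\<exists>l. D = {l})}"

definition W :: "'e hat_edge set set" where
  "W = xspan gens"

lemma G_ends: "f \<in> edges G \<Longrightarrow> \<exists>u\<in>verts G. \<exists>x\<in>verts G. ends G f = {u, x}"
  using biased by (simp add: biased_graph_def finite_mgraph_def)

lemma G_finite: "finite (edges G)"
  using biased by (simp add: biased_graph_def finite_mgraph_def)

lemma C_linear: "is_cycle G D \<Longrightarrow> D \<in> xspan \<C> \<Longrightarrow> D \<in> \<C>"
  using linear by (auto simp: linear_bias_def cycle_span_eq)

lemma e_at: "i \<in> {1..m} \<Longrightarrow> e i \<in> edges G \<and> v \<in> ends G (e i)"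
  using bij_betw_apply[OF bij_e, of i] by (simp add: edges_at_def)

lemma e_eq: "i \<in> {1..m} \<Longrightarrow> j \<in> {1..m} \<Longrightarrow> e i = e j \<longleftrightarrow> i = j"
  by (rule inj_on_eq_iff[OF bij_betw_imp_inj_on[OF bij_e]])

lemma ends_e:
  assumes "i \<in> {1..m}" "\<not> lp i"
  shows "ends G (e i) = {v, w i}" "w i \<noteq> v" "w i \<in> verts G"
proof -
  obtain a b where "a \<in> verts G" "b \<in> verts G" "ends G (e i) = {a, b}"
    using e_at[OF assms(1)] G_ends[of "e i"] by blast
  moreover have "v = a \<or> v = b" using calculation e_at[OF assms(1)] by simp
  ultimately obtain u where u: "ends G (e i) = {v, u}" "u \<in> verts G"
    by (metis insert_commute)
  then have "w i = u"
    by (auto simp: far_end_def doubleton_eq_iff)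
  then show "ends G (e i) = {v, w i}" "w i \<in> verts G" using u by simp_all
  then show "w i \<noteq> v" using assms(2) by (auto simp: is_loop_def)
qed

lemma new_iff:
  "Hat {i, j} \<in> hat_new G e m \<longleftrightarrow> i \<in> {1..m} \<and> j \<in> {1..m} \<and> i \<noteq> j \<and> \<not> (lp i \<and> lp j)"
  by (auto simp: hat_new_def doubleton_eq_iff)

lemma stem_iff:
  "Hat {i, j} \<in> stem_loops G e m \<longleftrightarrow> i \<in> {1..m} \<and> j \<in> {1..m} \<and> lp i \<noteq> lp j"
  by (auto simp: stem_loops_def doubleton_eq_iff)

lemma edges_Gh: "edges Gh = Old ` (edges G - edges_at G v) \<union> hat_new G e m"
  and verts_Gh: "verts Gh = verts G - {v}"
  and ends_Gh: "ends Gh = hat_ends G v e"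
  by (simp_all add: hat_graph_def)

lemma ends_R: "ends R = ends Gh"
  and verts_R: "verts R = verts Gh"
  and edges_R: "edges R = edges Gh - {l. {l} \<in> hat_generators G \<C> v e m}"
  by (simp_all add: hat_graph_reduced_def)

lemma ends_Hat: "\<not> lp i \<Longrightarrow> \<not> lp j \<Longrightarrow> ends Gh (Hat {i, j}) = {w i, w j}"
  by (auto simp: ends_Gh)

lemma ends_Hat_stem: "\<not> lp i \<Longrightarrow> lp j \<Longrightarrow> ends Gh (Hat {i, j}) = {w i}"
  by (auto simp: ends_Gh)

lemma hat_newE:
  assumes "x \<in> hat_new G e m"
  obtains i j where "x = Hat {i, j}" "i \<in> {1..m}" "j \<in> {1..m}" "i \<noteq> j" "\<not> lp i"
  using assms unfolding hat_new_def by (auto simp: insert_commute)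

lemma finite_hat_new: "finite (hat_new G e m)"
  by (rule finite_subset[of _ "(\<lambda>(i, j). Hat {i, j}) ` ({1..m} \<times> {1..m})"]) (auto simp: hat_new_def)

lemma finite_Gh: "finite (edges Gh)"
  using G_finite finite_hat_new by (simp add: edges_Gh)

lemma Gh_ends:
  assumes "x \<in> edges Gh"
  shows "\<exists>a\<in>verts Gh. \<exists>b\<in>verts Gh. ends Gh x = {a, b}"
proof -
  consider f where "x = Old f" "f \<in> edges G" "v \<notin> ends G f" | "x \<in> hat_new G e m"
    using assms by (auto simp: edges_Gh edges_at_def)
  then show ?thesis
  proof cases
    case 1
    then obtain a b where "a \<in> verts G" "b \<in> verts G" "ends G f = {a, b}"
      using G_ends by blast
    then show ?thesis using 1 by (auto simp: ends_Gh verts_Gh)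
  next
    case 2
    then obtain i j where ij: "x = Hat {i, j}" "i \<in> {1..m}" "j \<in> {1..m}" "\<not> lp i"
      by (rule hat_newE)
    show ?thesis
    proof (cases "lp j")
      case True
      then show ?thesis
        using ij ends_Hat_stem[of i j] ends_e[of i] by (auto simp: verts_Gh)
    next
      case False
      then show ?thesis
        using ij ends_Hat[of i j] ends_e[of i] ends_e[of j] by (auto simp: verts_Gh)
    qed
  qed
qed

lemma Gh_ends_subset: "x \<in> edges Gh \<Longrightarrow> ends Gh x \<subseteq> verts Gh"
  using Gh_ends[of x] by auto

section \<open>Pull-backs of balanced sets\<close>

lemma pull_back_Old: "pull_back e (Old ` D) = D"
proof -
  have *: "{i \<in> Old ` D. x \<in> pull_back_edge e i} = (if x \<in> D then {Old x} else {})" for x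
    by auto
  have "odd (card {i \<in> Old ` D. x \<in> pull_back_edge e i}) \<longleftrightarrow> x \<in> D" for x
    unfolding * by simp
  then show ?thesis by (auto simp: pull_back_def sym_diff_fam_def)
qed

text \<open>Petals meet only at \<open>v\<close>, so a common edge would be a loop at
  \<open>v\<close> and a balanced one, which is excluded. Hence petals are edge-disjoint and their
  union is their symmetric difference.\<close>

lemma petals_sum:
  assumes "petal_split G v X \<P>" "\<P> \<subseteq> \<C>"
  shows "X \<in> xspan \<C>"
proof -
  have cyc: "\<And>P. P \<in> \<P> \<Longrightarrow> is_cycle G P" and X: "\<Union>\<P> = X"
    and meet: "\<And>P Q. P \<in> \<P> \<Longrightarrow> Q \<in> \<P> \<Longrightarrow> P \<noteq> Q \<Longrightarrow> edge_verts G P \<inter> edge_verts G Q = {v}"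
    using assms(1) by (auto simp: petal_split_def)
  have "\<P> \<subseteq> Pow (edges G)" using cyc cycle_subset by blast
  then have fin: "finite \<P>" using G_finite by (simp add: finite_subset)
  have disj: "P = Q" if P: "P \<in> \<P>" and Q: "Q \<in> \<P>" and x: "x \<in> P" "x \<in> Q" for P Q x
  proof (rule ccontr)
    assume "P \<noteq> Q"
    have xG: "x \<in> edges G" using cyc[OF P] x cycle_subset by blast
    have "ends G x \<subseteq> edge_verts G P \<inter> edge_verts G Q"
      using x by (auto simp: edge_verts_def)
    then have "ends G x \<subseteq> {v}" using meet[OF P Q \<open>P \<noteq> Q\<close>] by simp
    then have loop: "is_loop G x" using G_ends[OF xG] by (auto simp: is_loop_def)
    then have "P = {x}" by (rule cycle_with_loop[OF cyc[OF P] x(1)])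
    then show False using no_balanced_loop[OF xG loop] P assms(2) by blast
  qed
  have "odd (card {P \<in> \<P>. x \<in> P}) \<longleftrightarrow> x \<in> X" for x
  proof (cases "x \<in> X")
    case True
    then obtain P where "P \<in> \<P>" "x \<in> P" using X by blast
    then have one: "{P \<in> \<P>. x \<in> P} = {P}" using disj by blast
    show ?thesis unfolding one using True by simp
  next
    case False
    then have none: "{P \<in> \<P>. x \<in> P} = {}" using X by blast
    show ?thesis unfolding none using False by simp
  qed
  then have "X = sym_diff_fam (\<lambda>A. A) \<P>" by (auto simp: sym_diff_fam_def)
  then show ?thesis using fin assms(2) unfolding xspan_def by blast
qed

text \<open>The three kinds of generators pull back to a balanced cycle, to nothing, and to a sum of
  balanced petals.\<close>

lemma generator_pull_back:
  assumes "D \<in> hat_generators G \<C> v e m"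
  shows "pull_back e D \<in> xspan \<C>"
  using assms petals_sum unfolding hat_generators_def
  by (auto simp: pull_back_Old intro: xspan_base)

lemma generator_cycle: "D \<in> hat_generators G \<C> v e m \<Longrightarrow> is_cycle Gh D"
  by (simp add: hat_generators_def)

lemma pull_back_empty: "pull_back e {} = {}"
  by (simp add: pull_back_def)

lemma pull_back_insert:
  "finite D \<Longrightarrow> x \<notin> D \<Longrightarrow> pull_back e (insert x D) = pull_back_edge e x \<triangle> pull_back e D"
  by (simp add: pull_back_def sym_diff_fam_insert)

text \<open>All three properties hold for the generators and survive symmetric differences. The
  second carries balance back to \<open>G\<close>, the third shows that no loop is balanced.\<close>

lemma W_properties:
  assumes "X \<in> W"
  shows "finite X \<and> pull_back e X \<in> xspan \<C> \<and> (\<forall>x\<in>X. \<not> is_loop Gh x)"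
  using assms unfolding W_def
proof (induction rule: xspan_induct)
  case empty
  show ?case by (simp add: pull_back_empty)
next
  case (sdiff D X)
  have D: "D \<in> hat_generators G \<C> v e m" "\<And>l. D \<noteq> {l}"
    using sdiff(1) by (auto simp: gens_def)
  have cyc: "is_cycle Gh D" using generator_cycle[OF D(1)] .
  then have "finite D" using cycle_subset finite_Gh finite_subset by blast
  moreover have "\<not> is_loop Gh x" if "x \<in> D" for x
    using cycle_with_loop[OF cyc that] D(2) by blast
  moreover have "pull_back e (D \<triangle> X) = pull_back e D \<triangle> pull_back e X"
    using \<open>finite D\<close> sdiff by (simp add: pull_back_def sym_diff_fam_sdiff)
  ultimately show ?case
    using sdiff generator_pull_back[OF D(1)] xspan_sdiff by (auto simp: sdiff_def)
qed

lemma balanced_W: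
  assumes "is_cycle R D"
  shows "D \<in> hat_balanced G \<C> v e m \<longleftrightarrow> D \<in> W"
proof -
  have "D \<subseteq> edges R" by (rule cycle_subset[OF assms])
  moreover have "edge_verts R D \<subseteq> verts Gh"
    using calculation Gh_ends_subset unfolding edge_verts_def ends_R edges_R by blast
  ultimately have "is_cycle Gh D"
    using cycle_transfer[OF assms, of Gh] by (auto simp: edges_R ends_R)
  then show ?thesis
    by (simp add: hat_balanced_def cycle_span_eq W_def gens_def)
qed

sublocale linear_frame R W "hat_balanced G \<C> v e m"
proof
  show "finite (edges R)" using finite_Gh by (simp add: edges_R)
  show "\<exists>a b. ends R x = {a, b}" if "x \<in> edges R" for x
    using Gh_ends[of x] that unfolding edges_R ends_R by blast
  show "{} \<in> W" by (simp add: W_def)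
  show "X \<triangle> Y \<in> W" if "X \<in> W" "Y \<in> W" for X Y
    using that by (simp add: W_def xspan_sdiff)
  show "ends R x \<subseteq> verts R" if "x \<in> edges R" for x
    using Gh_ends_subset[of x] that unfolding edges_R ends_R verts_R by blast
qed (rule balanced_W)

lemma hat_bases_eq: "hat_bases G \<C> v e m = {A. bas A}"
  unfolding hat_bases_def by (rule frame_bases_eq)

section \<open>Surviving new edges and short balanced cycles\<close>

lemma digon_at:
  assumes "i \<in> {1..m}" "j \<in> {1..m}" "i \<noteq> j" "\<not> lp i" "\<not> lp j" "w i = w j"
  shows "is_cycle G {e i, e j}"
  using assms ends_e[of i] ends_e[of j] e_at[of i] e_at[of j] e_eq[of i j] v
  by (intro digon_cycle[where x = v and y = "w j"]) auto

lemma petal_single: "is_cycle G X \<Longrightarrow> petal_split G v X {X}"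
  by (simp add: petal_split_def)

lemma pull_back_digon:
  assumes "i \<in> {1..m}" "j \<in> {1..m}" "k \<in> {1..m}" "i \<noteq> j" "j \<noteq> k" "i \<noteq> k"
  shows "pull_back e {Hat {i, k}, Hat {j, k}} = {e i, e j}"
  using assms e_eq by (simp add: pull_back_insert pull_back_empty doubleton_eq_iff)
    (auto simp: sdiff_def)

text \<open>The loop \<open>Hat {i, j}\<close> pulls back to a single petal, the digon of
  \<open>e i\<close> and \<open>e j\<close>. Linearity of \<open>\<C>\<close> shows that this digon
  is balanced if the loop is a generator.\<close>

lemma parallel_in_R:
  assumes "i \<in> {1..m}" "j \<in> {1..m}" "i \<noteq> j" "\<not> lp i" "\<not> lp j" "w i = w j"
  shows "Hat {i, j} \<in> edges R \<longleftrightarrow> {e i, e j} \<notin> \<C>"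
proof -
  have new: "Hat {i, j} \<in> hat_new G e m" using assms by (simp add: new_iff)
  have pb: "pull_back e {Hat {i, j}} = {e i, e j}"
    by (simp add: pull_back_insert pull_back_empty)
  have "{Hat {i, j}} \<in> hat_generators G \<C> v e m \<longleftrightarrow> {e i, e j} \<in> \<C>"
  proof
    assume "{Hat {i, j}} \<in> hat_generators G \<C> v e m"
    then show "{e i, e j} \<in> \<C>"
      using generator_pull_back[of "{Hat {i, j}}"] pb digon_at[OF assms] C_linear[of "{e i, e j}"]
      by simp
  next
    assume C: "{e i, e j} \<in> \<C>"
    have "is_cycle Gh {Hat {i, j}}"
      using new assms ends_Hat[of i j] ends_e[of j]
      by (intro loop_cycle[of _ _ "w j"]) (auto simp: edges_Gh verts_Gh)
    moreover have "Hat {i, j} \<notin> stem_loops G e m"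
      using assms by (simp add: stem_iff)
    moreover have "petal_split G v {e i, e j} {{e i, e j}}"
      using digon_at[OF assms] by (rule petal_single)
    ultimately show "{Hat {i, j}} \<in> hat_generators G \<C> v e m"
      using new pb C unfolding hat_generators_def by auto
  qed
  then show ?thesis using new by (simp add: edges_R edges_Gh)
qed

lemma link_in_R:
  assumes "i \<in> {1..m}" "j \<in> {1..m}" "i \<noteq> j" "\<not> lp i" "\<not> lp j" "w i \<noteq> w j"
  shows "Hat {i, j} \<in> edges R"
proof -
  have "\<not> is_loop Gh (Hat {i, j})"
    using assms ends_Hat[of i j] unfolding is_loop_def by (simp add: doubleton_eq_iff)
  then have "{Hat {i, j}} \<notin> hat_generators G \<C> v e m"
    using single_cycle[OF generator_cycle] by blast
  then show ?thesis using assms by (simp add: edges_R edges_Gh new_iff)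
qed

lemma stem_in_R:
  assumes "i \<in> {1..m}" "j \<in> {1..m}" "\<not> lp i" "lp j"
  shows "Hat {i, j} \<in> edges R"
proof -
  have "Hat {i, j} \<in> stem_loops G e m"
    using assms by (simp add: stem_iff)
  then have "{Hat {i, j}} \<notin> hat_generators G \<C> v e m"
    by (auto simp: hat_generators_def)
  moreover have "i \<noteq> j" using assms by auto
  ultimately show ?thesis using assms by (simp add: edges_R edges_Gh new_iff)
qed

lemma loop_notin_W: "is_loop Gh l \<Longrightarrow> {l} \<notin> W"
  using W_properties[of "{l}"] by auto

text \<open>In the pull-back \<open>e k\<close> cancels, which leaves the digon of
  \<open>e i\<close> and \<open>e j\<close> at \<open>v\<close>.\<close>

lemma digon_W:
  assumes "i \<in> {1..m}" "j \<in> {1..m}" "k \<in> {1..m}" "i \<noteq> j" "j \<noteq> k" "i \<noteq> k"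
    "\<not> lp i" "\<not> lp j" "\<not> lp k" "w i = w j" "w j \<noteq> w k"
  shows "{Hat {i, k}, Hat {j, k}} \<in> W \<longleftrightarrow> {e i, e j} \<in> \<C>"
proof
  assume "{Hat {i, k}, Hat {j, k}} \<in> W"
  then have "{e i, e j} \<in> xspan \<C>"
    using W_properties[of "{Hat {i, k}, Hat {j, k}}"] pull_back_digon[of i j k] assms by simp
  then show "{e i, e j} \<in> \<C>"
    using digon_at[of i j] assms C_linear by blast
next
  assume C: "{e i, e j} \<in> \<C>"
  have ne: "Hat {i, k} \<noteq> Hat {j, k}" using assms by (simp add: doubleton_eq_iff)
  have "is_cycle Gh {Hat {i, k}, Hat {j, k}}"
    using assms ne ends_Hat[of i k] ends_Hat[of j k] ends_e[of j] ends_e[of k]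
    by (intro digon_cycle[of _ _ _ "w j" "w k"]) (simp_all add: edges_Gh verts_Gh new_iff)
  moreover have "Hat {i, k} \<in> hat_new G e m" using assms by (simp add: new_iff)
  moreover have "petal_split G v {e i, e j} {{e i, e j}}"
    using digon_at[of i j] assms by (intro petal_single) simp
  ultimately have "{Hat {i, k}, Hat {j, k}} \<in> hat_generators G \<C> v e m"
    using pull_back_digon[of i j k] assms C ne unfolding hat_generators_def by auto
  then show "{Hat {i, k}, Hat {j, k}} \<in> W"
    using ne unfolding W_def by (intro xspan_base) (auto simp: gens_def)
qed

text \<open>Each of the three edges at \<open>v\<close> occurs twice in the pull-back, which is
  therefore empty.\<close>

lemma triangle_W:
  assumes "i \<in> {1..m}" "j \<in> {1..m}" "k \<in> {1..m}" "i \<noteq> j" "j \<noteq> k" "i \<noteq> k"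
    "\<not> lp i" "\<not> lp j" "\<not> lp k" "w i \<noteq> w j" "w j \<noteq> w k" "w i \<noteq> w k"
  shows "{Hat {i, k}, Hat {i, j}, Hat {j, k}} \<in> W"
proof -
  have ne: "Hat {i, k} \<noteq> Hat {i, j}" "Hat {i, j} \<noteq> Hat {j, k}" "Hat {i, k} \<noteq> Hat {j, k}"
    using assms by (auto simp: doubleton_eq_iff)
  have "is_cycle Gh {Hat {i, k}, Hat {i, j}, Hat {j, k}}"
    using assms ne ends_Hat ends_e[of i] ends_e[of j] ends_e[of k]
    by (intro triangle_cycle[of _ _ _ _ "w i" "w j" "w k"]) (simp_all add: edges_Gh verts_Gh new_iff)
  moreover have "pull_back e {Hat {i, k}, Hat {i, j}, Hat {j, k}} = {}"
    using ne assms e_eq by (simp add: pull_back_insert pull_back_empty) (auto simp: sdiff_def)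
  ultimately have "{Hat {i, k}, Hat {i, j}, Hat {j, k}} \<in> hat_generators G \<C> v e m"
    using ne unfolding hat_generators_def by auto
  then show ?thesis
    using ne unfolding W_def by (intro xspan_base) (auto simp: gens_def)
qed

section \<open>The equivalence relation of a potential on the indices\<close>

text \<open>A loop at \<open>v\<close> counts as off, as if its far end had value zero; this agrees
  with the behaviour of stem loops.\<close>

definition on :: "'v set \<Rightarrow> nat \<Rightarrow> bool" where
  "on U i \<longleftrightarrow> \<not> lp i \<and> w i \<in> U"

text \<open>If the far ends coincide, the labels cancel and the new edge is a loop, which is deleted
  exactly when the digon in \<open>G\<close> is balanced; so the digon decides.\<close>

definition bal :: "('v \<Rightarrow> 'e hat_edge set) \<Rightarrow> nat \<Rightarrow> nat \<Rightarrow> bool" where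
  "bal f i j \<longleftrightarrow>
     (if w i = w j then {e i, e j} \<in> \<C> else f (w i) \<triangle> f (w j) \<triangle> {Hat {i, j}} \<in> W)"

text \<open>For distinct indices, a missing edge is a deleted balanced loop or would come from two
  loops at \<open>v\<close>; counting it as related makes the relation transitive.\<close>

definition rel :: "'v set \<Rightarrow> ('v \<Rightarrow> 'e hat_edge set) \<Rightarrow> nat \<Rightarrow> nat \<Rightarrow> bool" where
  "rel U f i j \<longleftrightarrow> Hat {i, j} \<notin> edges R \<or> sat U f (Hat {i, j})"

lemma rel_sym: "rel U f i j \<longleftrightarrow> rel U f j i"
  by (simp add: rel_def insert_commute)

lemma bal_sym: "bal f i j \<longleftrightarrow> bal f j i"
  by (simp add: bal_def insert_commute sdiff_commute[of "f (w i)"])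

text \<open>One criterion for all kinds of new edges: two loops at \<open>v\<close> give no edge,
  one loop gives a stem loop, satisfied only off the support, and otherwise there is a link, or a
  loop if the far ends agree.\<close>

lemma rel_iff:
  assumes "i \<in> {1..m}" "j \<in> {1..m}" "i \<noteq> j"
  shows "rel U f i j \<longleftrightarrow> (on U i \<longleftrightarrow> on U j) \<and> (on U i \<longrightarrow> bal f i j)"
proof -
  have stem: "rel U f i j \<longleftrightarrow> w i \<notin> U" if "i \<in> {1..m}" "j \<in> {1..m}" "\<not> lp i" "lp j" for i j
  proof -
    have en: "ends R (Hat {i, j}) = {w i, w i}" using that ends_Hat_stem by (simp add: ends_R)
    have "is_loop Gh (Hat {i, j})" using en by (auto simp: is_loop_def ends_R)
    then have "{Hat {i, j}} \<notin> W" by (rule loop_notin_W)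
    then show ?thesis using stem_in_R[OF that] by (simp add: rel_def sat_iff[OF en])
  qed
  consider "lp i" "lp j" | "\<not> lp i" "lp j" | "lp i" "\<not> lp j" | "\<not> lp i" "\<not> lp j" by blast
  then show ?thesis
  proof cases
    case 1
    then have "Hat {i, j} \<notin> edges R" by (auto simp: edges_R edges_Gh new_iff)
    then show ?thesis using 1 by (simp add: rel_def on_def)
  next
    case 2
    then show ?thesis using stem[of i j] assms by (auto simp: on_def)
  next
    case 3
    then show ?thesis using stem[of j i] assms rel_sym[of U f i j] by (auto simp: on_def)
  next
    case 4
    have en: "ends R (Hat {i, j}) = {w i, w j}" using 4 ends_Hat by (simp add: ends_R)
    show ?thesis
    proof (cases "w i = w j")
      case True
      have "is_loop Gh (Hat {i, j})" using en True by (auto simp: is_loop_def ends_R)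
      then have "{Hat {i, j}} \<notin> W" by (rule loop_notin_W)
      then show ?thesis
        using True 4 parallel_in_R[OF assms 4 True]
        by (auto simp: rel_def sat_iff[OF en] on_def bal_def)
    next
      case False
      then show ?thesis
        using 4 link_in_R[OF assms 4 False] by (auto simp: rel_def sat_iff[OF en] on_def bal_def)
    qed
  qed
qed

text \<open>The cases are the coincidences among the three far ends. Equal far ends are handled by
  digons, three distinct ones by the balanced triangle.\<close>

lemma bal_trans:
  assumes ijk: "i \<in> {1..m}" "j \<in> {1..m}" "k \<in> {1..m}" "i \<noteq> j" "j \<noteq> k" "i \<noteq> k"
    and lp: "\<not> lp i" "\<not> lp j" "\<not> lp k"
    and bal: "bal f i j" "bal f j k"
  shows "bal f i k"
proof -
  have near: "bal f i k" if ijk: "i \<in> {1..m}" "j \<in> {1..m}" "k \<in> {1..m}" "i \<noteq> j" "j \<noteq> k" "i \<noteq> k"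
    and lp: "\<not> lp i" "\<not> lp j" "\<not> lp k" and bal: "bal f i j" "bal f j k"
    and eq: "w i = w j" "w j \<noteq> w k" for i j k
  proof -
    have "{Hat {i, k}, Hat {j, k}} \<in> W"
      using digon_W[OF ijk lp eq] bal eq by (simp add: bal_def)
    moreover have "Hat {i, k} \<noteq> Hat {j, k}" using ijk by (simp add: doubleton_eq_iff)
    then have "{Hat {i, k}, Hat {j, k}} = {Hat {i, k}} \<triangle> {Hat {j, k}}"
      by (auto simp: sdiff_def)
    ultimately have "{Hat {i, k}} \<triangle> {Hat {j, k}} \<in> W" by metis
    moreover have "f (w j) \<triangle> f (w k) \<triangle> {Hat {j, k}} \<in> W" using bal eq by (simp add: bal_def)
    ultimately have "({Hat {i, k}} \<triangle> {Hat {j, k}}) \<triangle> (f (w j) \<triangle> f (w k) \<triangle> {Hat {j, k}}) \<in> W"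
      by (rule W_sdiff)
    then show ?thesis using eq by (simp add: bal_def sdiff_ac)
  qed
  consider "w i = w j" "w j = w k" | "w i = w j" "w j \<noteq> w k" | "w k = w j" "w j \<noteq> w i"
    | "w i = w k" "w i \<noteq> w j" | "w i \<noteq> w j" "w j \<noteq> w k" "w i \<noteq> w k"
    by metis
  then show ?thesis
  proof cases
    case 1
    then have "{e i, e j} \<in> \<C>" "{e j, e k} \<in> \<C>" using bal by (simp_all add: bal_def)
    then have "{e i, e j} \<triangle> {e j, e k} \<in> xspan \<C>" by (intro xspan_sdiff xspan_base)
    moreover have "{e i, e j} \<triangle> {e j, e k} = {e i, e k}"
      using ijk e_eq by (auto simp: sdiff_def)
    ultimately have "{e i, e k} \<in> \<C>"
      using C_linear[OF digon_at[of i k]] ijk lp 1 by simp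
    then show ?thesis using 1 by (simp add: bal_def)
  next
    case 2
    then show ?thesis by (rule near[OF ijk lp bal])
  next
    case 3
    have "bal f k i"
      using near[of k j i] ijk lp bal 3 bal_sym by blast
    then show ?thesis using bal_sym by blast
  next
    case 4
    have ne: "Hat {i, j} \<noteq> Hat {k, j}" using ijk by (simp add: doubleton_eq_iff)
    \<comment> \<open>As \<open>w i = w k\<close>, the labels cancel in this sum and the digon on
      \<open>w i\<close> and \<open>w j\<close> remains.\<close>
    have "(f (w i) \<triangle> f (w j) \<triangle> {Hat {i, j}}) \<triangle> (f (w j) \<triangle> f (w k) \<triangle> {Hat {j, k}}) \<in> W"
      using bal 4 by (intro W_sdiff[of "f (w i) \<triangle> f (w j) \<triangle> {Hat {i, j}}"]) (simp_all add: bal_def)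
    then have "{Hat {i, j}} \<triangle> {Hat {k, j}} \<in> W"
      using 4 by (simp add: sdiff_ac insert_commute)
    moreover have "{Hat {i, j}} \<triangle> {Hat {k, j}} = {Hat {i, j}, Hat {k, j}}"
      using ne by (auto simp: sdiff_def)
    ultimately have "{Hat {i, j}, Hat {k, j}} \<in> W" by metis
    then have "{e i, e k} \<in> \<C>"
      using digon_W[of i k j] ijk lp 4 by simp
    then show ?thesis using 4 by (simp add: bal_def)
  next
    case 5
    have "(f (w i) \<triangle> f (w j) \<triangle> {Hat {i, j}}) \<triangle> (f (w j) \<triangle> f (w k) \<triangle> {Hat {j, k}}) \<in> W"
      using bal 5 by (intro W_sdiff[of "f (w i) \<triangle> f (w j) \<triangle> {Hat {i, j}}"]) (simp_all add: bal_def)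
    moreover have "Hat {i, k} \<noteq> Hat {i, j}" "Hat {i, j} \<noteq> Hat {j, k}" "Hat {i, k} \<noteq> Hat {j, k}"
      using ijk by (auto simp: doubleton_eq_iff)
    then have "{Hat {i, k}, Hat {i, j}, Hat {j, k}} = {Hat {i, k}} \<triangle> {Hat {i, j}} \<triangle> {Hat {j, k}}"
      by (auto simp: sdiff_def)
    then have "{Hat {i, k}} \<triangle> {Hat {i, j}} \<triangle> {Hat {j, k}} \<in> W"
      using triangle_W[OF ijk lp 5] by metis
    ultimately have "((f (w i) \<triangle> f (w j) \<triangle> {Hat {i, j}}) \<triangle> (f (w j) \<triangle> f (w k) \<triangle> {Hat {j, k}})) \<triangle>
        ({Hat {i, k}} \<triangle> {Hat {i, j}} \<triangle> {Hat {j, k}}) \<in> W"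
      by (rule W_sdiff)
    then show ?thesis using 5 by (simp add: bal_def sdiff_ac)
  qed
qed

lemma rel_trans:
  assumes ijk: "i \<in> {1..m}" "j \<in> {1..m}" "k \<in> {1..m}" "i \<noteq> j" "j \<noteq> k" "i \<noteq> k"
    and rel: "rel U f i j" "rel U f j k"
  shows "rel U f i k"
proof -
  have "(on U i \<longleftrightarrow> on U j) \<and> (on U i \<longrightarrow> bal f i j)" "(on U j \<longleftrightarrow> on U k) \<and> (on U j \<longrightarrow> bal f j k)"
    using rel ijk by (simp_all add: rel_iff)
  moreover have "bal f i k" if "on U i" "on U j" "on U k" "bal f i j" "bal f j k"
    using bal_trans[OF ijk _ _ _ that(4,5)] that(1-3) by (simp add: on_def)
  ultimately show ?thesis using ijk by (auto simp: rel_iff)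
qed

lemma bal_scale:
  assumes "f (w i) \<triangle> f' (w i) \<triangle> (f (w j) \<triangle> f' (w j)) \<in> W"
  shows "bal f i j \<longleftrightarrow> bal f' i j"
proof -
  have "(f (w i) \<triangle> f' (w i) \<triangle> (f (w j) \<triangle> f' (w j))) \<triangle> (f (w i) \<triangle> f (w j) \<triangle> {Hat {i, j}}) =
      f' (w i) \<triangle> f' (w j) \<triangle> {Hat {i, j}}"
    by (simp add: sdiff_ac)
  then show ?thesis
    using W_iff[OF assms, of "f (w i) \<triangle> f (w j) \<triangle> {Hat {i, j}}"] by (simp add: bal_def)
qed

end

section \<open>The crossing configuration\<close>

text \<open>\<open>X\<close> is the basis from which the switched edge has been removed and \<open>(U, f)\<close> its potential;
  \<open>(V, g)\<close> belongs to the other basis. Non-switchability enters only through the last assumption.\<close>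

locale crossing = vertex_deletion G \<C> v e m
  for G :: "('v, 'e) mgraph" and \<C> v e m +
  fixes i1 i2 i3 i4 :: nat and X :: "'e hat_edge set"
    and U V :: "'v set" and f g :: "'v \<Rightarrow> 'e hat_edge set" and r :: 'v
  assumes idx: "{i1, i2, i3, i4} \<subseteq> {1..m}" "distinct [i1, i2, i3, i4]"
    and X_ind: "ind X"
    and f_X: "sats U f X"
    and U_comp: "U = {y. conn (ends R) X r y}"
    and f_rel: "rel U f i1 i4" "rel U f i2 i3" "\<not> rel U f i1 i2"
    and g_rel: "rel V g i1 i3" "rel V g i2 i4" "\<not> rel V g i1 i2"
    and unique_on: "\<And>z T h. \<lbrakk>z \<in> X; sats T h (X - {z}); \<exists>!i. i \<in> {i1, i2, i3, i4} \<and> on T i\<rbrakk>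
      \<Longrightarrow> sat V g z"
begin

abbreviation "cn \<equiv> conn (ends R)"

lemma idx': "i1 \<in> {1..m}" "i2 \<in> {1..m}" "i3 \<in> {1..m}" "i4 \<in> {1..m}"
  "i1 \<noteq> i2" "i1 \<noteq> i3" "i1 \<noteq> i4" "i2 \<noteq> i3" "i2 \<noteq> i4" "i3 \<noteq> i4"
  using idx by auto

lemma f_rel': "\<not> rel U f i1 i3" "\<not> rel U f i2 i4" "\<not> rel U f i3 i4"
proof -
  show 13: "\<not> rel U f i1 i3"
    using rel_trans[of i1 i3 i2 U f] f_rel rel_sym idx' by metis
  show "\<not> rel U f i2 i4"
    using rel_trans[of i2 i4 i1 U f] f_rel rel_sym idx' by metis
  show "\<not> rel U f i3 i4"
    using rel_trans[of i1 i4 i3 U f] 13 f_rel rel_sym idx' by metis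
qed

lemma g_rel': "\<not> rel V g i1 i4" "\<not> rel V g i2 i3"
proof -
  show "\<not> rel V g i1 i4"
    using rel_trans[of i1 i4 i2 V g] g_rel rel_sym idx' by metis
  show "\<not> rel V g i2 i3"
    using rel_trans[of i2 i3 i1 V g] g_rel rel_sym idx' by metis
qed

lemma conn_U: "x \<in> U \<Longrightarrow> y \<in> U \<Longrightarrow> cn X x y"
  unfolding U_comp using conn_join[of "ends R" X r x y] by simp

lemma on_conn: "on U i \<Longrightarrow> on U j \<Longrightarrow> cn X (w i) (w j)"
  by (simp add: on_def conn_U)

section \<open>Comparing the two potentials along paths\<close>

text \<open>Where \<open>V\<close> is on, \<open>f\<close> and \<open>g\<close> differ by a constant
  along \<open>A\<close>; where it is off, both indices are off and hence related.\<close>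

lemma path_transfer:
  assumes "on U i" "on U j" "cn A (w i) (w j)" "A \<subseteq> X" "sats V g A"
    "i \<in> {1..m}" "j \<in> {1..m}" "i \<noteq> j"
  shows "rel V g i j \<longleftrightarrow> on V i \<longrightarrow> rel U f i j"
proof -
  have fA: "sats U f A" using f_X assms(4) by (rule sats_mono)
  have "w i \<in> V \<longleftrightarrow> w j \<in> V" by (rule sats_conn[OF assms(5,3)])
  then have on: "on V i \<longleftrightarrow> on V j" using assms(1,2) by (simp add: on_def)
  have "bal f i j \<longleftrightarrow> bal g i j" if "on V i"
    using sats_scale[OF fA assms(5,3)] assms(1) that bal_scale by (simp add: on_def)
  then show ?thesis using on assms by (auto simp: rel_iff)
qed

text \<open>\<open>(U, f)\<close> restricted to the component of \<open>w i\<close> in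
  \<open>X - {z}\<close> is on at \<open>i\<close> alone among the four indices, so
  \<open>unique_on\<close> applies.\<close>

lemma isolated_sat:
  assumes "z \<in> X" "i \<in> {i1, i2, i3, i4}" "on U i"
    "\<And>j. j \<in> {i1, i2, i3, i4} \<Longrightarrow> j \<noteq> i \<Longrightarrow> on U j \<Longrightarrow> \<not> cn (X - {z}) (w i) (w j)"
  shows "sat V g z"
proof -
  define T where "T = U \<inter> {y. cn (X - {z}) (w i) y}"
  have "sats U f (X - {z})" using f_X by (rule sats_mono) blast
  then have "sats T f (X - {z})" unfolding T_def by (rule sats_restrict[OF sep_comp])
  moreover have "on T i" using assms(3) by (simp add: on_def T_def)
  moreover have "\<not> on T j" if "j \<in> {i1, i2, i3, i4}" "j \<noteq> i" for j
    using assms(4)[OF that] by (auto simp: on_def T_def)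
  ultimately show ?thesis
    using unique_on[of z T f] assms(1,2) by blast
qed

text \<open>Each edge of the path from \<open>w i\<close> to \<open>w j\<close> separates the only
  two indices that are on, hence is satisfied by \<open>(V, g)\<close>; the path then carries the
  relation over.\<close>

lemma pair_on:
  assumes "i \<in> {i1, i2, i3, i4}" "j \<in> {i1, i2, i3, i4}" "i \<noteq> j" "on U i" "on U j" "rel U f i j"
    "\<And>k. k \<in> {i1, i2, i3, i4} \<Longrightarrow> k \<noteq> i \<Longrightarrow> k \<noteq> j \<Longrightarrow> \<not> on U k"
  shows "rel V g i j"
proof -
  obtain vs es where p: "upath (ends R) vs es" "hd vs = w i" "last vs = w j" "set es \<subseteq> X"
    using conn_imp_upath[OF on_conn[OF assms(4,5)]] by blast
  have "sat V g z" if z: "z \<in> set es" for z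
  proof (rule isolated_sat[OF _ assms(1,4)])
    show "z \<in> X" using z p(4) by blast
    have nc: "\<not> cn (X - {z}) (w i) (w j)"
      using path_cut[OF X_ind f_X p(1,4) z] p(2,3) assms(4) by (simp add: on_def)
    fix k assume "k \<in> {i1, i2, i3, i4}" "k \<noteq> i" "on U k"
    then have "k = j" using assms(7) by blast
    then show "\<not> cn (X - {z}) (w i) (w k)" using nc by simp
  qed
  then have "sats V g (set es)" by (simp add: sats_def)
  moreover have "cn (set es) (w i) (w j)" using upath_conn[OF p(1)] p(2,3) by simp
  moreover have "i \<in> {1..m}" "j \<in> {1..m}" using assms(1,2) idx(1) by blast+
  ultimately show ?thesis
    using path_transfer[OF assms(4,5) _ p(4)] assms(3,6) by blast
qed

text \<open>Each class \<open>{i1, i4}\<close>, \<open>{i2, i3}\<close> is on or off as a whole. If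
  only one were on, \<open>pair_on\<close> would make it related under \<open>(V, g)\<close>
  too.\<close>

lemma all_on: "on U i1" "on U i2" "on U i3" "on U i4"
proof -
  have eq: "on U i1 \<longleftrightarrow> on U i4" "on U i2 \<longleftrightarrow> on U i3"
    using f_rel idx' by (simp_all add: rel_iff)
  have some: "on U i1 \<or> on U i2"
    using f_rel(3) idx' by (auto simp: rel_iff)
  have 1: "on U i1"
  proof (rule ccontr)
    assume "\<not> on U i1"
    then have "rel V g i2 i3"
      using pair_on[of i2 i3] eq some f_rel(2) idx' by auto
    then show False using g_rel' by simp
  qed
  have 2: "on U i2"
  proof (rule ccontr)
    assume "\<not> on U i2"
    then have "rel V g i1 i4"
      using pair_on[of i1 i4] eq some f_rel(1) idx' by auto
    then show False using g_rel' by simp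
  qed
  show "on U i1" "on U i2" "on U i3" "on U i4" using 1 2 eq by simp_all
qed

lemma all_on': "i \<in> {i1, i2, i3, i4} \<Longrightarrow> on U i"
  using all_on by blast

text \<open>An edge of the path between \<open>w i\<close> and \<open>w j\<close> separates these
  two, while \<open>k\<close> and \<open>l\<close> stay together beyond \<open>z0\<close>. Hence
  \<open>i\<close> or \<open>j\<close> is cut off from the three others, and the edge satisfies
  \<open>(V, g)\<close>.\<close>

lemma side_path_sat:
  assumes I: "{i, j, k, l} = {i1, i2, i3, i4}" and z0: "z0 \<in> X"
    and c: "cn (X - {z0}) (w i) (w j)" "cn (X - {z0}) (w k) (w l)" "\<not> cn (X - {z0}) (w i) (w k)"
  obtains A where "A \<subseteq> X" "sats V g A" "cn A (w i) (w j)"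
proof -
  obtain vs es where p: "upath (ends R) vs es" "hd vs = w i" "last vs = w j" "set es \<subseteq> X - {z0}"
    using conn_imp_upath[OF c(1)] by blast
  have i: "i \<in> {i1, i2, i3, i4}" "j \<in> {i1, i2, i3, i4}" using I by blast+
  have iU: "w i \<in> U" using all_on'[OF i(1)] by (simp add: on_def)
  have esX: "set es \<subseteq> X" using p(4) by blast
  have "sat V g z" if z: "z \<in> set es" for z
  proof -
    have zX: "z \<in> X" using z p(4) by blast
    have nij: "\<not> cn (X - {z}) (w i) (w j)"
      using path_cut[OF X_ind f_X p(1) esX z] p(2,3) iU by simp
    obtain a b where ab: "ends R z = {a, b}" using two_ends zX ind_E[OF X_ind] by blast
    have abv: "a \<in> set vs" "b \<in> set vs" using upath_ends[OF p(1) z] ab by simp_all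
    have path_conn: "cn (X - {z0}) (w i) y" if "y \<in> set vs" for y
      using conn_mono[OF upath_conn_mem[OF p(1) that] p(4)] p(2) by simp
    have near: "\<not> cn (X - {z0}) (w k) y" if "y \<in> set vs" for y
    proof
      assume "cn (X - {z0}) (w k) y"
      then have "cn (X - {z0}) (w i) (w k)"
        by (rule conn_trans[OF path_conn[OF that] conn_sym])
      then show False using c(3) by simp
    qed
    have sub: "X - {z0} - {z} \<subseteq> X - {z0}" "X - {z0} - {z} \<subseteq> X - {z}" by blast+
    \<comment> \<open>A walk from \<open>w k\<close> to \<open>w l\<close> that avoids
      \<open>z0\<close> cannot reach an end of \<open>z\<close>, as both ends lie on the side of
      \<open>w i\<close>.\<close>
    have "cn (X - {z0} - {z}) (w k) (w l)"
      using conn_remove[OF c(2) ab] near[OF abv(1)] near[OF abv(2)]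
        conn_mono[of "ends R" "X - {z0} - {z}" "w k" a, OF _ sub(1)]
        conn_mono[of "ends R" "X - {z0} - {z}" "w k" b, OF _ sub(1)]
      by argo
    then have kl: "cn (X - {z}) (w k) (w l)" by (rule conn_mono[OF _ sub(2)])
    show ?thesis
    proof (cases "cn (X - {z}) (w i) (w k)")
      case True
      have il: "cn (X - {z}) (w i) (w l)" by (rule conn_trans[OF True kl])
      have far: "\<not> cn (X - {z}) (w j) y" if y: "cn (X - {z}) (w i) y" for y
      proof
        assume "cn (X - {z}) (w j) y"
        then have "cn (X - {z}) (w i) (w j)" by (rule conn_trans[OF y conn_sym])
        then show False using nij by simp
      qed
      show ?thesis
      proof (rule isolated_sat[OF zX i(2) all_on'[OF i(2)]])
        fix x assume "x \<in> {i1, i2, i3, i4}" "x \<noteq> j"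
        then have "x = i \<or> x = k \<or> x = l" using I by blast
        then show "\<not> cn (X - {z}) (w j) (w x)"
          using far[OF conn_refl] far[OF True] far[OF il] by auto
      qed
    next
      case False
      have nil: "\<not> cn (X - {z}) (w i) (w l)"
      proof
        assume "cn (X - {z}) (w i) (w l)"
        then have "cn (X - {z}) (w i) (w k)" by (rule conn_trans[OF _ conn_sym[OF kl]])
        then show False using False by simp
      qed
      show ?thesis
      proof (rule isolated_sat[OF zX i(1) all_on'[OF i(1)]])
        fix x assume "x \<in> {i1, i2, i3, i4}" "x \<noteq> i"
        then have "x = j \<or> x = k \<or> x = l" using I by blast
        then show "\<not> cn (X - {z}) (w i) (w x)" using nij False nil by auto
      qed
    qed
  qed
  then have "sats V g (set es)" by (simp add: sats_def)
  moreover have "cn (set es) (w i) (w j)" using upath_conn[OF p(1)] p(2,3) by simp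
  ultimately show ?thesis using that esX by blast
qed

text \<open>\<open>i1\<close> and \<open>i4\<close> are unrelated under \<open>(V, g)\<close>, so
  the path joining them has an edge \<open>z\<close> violating it. By \<open>isolated_sat\<close> it
  cannot split off a single index, so it splits them two and two.\<close>

lemma separating_edge:
  obtains z where "z \<in> X" "cn (X - {z}) (w i1) (w i2)" "cn (X - {z}) (w i3) (w i4)"
    "\<not> cn (X - {z}) (w i1) (w i3)"
proof -
  obtain vs es where p: "upath (ends R) vs es" "hd vs = w i1" "last vs = w i4" "set es \<subseteq> X"
    using conn_imp_upath[OF on_conn[OF all_on(1,4)]] by blast
  have "\<not> sats V g (set es)"
  proof
    assume s: "sats V g (set es)"
    have "cn (set es) (w i1) (w i4)" using upath_conn[OF p(1)] p(2,3) by simp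
    then have "rel V g i1 i4"
      using path_transfer[OF all_on(1,4) _ p(4) s] f_rel(1) idx' by blast
    then show False using g_rel' by simp
  qed
  then obtain z where z: "z \<in> set es" "\<not> sat V g z" by (auto simp: sats_def)
  have zX: "z \<in> X" using z p(4) by blast
  have n14: "\<not> cn (X - {z}) (w i1) (w i4)"
    using path_cut[OF X_ind f_X p(1,4) z(1)] p(2,3) all_on(1) by (simp add: on_def)
  obtain a b where ab: "ends R z = {a, b}" "cn (set es - {z}) (hd vs) a"
      "cn (set es - {z}) b (last vs)"
    using upath_split[OF p(1) z(1)] by blast
  have sub: "set es - {z} \<subseteq> X - {z}" using p(4) by blast
  have c: "cn (X - {z}) (w i1) a" "cn (X - {z}) b (w i4)"
    using conn_mono[OF ab(2) sub] conn_mono[OF ab(3) sub] p(2,3) by simp_all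
  have side: "cn (X - {z}) (w i1) (w k) \<or> cn (X - {z}) (w i4) (w k)" if "on U k" for k
  proof -
    have X: "cn X (w i1) (w k)" using on_conn[OF all_on(1) that] .
    consider "cn (X - {z}) (w i1) (w k)" | "cn (X - {z}) b (w k)" | "cn (X - {z}) (w i1) b"
      using conn_remove[OF X ab(1)] by blast
    then show ?thesis
    proof cases
      case 2
      have "cn (X - {z}) (w i4) (w k)" by (rule conn_join[OF c(2) 2])
      then show ?thesis by simp
    next
      case 3
      have "cn (X - {z}) (w i1) (w i4)" by (rule conn_trans[OF 3 c(2)])
      then show ?thesis using n14 by simp
    qed simp
  qed
  have excl: "\<not> cn (X - {z}) (w i4) y" if y: "cn (X - {z}) (w i1) y" for y
  proof
    assume "cn (X - {z}) (w i4) y"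
    then have "cn (X - {z}) (w i1) (w i4)" by (rule conn_trans[OF y conn_sym])
    then show False using n14 by simp
  qed
  have excl': "\<not> cn (X - {z}) (w i1) y" if y: "cn (X - {z}) (w i4) y" for y
  proof
    assume "cn (X - {z}) (w i1) y"
    then have "cn (X - {z}) (w i1) (w i4)" by (rule conn_trans[OF _ conn_sym[OF y]])
    then show False using n14 by simp
  qed
  consider (a) "cn (X - {z}) (w i1) (w i2)" "cn (X - {z}) (w i1) (w i3)"
    | (b) "cn (X - {z}) (w i4) (w i2)" "cn (X - {z}) (w i4) (w i3)"
    | (c) "cn (X - {z}) (w i1) (w i2)" "cn (X - {z}) (w i4) (w i3)"
    | (d) "cn (X - {z}) (w i4) (w i2)" "cn (X - {z}) (w i1) (w i3)"
    using side[OF all_on(2)] side[OF all_on(3)] by blast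
  then show ?thesis
  proof cases
    case a
    have "sat V g z"
      using excl[OF conn_refl] excl[OF a(1)] excl[OF a(2)]
      by (intro isolated_sat[OF zX _ all_on(4)]) auto
    then show ?thesis using z(2) by simp
  next
    case b
    have "sat V g z"
      using excl'[OF b(1)] excl'[OF b(2)] n14 by (intro isolated_sat[OF zX _ all_on(1)]) auto
    then show ?thesis using z(2) by simp
  next
    case c
    then show ?thesis
      using that[OF zX c(1) conn_sym[OF c(2)] excl'[OF c(2)]] by blast
  next
    \<comment> \<open>In this split both side paths satisfy \<open>(V, g)\<close>. As
      \<open>{i1, i3}\<close> and \<open>{i2, i4}\<close> are related under \<open>(V, g)\<close>
      but not under \<open>(U, f)\<close>, \<open>V\<close> is off at both pairs, which would relate
      \<open>i1\<close> and \<open>i2\<close>.\<close>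
    case d
    have "cn (X - {z}) (w i2) (w i4)" using conn_sym[OF d(1)] .
    moreover have "\<not> cn (X - {z}) (w i1) (w i2)" using excl'[OF d(1)] .
    ultimately obtain A where A: "A \<subseteq> X" "sats V g A" "cn A (w i1) (w i3)"
      using side_path_sat[of i1 i3 i2 i4 z] zX d(2) by blast
    have "\<not> cn (X - {z}) (w i2) (w i1)"
      using \<open>\<not> cn (X - {z}) (w i1) (w i2)\<close> conn_sym[of "ends R" "X - {z}" "w i2" "w i1"] by blast
    then obtain A' where A': "A' \<subseteq> X" "sats V g A'" "cn A' (w i2) (w i4)"
      using side_path_sat[of i2 i4 i1 i3 z] zX d(2) \<open>cn (X - {z}) (w i2) (w i4)\<close> by blast
    have "\<not> on V i1"
      using path_transfer[OF all_on(1,3) A(3,1,2)] g_rel(1) f_rel'(1) idx' by blast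
    moreover have "\<not> on V i2"
      using path_transfer[OF all_on(2,4) A'(3,1,2)] g_rel(2) f_rel'(2) idx' by blast
    ultimately have "rel V g i1 i2" using idx' by (simp add: rel_iff)
    then show ?thesis using g_rel(3) by simp
  qed
qed

section \<open>Assembling the handcuff\<close>

abbreviation "h12 \<equiv> Hat {i1, i2}"
abbreviation "h34 \<equiv> Hat {i3, i4}"

lemma path_verts:
  assumes "upath (ends R) vs es" "set es \<subseteq> edges R" "hd vs \<in> verts Gh"
  shows "set vs \<subseteq> verts Gh"
proof (cases "es = []")
  case True
  then have "vs = [hd vs]" using assms(1) by (auto simp: upath_iff length_Suc_conv)
  then have "set vs = {hd vs}" by (metis list.simps(15) empty_set)
  then show ?thesis using assms(3) by simp
next
  case False
  have "(\<Union>x\<in>set es. ends R x) \<subseteq> verts Gh"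
    using assms(2) ends_verts unfolding verts_R by blast
  then show ?thesis using upath_edge_verts[OF assms(1) False] by simp
qed

lemma path_cycle:
  assumes "upath (ends R) vs es" "hd vs = w i" "last vs = w j" "set es \<subseteq> X"
    "Hat {i, j} \<in> edges R" "Hat {i, j} \<notin> X" "i \<in> {1..m}" "\<not> lp i" "\<not> lp j"
  shows "is_cycle Gh (insert (Hat {i, j}) (set es))"
    "edge_verts Gh (insert (Hat {i, j}) (set es)) = set vs"
proof -
  have E: "set es \<subseteq> edges R" using assms(4) ind_E[OF X_ind] by blast
  have vsV: "set vs \<subseteq> verts Gh"
    using path_verts[OF assms(1) E] assms(2,7,8) ends_e[of i] by (simp add: verts_Gh)
  have up: "upath (ends Gh) vs es" using assms(1) by (simp add: ends_R)
  show "is_cycle Gh (insert (Hat {i, j}) (set es))"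
    using assms E vsV edges_R ends_Hat[of i j] by (intro cycleI[OF up]) auto
  have "edge_verts Gh (insert (Hat {i, j}) (set es)) = {w i, w j} \<union> (\<Union>x\<in>set es. ends R x)"
    using assms(8,9) ends_Hat[of i j] by (simp add: edge_verts_def ends_R)
  also have "\<dots> = set vs"
  proof (cases "es = []")
    case True
    then obtain y where "vs = [y]" using assms(1) by (auto simp: upath_iff length_Suc_conv)
    then show ?thesis using True assms(2,3) by simp
  next
    case False
    have "vs \<noteq> []" by (rule upath_nonempty[OF assms(1)])
    then have "{w i, w j} \<subseteq> set vs"
      using hd_in_set[of vs] last_in_set[of vs] unfolding assms(2,3) by simp
    then show ?thesis using upath_edge_verts[OF assms(1) False] by blast
  qed
  finally show "edge_verts Gh (insert (Hat {i, j}) (set es)) = set vs" .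
qed

text \<open>The separating edge yields disjoint paths from \<open>w i1\<close> to
  \<open>w i2\<close> and from \<open>w i3\<close> to \<open>w i4\<close>, closed up by
  \<open>h12\<close> and \<open>h34\<close>, and a further path of \<open>X\<close> connects them.
  Exchanges force every edge of this handcuff into \<open>C\<close>, and a closure argument excludes
  all others.\<close>

lemma circuit_is_handcuff:
  assumes b12: "bas (insert h12 X)" and b34: "bas (insert h34 X)" and nX: "h12 \<notin> X" "h34 \<notin> X"
    and C: "is_circuit (edges R) {B. bas B} C" "C \<subseteq> insert h12 (insert h34 X)"
  shows "\<exists>D1 D2. cycles_joined_by_path Gh (edge_induced Gh C) D1 D2 \<and>
    card (D1 \<inter> {h12, h34}) = 1 \<and> card (D2 \<inter> {h12, h34}) = 1"
proof -
  have hE: "h12 \<in> edges R" "h34 \<in> edges R" using b12 b34 bas_E by blast+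
  have XE: "X \<subseteq> edges R" by (rule ind_E[OF X_ind])
  have hC: "h12 \<in> C" "h34 \<in> C" using circuit_mem_iff[OF b12 b34 nX C] by simp_all
  have ne: "h12 \<noteq> h34" using idx' by (simp add: doubleton_eq_iff)
  have lps: "\<not> lp i1" "\<not> lp i2" "\<not> lp i3" "\<not> lp i4" and wU: "w i1 \<in> U" "w i2 \<in> U" "w i3 \<in> U"
    using all_on by (simp_all add: on_def)
  have rel12: "rel T s i1 i2 \<longleftrightarrow> sat T s h12" and rel34: "rel T s i3 i4 \<longleftrightarrow> sat T s h34" for T s
    using hE by (simp_all add: rel_def)
  \<comment> \<open>Without \<open>z\<close>, the circuit would be contained in a basis, namely the
    one obtained by exchanging \<open>z\<close>.\<close>
  have in_C: "z \<in> C" if z: "z \<in> X" and s: "sats T s (X - {z})" "rel T s i1 i2 \<noteq> rel T s i3 i4" for z T s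
  proof (rule ccontr)
    assume "z \<notin> C"
    then have "C \<subseteq> insert h12 (insert h34 (X - {z}))" using C(2) by blast
    moreover have "bas (insert h12 (insert h34 (X - {z})))"
      using bas_exchange_sat[OF b12 b34 nX z s(1)] s(2) rel12 rel34 by simp
    ultimately show False using C(1) by (auto simp: is_circuit_def)
  qed
  have cut_in_C: "z \<in> C" if z: "z \<in> X"
    and c: "on (U \<inter> {y. cn (X - {z}) x y}) i1 \<or> on (U \<inter> {y. cn (X - {z}) x y}) i2 \<or>
        on (U \<inter> {y. cn (X - {z}) x y}) i3 \<or> on (U \<inter> {y. cn (X - {z}) x y}) i4"
      "cn (X - {z}) x (w i1) \<or> cn (X - {z}) x (w i2) \<longrightarrow>
        \<not> cn (X - {z}) x (w i3) \<and> \<not> cn (X - {z}) x (w i4)" for z x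
  proof -
    define T where "T = U \<inter> {y. cn (X - {z}) x y}"
    have "sats U f (X - {z})" using f_X by (rule sats_mono) blast
    then have T: "sats T f (X - {z})" unfolding T_def by (rule sats_restrict[OF sep_comp])
    have onT: "on T i \<longleftrightarrow> on U i \<and> cn (X - {z}) x (w i)" for i by (auto simp: on_def T_def)
    \<comment> \<open>Neither pair is balanced, so the restricted potential violates exactly the
      pair it touches and is zero on the other.\<close>
    have "\<not> bal f i1 i2" "\<not> bal f i3 i4"
      using f_rel(3) f_rel'(3) all_on idx' by (simp_all add: rel_iff)
    then have "rel T f i1 i2 \<noteq> rel T f i3 i4"
      using c[folded T_def] all_on idx' by (auto simp: rel_iff onT)
    then show ?thesis by (rule in_C[OF z T])
  qed
  obtain z0 where z0: "z0 \<in> X" "cn (X - {z0}) (w i1) (w i2)" "cn (X - {z0}) (w i3) (w i4)"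
      "\<not> cn (X - {z0}) (w i1) (w i3)"
    by (rule separating_edge)
  obtain vs1 es1 where p1: "upath (ends R) vs1 es1" "hd vs1 = w i1" "last vs1 = w i2" "set es1 \<subseteq> X - {z0}"
    using conn_imp_upath[OF z0(2)] by blast
  obtain vs2 es2 where p2: "upath (ends R) vs2 es2" "hd vs2 = w i3" "last vs2 = w i4" "set es2 \<subseteq> X - {z0}"
    using conn_imp_upath[OF z0(3)] by blast
  have disj: "set vs1 \<inter> set vs2 = {}"
  proof (rule ccontr)
    assume "set vs1 \<inter> set vs2 \<noteq> {}"
    then obtain y where y: "y \<in> set vs1" "y \<in> set vs2" by blast
    have "cn (X - {z0}) (w i1) y" "cn (X - {z0}) (w i3) y"
      using conn_mono[OF upath_conn_mem[OF p1(1) y(1)] p1(4)]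
        conn_mono[OF upath_conn_mem[OF p2(1) y(2)] p2(4)] p1(2) p2(2) by simp_all
    then have "cn (X - {z0}) (w i1) (w i3)" by (rule conn_trans[OF _ conn_sym])
    then show False using z0(4) by simp
  qed
  have sub1: "set es1 \<subseteq> X" and sub2: "set es2 \<subseteq> X" using p1(4) p2(4) by blast+
  have mem: "w i1 \<in> set vs1" "w i3 \<in> set vs2"
    using hd_in_set[OF upath_nonempty[OF p1(1)]] hd_in_set[OF upath_nonempty[OF p2(1)]] p1(2) p2(2)
    by simp_all
  obtain vs es where p: "upath (ends R) vs es" "set es \<subseteq> X" "hd vs \<in> set vs1" "last vs \<in> set vs2"
      "set vs \<inter> set vs1 = {hd vs}" "set vs \<inter> set vs2 = {last vs}"
    using connecting_path[OF on_conn[OF all_on(1,3)] mem] by blast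
  have es_ne: "es \<noteq> []"
  proof
    assume "es = []"
    then obtain y where "vs = [y]" using p(1) by (auto simp: upath_iff length_Suc_conv)
    then show False using p(3,4) disj by auto
  qed
  have ends_ne: "\<exists>y. y \<in> ends R x" if "x \<in> X" for x
    using two_ends[of x] that XE by blast
  have dis12: "set es1 \<inter> set es2 = {}"
  proof (rule ccontr)
    assume "set es1 \<inter> set es2 \<noteq> {}"
    then obtain x where x: "x \<in> set es1" "x \<in> set es2" by blast
    obtain y where "y \<in> ends R x" using ends_ne[of x] x sub1 by blast
    then show False using upath_ends[OF p1(1) x(1)] upath_ends[OF p2(1) x(2)] disj by blast
  qed
  \<comment> \<open>An edge of the connecting path has two different ends, but this path shares only
    one vertex with either side path.\<close>
  have dis3: "x \<notin> set es1" "x \<notin> set es2" if x: "x \<in> set es" for x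
  proof -
    obtain a b where ab: "a \<noteq> b" "ends R x = {a, b}" using upath_card_ends[OF p(1) x] by blast
    have abv: "{a, b} \<subseteq> set vs" using upath_ends[OF p(1) x] ab by simp
    show "x \<notin> set es1"
    proof
      assume "x \<in> set es1"
      then have "{a, b} \<subseteq> {hd vs}" using upath_ends[OF p1(1)] ab abv p(5) by blast
      then show False using ab(1) by blast
    qed
    show "x \<notin> set es2"
    proof
      assume "x \<in> set es2"
      then have "{a, b} \<subseteq> {last vs}" using upath_ends[OF p2(1)] ab abv p(6) by blast
      then show False using ab(1) by blast
    qed
  qed
  have es1_C: "z \<in> C" if z: "z \<in> set es1" for z
  proof -
    have zX: "z \<in> X" using z sub1 by blast
    have nc: "\<not> cn (X - {z}) (w i1) (w i2)"
      using path_cut[OF X_ind f_X p1(1) sub1 z] p1(2,3) wU by simp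
    have "set es2 \<subseteq> X - {z}" using sub2 z dis12 by blast
    then have c34: "cn (X - {z}) (w i3) (w i4)"
      using conn_mono[OF upath_conn[OF p2(1)]] p2(2,3) by simp
    \<comment> \<open>\<open>i3\<close> and \<open>i4\<close> stay together, so at least one of
      \<open>i1\<close> and \<open>i2\<close> is cut off from all the other indices.\<close>
    show ?thesis
    proof (cases "cn (X - {z}) (w i1) (w i3)")
      case False
      moreover from this have "\<not> cn (X - {z}) (w i1) (w i4)"
        using conn_trans[OF _ conn_sym[OF c34]] by blast
      ultimately show ?thesis
        using nc all_on(1) by (intro cut_in_C[OF zX, of "w i1"]) (simp_all add: on_def)
    next
      case True
      have "\<not> cn (X - {z}) (w i2) (w i3)"
        using conn_trans[OF True conn_sym] nc by blast
      moreover from this have "\<not> cn (X - {z}) (w i2) (w i4)"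
        using conn_trans[OF _ conn_sym[OF c34]] by blast
      ultimately show ?thesis
        using all_on(2) by (intro cut_in_C[OF zX, of "w i2"]) (simp_all add: on_def)
    qed
  qed
  have es2_C: "z \<in> C" if z: "z \<in> set es2" for z
  proof -
    have zX: "z \<in> X" using z sub2 by blast
    have nc: "\<not> cn (X - {z}) (w i3) (w i4)"
      using path_cut[OF X_ind f_X p2(1) sub2 z] p2(2,3) wU by simp
    have "set es1 \<subseteq> X - {z}" using sub1 z dis12 by blast
    then have c12: "cn (X - {z}) (w i1) (w i2)"
      using conn_mono[OF upath_conn[OF p1(1)]] p1(2,3) by simp
    show ?thesis
    proof (cases "cn (X - {z}) (w i3) (w i1)")
      case False
      moreover from this have "\<not> cn (X - {z}) (w i3) (w i2)"
        using conn_trans[OF _ conn_sym[OF c12]] by blast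
      ultimately show ?thesis
        using nc all_on(3) by (intro cut_in_C[OF zX, of "w i3"]) (simp_all add: on_def)
    next
      case True
      have "\<not> cn (X - {z}) (w i4) (w i1)"
        using conn_trans[OF True conn_sym] nc by blast
      moreover from this have "\<not> cn (X - {z}) (w i4) (w i2)"
        using conn_trans[OF _ conn_sym[OF c12]] by blast
      ultimately show ?thesis
        using all_on(4) by (intro cut_in_C[OF zX, of "w i4"]) (simp_all add: on_def)
    qed
  qed
  have es_C: "z \<in> C" if z: "z \<in> set es" for z
  proof -
    have zX: "z \<in> X" using z p(2) by blast
    \<comment> \<open>Both side paths survive the deletion of \<open>z\<close>, so each pair stays
      together and only the two pairs are separated.\<close>
    have s1: "set es1 \<subseteq> X - {z}" and s2: "set es2 \<subseteq> X - {z}"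
      using sub1 sub2 dis3[OF z] by blast+
    have c1: "cn (X - {z}) (w i1) (hd vs)"
      using conn_mono[OF upath_conn_mem[OF p1(1) p(3)] s1] p1(2) by simp
    have c2: "cn (X - {z}) (w i3) (last vs)"
      using conn_mono[OF upath_conn_mem[OF p2(1) p(4)] s2] p2(2) by simp
    have c34: "cn (X - {z}) (w i3) (w i4)"
      using conn_mono[OF upath_conn[OF p2(1)] s2] p2(2,3) by simp
    have "hd vs \<in> U"
    proof -
      have "cn X (w i1) (hd vs)" using c1 by (rule conn_mono) blast
      then show ?thesis using sats_conn[OF f_X, of "w i1" "hd vs"] wU by simp
    qed
    then have nc: "\<not> cn (X - {z}) (hd vs) (last vs)"
      by (rule path_cut[OF X_ind f_X p(1,2) z])
    have n13: "\<not> cn (X - {z}) (w i1) (w i3)"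
    proof
      assume "cn (X - {z}) (w i1) (w i3)"
      then have "cn (X - {z}) (hd vs) (last vs)"
        by (rule conn_trans[OF conn_join[OF c1] c2])
      then show False using nc by simp
    qed
    moreover from this have "\<not> cn (X - {z}) (w i1) (w i4)"
      using conn_trans[OF _ conn_sym[OF c34]] by blast
    ultimately show ?thesis
      using all_on(1) by (intro cut_in_C[OF zX, of "w i1"]) (simp_all add: on_def)
  qed
  define Z where "Z = set es1 \<union> set es2 \<union> set es"
  have ZX: "Z \<subseteq> X" using sub1 sub2 p(2) by (auto simp: Z_def)
  \<comment> \<open>The cycle through \<open>h34\<close> is unbalanced, so a potential satisfying
    \<open>h34\<close> and \<open>Z\<close> vanishes at \<open>w i3\<close> and, by connectedness,
    on the whole handcuff; hence it satisfies \<open>h12\<close>.\<close>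
  have h12_span: "h12 \<in> span (insert h34 Z)"
  proof (rule spanI[OF hE(1)])
    fix T s assume s: "sats T s (insert h34 Z)"
    have sZ: "sats T s Z" "sats T s (set es2)" using s by (auto simp: sats_def Z_def)
    have f2: "sats U f (set es2)" using f_X sub2 by (rule sats_mono)
    have Zc: "cn Z a b" if "cn (set es1) a b \<or> cn (set es2) a b \<or> cn (set es) a b" for a b
      using that by (auto simp: Z_def elim: conn_mono)
    have c34: "cn (set es2) (w i3) (w i4)" using upath_conn[OF p2(1)] p2(2,3) by simp
    have n3: "w i3 \<notin> T"
    proof
      assume T3: "w i3 \<in> T"
      have "bal f i3 i4 \<longleftrightarrow> bal s i3 i4"
        by (rule bal_scale[OF sats_scale[OF f2 sZ(2) c34 wU(3) T3]])
      moreover have "rel T s i3 i4" using s rel34 by (simp add: sats_insert)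
      ultimately have "bal f i3 i4"
        using T3 lps idx' by (simp add: rel_iff on_def)
      then show False using f_rel'(3) all_on idx' by (simp add: rel_iff)
    qed
    have k1: "cn Z (w i1) (hd vs)" "cn Z (w i1) (w i2)" "cn Z (w i3) (last vs)" "cn Z (hd vs) (last vs)"
      using upath_conn_mem[OF p1(1) p(3)] upath_conn[OF p1(1)] upath_conn_mem[OF p2(1) p(4)]
        upath_conn[OF p(1)] p1(2,3) p2(2) Zc by simp_all
    have "cn Z (w i3) (w i1)"
      by (rule conn_trans[OF conn_trans[OF k1(3) conn_sym[OF k1(4)]] conn_sym[OF k1(1)]])
    then have "w i1 \<notin> T" using sats_conn[OF sZ(1)] n3 by blast
    moreover from this have "w i2 \<notin> T" using sats_conn[OF sZ(1) k1(2)] by blast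
    ultimately have "rel T s i1 i2" using idx' by (simp add: rel_iff on_def)
    then show "sat T s h12" by (simp add: rel12)
  qed
  have "C \<subseteq> insert h12 (insert h34 Z)"
  proof
    fix c assume c: "c \<in> C"
    show "c \<in> insert h12 (insert h34 Z)"
    proof (rule ccontr)
      assume nc: "c \<notin> insert h12 (insert h34 Z)"
      then have cX: "c \<in> X" using c C(2) by blast
      have E: "insert h34 (X - {c}) \<subseteq> edges R" using hE XE by blast
      \<comment> \<open>A further edge \<open>c\<close> of \<open>C\<close> would lie in the closure
        of \<open>insert h34 (X - {c})\<close>, although \<open>insert h34 X\<close> is
        independent.\<close>
      have "span (insert h34 Z) \<subseteq> span (insert h34 (X - {c}))"
        using nc ZX E by (intro cl_mono) auto
      then have "C - {c} \<subseteq> span (insert h34 (X - {c}))"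
        using h12_span C(2) extensive[OF E] by blast
      then have "c \<in> span (insert h34 (X - {c}))"
        using circuit_cl[OF C(1) c] cl_least by blast
      moreover have "insert h34 X - {c} = insert h34 (X - {c})" using nc by blast
      ultimately show False using bas_ind[OF b34] cX by (auto simp: ind_def)
    qed
  qed
  moreover have "insert h12 (insert h34 Z) \<subseteq> C"
    using hC es1_C es2_C es_C by (auto simp: Z_def)
  ultimately have C_eq: "C = insert h12 (set es1) \<union> insert h34 (set es2) \<union> set es"
    by (auto simp: Z_def)
  note D1 = path_cycle[OF p1(1-3) sub1 hE(1) nX(1) idx'(1) lps(1,2)]
  note D2 = path_cycle[OF p2(1-3) sub2 hE(2) nX(2) idx'(3) lps(3,4)]
  have esR: "set es \<subseteq> edges R" using p(2) XE by blast
  have vs1R: "set vs1 \<subseteq> verts Gh"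
  proof (rule path_verts[OF p1(1)])
    show "set es1 \<subseteq> edges R" using sub1 XE by blast
    show "hd vs1 \<in> verts Gh" using p1(2) ends_e[OF idx'(1) lps(1)] by (simp add: verts_Gh)
  qed
  have "is_path Gh vs es"
    unfolding is_path_def
    using p(1) path_verts[OF p(1) esR] p(3) vs1R esR edges_R
    by (auto simp: upath_iff ends_R)
  moreover have "edge_verts Gh (set es) = set vs"
    using upath_edge_verts[OF p(1) es_ne] by (simp add: edge_verts_def ends_R)
  then have "edge_verts Gh C = set vs1 \<union> set vs2 \<union> set vs"
    unfolding C_eq D1(2)[symmetric] D2(2)[symmetric] by (simp add: edge_verts_def Un_ac)
  ultimately have "cycles_joined_by_path Gh (edge_induced Gh C) (insert h12 (set es1)) (insert h34 (set es2))"
    unfolding cycles_joined_by_path_def D1(2) D2(2)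
    using D1(1) D2(1) disj p(5,6) es_ne C_eq by (intro conjI exI[of _ vs] exI[of _ es]) simp_all
  moreover have one: "insert h12 (set es1) \<inter> {h12, h34} = {h12}"
      "insert h34 (set es2) \<inter> {h12, h34} = {h34}"
    using nX sub1 sub2 ne by auto
  have "card (insert h12 (set es1) \<inter> {h12, h34}) = 1" "card (insert h34 (set es2) \<inter> {h12, h34}) = 1"
    unfolding one by simp_all
  ultimately show ?thesis by blast
qed

end

section \<open>Switching\<close>

lemma non_incident_Hat: "non_incident (Hat P) (Hat Q) \<longleftrightarrow> P \<inter> Q = {}"
  by (simp add: non_incident_def)

text \<open>Both transformations around the exchange are identities, with \<open>a\<close> and
  \<open>b\<close> as the prescribed edges.\<close>

lemma switch_stepI:
  assumes "viable \<B> H A" "viable \<B> H B" "a \<noteq> b"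
    "(fst A \<union> snd A) \<inter> H = {a, b}" "(fst B \<union> snd B) \<inter> H = {a, b}" "sym_exchange \<B> A B"
  shows "switch_step \<B> H A B"
proof -
  have "a \<in> H" "b \<in> H" using assms(4) by blast+
  then have "transforms \<B> H a b A A" "transforms \<B> H a b B B"
    using assms by (simp_all add: transforms_def viable_def)
  then show ?thesis
    using assms unfolding switch_step_def by blast
qed

section \<open>Bases excluded by non-switchability\<close>

locale non_switchable =
  fixes \<B> :: "'e hat_edge set set" and H X1 X2 :: "'e hat_edge set" and a b :: "'e hat_edge"
  assumes bases: "insert a X1 \<in> \<B>" "insert b X2 \<in> \<B>" "insert a X1 \<inter> insert b X2 = {}"
    and H: "a \<in> H" "b \<in> H" "X1 \<inter> H = {}" "X2 \<inter> H = {}"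
    and non_inc: "non_incident a b"
    and not_switch: "\<not> switchable \<B> H a b (insert a X1, insert b X2)"
begin

lemma neq: "a \<noteq> b" "a \<notin> X2" "b \<notin> X1" "a \<notin> X1" "b \<notin> X2"
  using bases H by blast+

lemma not_amenable:
  assumes "(switch_step \<B> H)\<^sup>*\<^sup>* (insert a X1, insert b X2) B"
    "a' \<in> H - {a, b}" "b' \<in> H - {a, b}" "non_incident a' b'"
  shows "\<not> amenable \<B> H a' b' B"
proof
  assume am: "amenable \<B> H a' b' B"
  have F: "a \<in> F_set \<B> H (insert a X1)" "b \<in> F_set \<B> H (insert b X2)"
  proof -
    have "insert a X1 - H \<union> {a} = insert a X1" "insert b X2 - H \<union> {b} = insert b X2"
      using H by blast+
    then show "a \<in> F_set \<B> H (insert a X1)" "b \<in> F_set \<B> H (insert b X2)"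
      using bases H by (simp_all add: F_set_def)
  qed
  have "disjoint_bases \<B> (insert a X1, insert b X2)"
    using bases by (simp add: disjoint_bases_def)
  then have "switchable \<B> H a b (insert a X1, insert b X2)"
    using F non_inc assms am unfolding switchable_def fst_conv snd_conv by blast
  then show False using not_switch by simp
qed

lemma viable_start: "viable \<B> H (insert a X1, insert b X2)"
  and start_H: "(insert a X1 \<union> insert b X2) \<inter> H = {a, b}"
proof -
  show H_eq: "(insert a X1 \<union> insert b X2) \<inter> H = {a, b}" using H by blast
  then show "viable \<B> H (insert a X1, insert b X2)"
    unfolding viable_def using bases non_inc neq by (auto simp: disjoint_bases_def)
qed

text \<open>The chain of length zero: replacing \<open>a\<close> by \<open>a'\<close> and
  \<open>b\<close> by \<open>b'\<close> would show that the given pair is amenable.\<close>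

lemma no_direct_switch:
  assumes "a' \<in> H - {a, b}" "b' \<in> H - {a, b}" "non_incident a' b'" "a' \<noteq> b'"
  shows "insert a' X1 \<notin> \<B> \<or> insert b' X2 \<notin> \<B>"
proof (rule ccontr)
  assume "\<not> ?thesis"
  then have B: "insert a' X1 \<in> \<B>" "insert b' X2 \<in> \<B>" by simp_all
  have "transforms \<B> H a' b' (insert a X1, insert b X2) (insert a' X1, insert b' X2)"
    unfolding transforms_def disjoint_bases_def using assms B bases H by auto
  then show False
    using not_amenable[OF rtranclp.rtrancl_refl assms(1-3)] by (auto simp: amenable_def)
qed

text \<open>Exchanging \<open>a\<close> with \<open>z\<close> puts \<open>a\<close> and
  \<open>b\<close> into the second basis, and the pair stays viable for that reason. The excluded
  basis would make this new pair amenable.\<close>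

lemma no_switch_second:
  assumes "a' \<in> H - {a, b}" "b' \<in> H - {a, b}" "non_incident a' b'" "a' \<noteq> b'"
    and z: "z \<in> X2" "insert z X1 \<in> \<B>" "insert a (insert b (X2 - {z})) \<in> \<B>"
  shows "insert a' (insert b' (X2 - {z})) \<notin> \<B>"
proof
  assume B: "insert a' (insert b' (X2 - {z})) \<in> \<B>"
  let ?A = "(insert a X1, insert b X2)"
  let ?B = "(insert z X1, insert a (insert b (X2 - {z})))"
  have disj: "X1 \<inter> X2 = {}" and zH: "z \<notin> H" using bases H z by blast+
  have B_H: "(fst ?B \<union> snd ?B) \<inter> H = {a, b}" using H zH by auto
  have disj_B: "disjoint_bases \<B> ?B"
    unfolding disjoint_bases_def using z disj neq zH H by auto
  then have "viable \<B> H ?B"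
    unfolding viable_def using B_H neq(1) by auto
  moreover have "sym_exchange \<B> ?A ?B"
    unfolding sym_exchange_def
  proof (intro conjI bexI)
    show "fst ?B = fst ?A - {a} \<union> {z}" using neq by auto
    show "snd ?B = snd ?A - {z} \<union> {a}" using zH H by auto
    show "a \<in> fst ?A - snd ?A" using neq by auto
    show "z \<in> snd ?A - fst ?A" using z disj zH H by auto
  qed (use bases z in simp_all)
  ultimately have "switch_step \<B> H ?A ?B"
    using viable_start start_H B_H neq(1) by (intro switch_stepI[of _ _ _ _ a b]) simp_all
  moreover have "transforms \<B> H a' b' ?B (insert z X1, insert a' (insert b' (X2 - {z})))"
    unfolding transforms_def using assms(1,2,4) disj_B z B H disj zH
    by (auto simp: disjoint_bases_def)
  ultimately show False
    using not_amenable[OF r_into_rtranclp assms(1-3)] by (auto simp: amenable_def)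
qed

end

section \<open>Symmetry in the two bases\<close>

lemma viable_swap: "viable \<B> H (B, A) \<longleftrightarrow> viable \<B> H (A, B)"
  by (auto simp: viable_def disjoint_bases_def Un_commute Int_commute)

lemma transforms_swap: "transforms \<B> H a b (B, A) (B', A') \<longleftrightarrow> transforms \<B> H a b (A, B) (A', B')"
  by (auto simp: transforms_def disjoint_bases_def Un_commute Int_commute)

lemma sym_exchange_swap: "sym_exchange \<B> (B, A) (B', A') \<longleftrightarrow> sym_exchange \<B> (A, B) (A', B')"
  unfolding sym_exchange_def by auto

lemma switch_step_swap: "switch_step \<B> H A B \<Longrightarrow> switch_step \<B> H (prod.swap A) (prod.swap B)"
proof -
  assume "switch_step \<B> H A B"
  then obtain c1 c2 A' B' where *: "viable \<B> H A" "viable \<B> H B" "viable \<B> H A'" "viable \<B> H B'"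
      "transforms \<B> H c1 c2 A A'" "transforms \<B> H c1 c2 B B'" "sym_exchange \<B> A' B'"
    unfolding switch_step_def by blast
  have "viable \<B> H (prod.swap P)" if "viable \<B> H P" for P
    using that viable_swap[of \<B> H "snd P" "fst P"] by (simp add: prod.swap_def)
  moreover have "transforms \<B> H c1 c2 (prod.swap P) (prod.swap Q)" if "transforms \<B> H c1 c2 P Q" for P Q
    using that transforms_swap[of \<B> H c1 c2 "snd P" "fst P" "snd Q" "fst Q"] by (simp add: prod.swap_def)
  moreover have "sym_exchange \<B> (prod.swap A') (prod.swap B')"
    using *(7) sym_exchange_swap[of \<B> "snd A'" "fst A'" "snd B'" "fst B'"] by (simp add: prod.swap_def)
  ultimately show ?thesis
    unfolding switch_step_def using *(1-6) by blast
qed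

text \<open>Steps, transformations and exchanges do not depend on the order within a pair, so a
  whole chain can be swapped.\<close>

lemma switchable_swap:
  assumes "switchable \<B> H b a (B2, B1)"
  shows "switchable \<B> H a b (B1, B2)"
proof -
  obtain B' a' b' where *: "(switch_step \<B> H)\<^sup>*\<^sup>* (B2, B1) B'" "a' \<in> H - {b, a}" "b' \<in> H - {b, a}"
      "non_incident a' b'" "amenable \<B> H a' b' B'"
    using assms unfolding switchable_def by blast
  have "(switch_step \<B> H)\<^sup>*\<^sup>* (prod.swap (B2, B1)) (prod.swap B')"
    using *(1) by (induction rule: rtranclp_induct) (auto dest: switch_step_swap intro: rtranclp.rtrancl_into_rtrancl)
  moreover obtain P where "transforms \<B> H a' b' B' P" using *(5) by (auto simp: amenable_def)
  then have "transforms \<B> H a' b' (prod.swap B') (prod.swap P)"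
    using transforms_swap[of \<B> H a' b' "snd B'" "fst B'" "snd P" "fst P"] by (simp add: prod.swap_def)
  then have "amenable \<B> H a' b' (prod.swap B')" unfolding amenable_def by blast
  moreover have "a' \<in> H - {a, b}" "b' \<in> H - {a, b}" using *(2,3) by blast+
  ultimately have ex: "\<exists>B'. (switch_step \<B> H)\<^sup>*\<^sup>* (B1, B2) B' \<and>
      (\<exists>a'\<in>H - {a, b}. \<exists>b'\<in>H - {a, b}. non_incident a' b' \<and> amenable \<B> H a' b' B')"
    using *(4) unfolding swap_simp by blast
  have "non_incident a b" "disjoint_bases \<B> (B1, B2)" "a \<in> F_set \<B> H B1" "b \<in> F_set \<B> H B2"
    using assms by (auto simp: switchable_def non_incident_def disjoint_bases_def)
  then show ?thesis
    unfolding switchable_def fst_conv snd_conv by (intro conjI ex)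
qed

section \<open>From excluded bases to the crossing configuration\<close>

context vertex_deletion
begin

lemma not_rel_bas:
  assumes "bas (insert b X)" "sats U f X" "\<not> sat U f b" "\<not> rel U f i j"
  shows "bas (insert (Hat {i, j}) X)"
  using hyperplane_bas_iff[OF assms(1-3), of "Hat {i, j}"] assms(4) by (simp add: rel_def)

text \<open>The pair containing the only index that is on is unrelated under \<open>(T, h)\<close>,
  while the other pair is off at both indices and so related.\<close>

lemma exchange_pair:
  assumes idx: "{i, j, k, l} \<subseteq> {1..m}" "distinct [i, j, k, l]"
    and b: "bas (insert (Hat {i, j}) X)" "bas (insert (Hat {k, l}) X)" "Hat {i, j} \<notin> X" "Hat {k, l} \<notin> X"
    and z: "z \<in> X" "sats T h (X - {z})" "\<exists>!x. x \<in> {i, j, k, l} \<and> on T x"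
  shows "bas (insert (Hat {i, j}) (insert (Hat {k, l}) (X - {z})))"
proof (rule bas_exchange_sat[OF b z(1,2)])
  have E: "Hat {i, j} \<in> edges R" "Hat {k, l} \<in> edges R" using b bas_E by blast+
  have "rel T h i j \<noteq> rel T h k l"
    using idx z(3) by (simp add: rel_iff) metis
  then show "sat T h (Hat {i, j}) \<noteq> sat T h (Hat {k, l})" using E by (simp add: rel_def)
qed

text \<open>The point is to verify \<open>unique_on\<close>. An edge \<open>z\<close> violating
  \<open>(V, g)\<close> may enter the other basis; if some potential on \<open>X - {z}\<close> were
  on at exactly one index, both \<open>{i1, i2}, {i3, i4}\<close> and
  \<open>{i1, i3}, {i2, i4}\<close> would complete \<open>X - {z}\<close> to a basis, against
  \<open>no_switch\<close>.\<close>

lemma handcuff_circuit: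
  assumes idx: "{i1, i2, i3, i4} \<subseteq> {1..m}" "distinct [i1, i2, i3, i4]"
    and X: "bas (insert b X)" "sats U f X" "\<not> sat U f b" "U = {y. conn (ends R) X r y}"
    and Y: "bas (insert a Y)" "sats V g Y" "\<not> sat V g a"
    and notin: "\<And>i j. i \<in> {i1, i2, i3, i4} \<Longrightarrow> j \<in> {i1, i2, i3, i4} \<Longrightarrow> Hat {i, j} \<notin> X"
    and f_rel: "rel U f i1 i4" "rel U f i2 i3" "\<not> rel U f i1 i2"
    and g_rel: "rel V g i1 i3" "rel V g i2 i4" "\<not> rel V g i1 i2"
    and no_switch: "\<And>z. \<lbrakk>z \<in> X; bas (insert z Y); bas (insert (Hat {i1, i2}) (insert (Hat {i3, i4}) (X - {z})))\<rbrakk>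
      \<Longrightarrow> \<not> bas (insert (Hat {i1, i3}) (insert (Hat {i2, i4}) (X - {z})))"
    and C: "hat_circuit G \<C> v e m C" "C \<subseteq> insert (Hat {i1, i2}) (insert (Hat {i3, i4}) X)"
  shows "\<exists>D1 D2. cycles_joined_by_path Gh (edge_induced Gh C) D1 D2 \<and>
    card (D1 \<inter> {Hat {i1, i2}, Hat {i3, i4}}) = 1 \<and> card (D2 \<inter> {Hat {i1, i2}, Hat {i3, i4}}) = 1"
proof -
  have idx': "i1 \<in> {1..m}" "i2 \<in> {1..m}" "i3 \<in> {1..m}" "i4 \<in> {1..m}"
    "i1 \<noteq> i2" "i1 \<noteq> i3" "i1 \<noteq> i4" "i2 \<noteq> i3" "i2 \<noteq> i4" "i3 \<noteq> i4"
    using idx by auto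
  have n13: "\<not> rel U f i1 i3"
    using rel_trans[of i1 i3 i2 U f] f_rel rel_sym idx' by metis
  have n24: "\<not> rel U f i2 i4"
    using rel_trans[of i2 i4 i1 U f] f_rel rel_sym idx' by metis
  have n34: "\<not> rel U f i3 i4"
    using rel_trans[of i1 i4 i3 U f] n13 f_rel rel_sym idx' by metis
  note bas_rel = not_rel_bas[OF X(1-3)]
  have X_ind: "ind X" using bas_ind[OF X(1)] ind_subset by blast
  have "sat V g z" if z: "z \<in> X" "sats T h (X - {z})" "\<exists>!i. i \<in> {i1, i2, i3, i4} \<and> on T i" for z T h
  proof (rule ccontr)
    assume "\<not> sat V g z"
    moreover have "z \<in> edges R" using z(1) ind_E[OF X_ind] by blast
    ultimately have "bas (insert z Y)" using hyperplane_bas_iff[OF Y] by blast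
    moreover have "bas (insert (Hat {i1, i2}) (insert (Hat {i3, i4}) (X - {z})))"
      using idx bas_rel f_rel(3) n34 notin z by (intro exchange_pair[of _ _ _ _ _ _ T h]) simp_all
    moreover have eq: "{i1, i3, i2, i4} = {i1, i2, i3, i4}" by blast
    have "bas (insert (Hat {i1, i3}) (insert (Hat {i2, i4}) (X - {z})))"
      using idx idx' bas_rel n13 n24 notin z unfolding eq[symmetric]
      by (intro exchange_pair[of _ _ _ _ _ _ T h]) auto
    ultimately show False using no_switch[OF z(1)] by blast
  qed
  then interpret crossing G \<C> v e m i1 i2 i3 i4 X U V f g r
    using idx X_ind X f_rel g_rel by unfold_locales
  show ?thesis
  proof (rule circuit_is_handcuff)
    show "is_circuit (edges R) {B. bas B} C"
      using C(1) by (simp add: hat_circuit_def hat_bases_eq)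
  qed (use bas_rel f_rel(3) n34 notin C(2) in simp_all)
qed

end

theorem theorem5p6:
  fixes G :: "('v, 'e) mgraph" and \<C> :: "'e set set" and v :: 'v
    and e :: "nat \<Rightarrow> 'e" and m i1 i2 i3 i4 :: nat and I :: "nat set"
    and B1 B2 C1 C2 H :: "'e hat_edge set"
  assumes "biased_graph G \<C>" and "linear_bias G \<C>"
    and no_balanced_loops: "\<And>f. f \<in> edges G \<Longrightarrow> is_loop G f \<Longrightarrow> {f} \<notin> \<C>"
    and "v \<in> verts G" and "bij_betw e {1..m} (edges_at G v)"
    and "disjoint_bases (hat_bases G \<C> v e m) (B1, B2)"
    and "I = {i1, i2, i3, i4}" and "I \<subseteq> {1..m}" and "card I = 4"
    and "H = H_edges G e m I"
    and "B1 \<inter> H = {Hat {i1, i2}}" and "B2 \<inter> H = {Hat {i3, i4}}"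
    and "hat_circuit G \<C> v e m C1"
    and "C1 \<subseteq> B1 \<union> {Hat {i1, i2}, Hat {i3, i4}}"
    and "hat_circuit G \<C> v e m C2"
    and "C2 \<subseteq> B2 \<union> {Hat {i1, i2}, Hat {i3, i4}}"
    and "\<not> switchable (hat_bases G \<C> v e m) H (Hat {i1, i2}) (Hat {i3, i4}) (B1, B2)"
  shows "\<forall>C\<in>{C1, C2}. \<exists>D1 D2.
     cycles_joined_by_path (hat_graph G v e m) (edge_induced (hat_graph G v e m) C) D1 D2 \<and>
     card (D1 \<inter> {Hat {i1, i2}, Hat {i3, i4}}) = 1 \<and>
     card (D2 \<inter> {Hat {i1, i2}, Hat {i3, i4}}) = 1"
proof -
  interpret vertex_deletion G \<C> v e m
    using assms(1-5) by unfold_locales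
  have dist: "distinct [i1, i2, i3, i4]"
    using assms(7,9) card_distinct[of "[i1, i2, i3, i4]"] by simp
  have idx: "{i1, i2, i3, i4} \<subseteq> {1..m}" using assms(7,8) by simp
  have idx': "i1 \<in> {1..m}" "i2 \<in> {1..m}" "i3 \<in> {1..m}" "i4 \<in> {1..m}"
    "i1 \<noteq> i2" "i1 \<noteq> i3" "i1 \<noteq> i4" "i2 \<noteq> i3" "i2 \<noteq> i4" "i3 \<noteq> i4"
    using idx dist by auto
  let ?h12 = "Hat {i1, i2} :: 'e hat_edge" and ?h34 = "Hat {i3, i4} :: 'e hat_edge"
  define X1 where "X1 = B1 - {?h12}"
  define X2 where "X2 = B2 - {?h34}"
  have B: "B1 = insert ?h12 X1" "B2 = insert ?h34 X2"
    using assms(11,12) unfolding X1_def X2_def by blast+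
  have h: "?h12 \<in> H" "?h34 \<in> H" and XH: "X1 \<inter> H = {}" "X2 \<inter> H = {}"
    using assms(11,12) unfolding X1_def X2_def by blast+
  have bas: "bas (insert ?h12 X1)" "bas (insert ?h34 X2)"
    and disj: "insert ?h12 X1 \<inter> insert ?h34 X2 = {}"
    using assms(6) B by (simp_all add: disjoint_bases_def hat_bases_eq)
  have non_inc: "non_incident ?h12 ?h34"
    using dist by (auto simp: non_incident_def)
  interpret S: non_switchable "{B. bas B}" H X1 X2 ?h12 ?h34
    using bas disj h XH non_inc assms(17) B by unfold_locales (simp_all add: hat_bases_eq)
  \<comment> \<open>With the bases interchanged, edges of \<open>X1\<close> can be moved into the
    second basis as well.\<close>
  interpret S': non_switchable "{B. bas B}" H X2 X1 ?h34 ?h12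
  proof unfold_locales
    show "\<not> switchable {B. bas B} H ?h34 ?h12 (insert ?h34 X2, insert ?h12 X1)"
      using S.not_switch switchable_swap by blast
    show "non_incident ?h34 ?h12" using non_inc by (auto simp: non_incident_def)
  qed (use bas disj h XH in auto)
  have in_H: "Hat {i, j} \<in> H" if "i \<in> {i1, i2, i3, i4}" "j \<in> {i1, i2, i3, i4}" "Hat {i, j} \<in> edges R" for i j
    using that assms(7,10) by (auto simp: H_edges_def edges_R edges_Gh)
  have XE: "X1 \<subseteq> edges R" "X2 \<subseteq> edges R" using bas bas_E by blast+
  have notin: "Hat {i, j} \<notin> X1" "Hat {i, j} \<notin> X2" if "i \<in> {i1, i2, i3, i4}" "j \<in> {i1, i2, i3, i4}" for i j
    using in_H[OF that] XE XH by blast+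
  have hE: "?h12 \<in> edges R" "?h34 \<in> edges R" using bas bas_E by blast+
  \<comment> \<open>This provides the potentials of the hyperplanes spanned by \<open>X1\<close> and
    \<open>X2\<close>, which are then cut down to one component each.\<close>
  have "?h12 \<notin> span X1" "?h34 \<notin> span X2"
    using bas_not_cl[OF bas(1)] bas_not_cl[OF bas(2)] S.neq by blast+
  then obtain V0 g U0 f where g0: "sats V0 g X1" "\<not> sat V0 g ?h12" and f0: "sats U0 f X2" "\<not> sat U0 f ?h34"
    using spanI[OF hE(1), of X1] spanI[OF hE(2), of X2] by blast
  obtain s where g: "sats {y. conn (ends R) X1 s y} g X1" "\<not> sat {y. conn (ends R) X1 s y} g ?h12"
    using component_violation[OF hE(1) g0] by blast
  obtain r where f: "sats {y. conn (ends R) X2 r y} f X2" "\<not> sat {y. conn (ends R) X2 r y} f ?h34"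
    using component_violation[OF hE(2) f0] by blast
  define V where "V = {y. conn (ends R) X1 s y}"
  define U where "U = {y. conn (ends R) X2 r y}"
  note g = g[folded V_def] and f = f[folded U_def]
  note basX1 = not_rel_bas[OF bas(1) g] and basX2 = not_rel_bas[OF bas(2) f]
  \<comment> \<open>The two perfect matchings of the four indices other than the given one, each in
    both orders.\<close>
  define good where "good p q \<longleftrightarrow> (p, q) \<in> {(Hat {i1, i3}, Hat {i2, i4}), (Hat {i2, i4}, Hat {i1, i3}),
    (Hat {i1, i4}, Hat {i2, i3}), (Hat {i2, i3}, Hat {i1, i4})}" for p q :: "'e hat_edge"
  have good: "good (Hat {i1, i3}) (Hat {i2, i4})" "good (Hat {i2, i4}) (Hat {i1, i3})"
    "good (Hat {i1, i4}) (Hat {i2, i3})" "good (Hat {i2, i3}) (Hat {i1, i4})"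
    by (simp_all add: good_def)
  have good_ne: "non_incident p q" "p \<noteq> q" "p \<notin> {?h12, ?h34}" "q \<notin> {?h12, ?h34}" if "good p q" for p q
    using that idx' unfolding good_def by (auto simp: non_incident_Hat doubleton_eq_iff)
  have good_H: "p \<in> H - {?h12, ?h34}" "q \<in> H - {?h12, ?h34}"
    if p: "good p q" "p \<in> edges R" "q \<in> edges R" for p q
  proof -
    obtain i j k l where "p = Hat {i, j}" "q = Hat {k, l}" "{i, j, k, l} \<subseteq> {i1, i2, i3, i4}"
      using p(1) unfolding good_def by blast
    then have "p \<in> H" "q \<in> H" using in_H p(2,3) by simp_all
    then show "p \<in> H - {?h12, ?h34}" "q \<in> H - {?h12, ?h34}" using good_ne[OF p(1)] by blast+
  qed
  have direct: "\<not> (bas (insert p X1) \<and> bas (insert q X2))" if p: "good p q" for p q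
  proof
    assume b: "bas (insert p X1) \<and> bas (insert q X2)"
    then have "p \<in> edges R" "q \<in> edges R" using bas_E by blast+
    then show False
      using S.no_direct_switch[of p q] good_H[OF p] good_ne[OF p] b by simp
  qed
  have second: "\<not> bas (insert p (insert q (X2 - {z})))"
    if p: "good p q" and z: "z \<in> X2" "bas (insert z X1)" "bas (insert ?h12 (insert ?h34 (X2 - {z})))" for p q z
  proof
    assume b: "bas (insert p (insert q (X2 - {z})))"
    then have "p \<in> edges R" "q \<in> edges R" using bas_E by blast+
    then show False
      using S.no_switch_second[of p q z] good_H[OF p] good_ne[OF p] b z by simp
  qed
  have first: "\<not> bas (insert p (insert q (X1 - {z})))"
    if p: "good p q" and z: "z \<in> X1" "bas (insert z X2)" "bas (insert ?h12 (insert ?h34 (X1 - {z})))" for p q z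
  proof
    assume b: "bas (insert p (insert q (X1 - {z})))"
    then have "p \<in> edges R" "q \<in> edges R" using bas_E by blast+
    then show False
      using S'.no_switch_second[of p q z] good_H[OF p] good_ne[OF p] b z by (simp add: insert_commute)
  qed
  \<comment> \<open>For a good pair \<open>p\<close>, \<open>q\<close> one of
    \<open>insert p X1\<close> and \<open>insert q X2\<close> is not a basis, so the indices of
    \<open>p\<close> are related under \<open>(V, g)\<close> or those of \<open>q\<close> under
    \<open>(U, f)\<close>.\<close>
  have cover: "rel V g i1 i3 \<or> rel U f i2 i4" "rel V g i2 i4 \<or> rel U f i1 i3"
    "rel V g i1 i4 \<or> rel U f i2 i3" "rel V g i2 i3 \<or> rel U f i1 i4"
    using direct good basX1 basX2 by blast+
  have g12: "\<not> rel V g i1 i2" and f34: "\<not> rel U f i3 i4"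
    using g f hE by (simp_all add: rel_def)
  have excl: "\<not> (rel V g i1 i3 \<and> rel V g i2 i3)" "\<not> (rel V g i1 i4 \<and> rel V g i2 i4)"
    "\<not> (rel U f i1 i3 \<and> rel U f i1 i4)" "\<not> (rel U f i2 i3 \<and> rel U f i2 i4)"
    using rel_trans[of i1 i3 i2 V g] rel_trans[of i1 i4 i2 V g] rel_trans[of i3 i1 i4 U f]
      rel_trans[of i3 i2 i4 U f] g12 f34 rel_sym idx' by metis+
  \<comment> \<open>If \<open>(U, f)\<close> related \<open>i1\<close> and \<open>i2\<close>, their
    class would miss \<open>i3\<close> or \<open>i4\<close>; by \<open>cover\<close>,
    \<open>(V, g)\<close> would then relate both \<open>i1\<close> and \<open>i2\<close> to the
    other of these, against \<open>excl\<close>.\<close>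
  have f12: "\<not> rel U f i1 i2"
    using rel_trans[of i1 i2 i3 U f] rel_trans[of i1 i2 i4 U f] rel_trans[of i2 i1 i3 U f]
      rel_trans[of i2 i1 i4 U f] rel_sym[of U f i1 i2] excl cover idx' by metis
  have C1: "C1 \<subseteq> insert ?h12 (insert ?h34 X1)" and C2: "C2 \<subseteq> insert ?h12 (insert ?h34 X2)"
    using assms(14,16) B by blast+
  \<comment> \<open>For the second of the two circuits the roles of the partitions are reversed;
    interchanging \<open>i3\<close> and \<open>i4\<close> restores the expected form.\<close>
  have swap: "{i1, i2, i4, i3} = {i1, i2, i3, i4}" "{i4, i3} = {i3, i4}" by blast+
  have idx'': "{i1, i2, i4, i3} \<subseteq> {1..m}" "distinct [i1, i2, i4, i3]" using idx dist by auto
  \<comment> \<open>The two potentials thus induce the two crossing matchings, in one order or the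
    other.\<close>
  consider "rel V g i1 i3" "rel V g i2 i4" "rel U f i1 i4" "rel U f i2 i3"
    | "rel V g i1 i4" "rel V g i2 i3" "rel U f i1 i3" "rel U f i2 i4"
    using cover excl by argo
  then have "(\<exists>D1 D2. cycles_joined_by_path Gh (edge_induced Gh C1) D1 D2 \<and>
        card (D1 \<inter> {?h12, ?h34}) = 1 \<and> card (D2 \<inter> {?h12, ?h34}) = 1) \<and>
      (\<exists>D1 D2. cycles_joined_by_path Gh (edge_induced Gh C2) D1 D2 \<and>
        card (D1 \<inter> {?h12, ?h34}) = 1 \<and> card (D2 \<inter> {?h12, ?h34}) = 1)"
  proof cases
    case 1
    show ?thesis
    proof
      show "\<exists>D1 D2. cycles_joined_by_path Gh (edge_induced Gh C2) D1 D2 \<and>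
          card (D1 \<inter> {?h12, ?h34}) = 1 \<and> card (D2 \<inter> {?h12, ?h34}) = 1"
        by (rule handcuff_circuit[OF idx dist bas(2) f U_def bas(1) g notin(2) 1(3,4) f12 1(1,2) g12
              second[OF good(1)] assms(15) C2])
      show "\<exists>D1 D2. cycles_joined_by_path Gh (edge_induced Gh C1) D1 D2 \<and>
          card (D1 \<inter> {?h12, ?h34}) = 1 \<and> card (D2 \<inter> {?h12, ?h34}) = 1"
        by (rule handcuff_circuit[OF idx'' bas(1) g V_def bas(2) f _ 1(1,2) g12 1(3,4) f12 _ assms(13),
              unfolded swap, OF notin(1) first[OF good(3)] C1])
    qed
  next
    case 2
    show ?thesis
    proof
      show "\<exists>D1 D2. cycles_joined_by_path Gh (edge_induced Gh C1) D1 D2 \<and>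
          card (D1 \<inter> {?h12, ?h34}) = 1 \<and> card (D2 \<inter> {?h12, ?h34}) = 1"
        by (rule handcuff_circuit[OF idx dist bas(1) g V_def bas(2) f notin(1) 2(1,2) g12 2(3,4) f12
              first[OF good(1)] assms(13) C1])
      show "\<exists>D1 D2. cycles_joined_by_path Gh (edge_induced Gh C2) D1 D2 \<and>
          card (D1 \<inter> {?h12, ?h34}) = 1 \<and> card (D2 \<inter> {?h12, ?h34}) = 1"
        by (rule handcuff_circuit[OF idx'' bas(2) f U_def bas(1) g _ 2(3,4) f12 2(1,2) g12 _ assms(15),
              unfolded swap, OF notin(2) second[OF good(3)] C2])
    qed
  qed
  then show ?thesis by blast
qed

end
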